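(* Let $(R,\mathfrak m,k)$ be a commutative Noetherian local ring and let $M$ and $N$ be nonzero finitely generated $R$-modules. View $N$ as an $R\ltimes M$-module via the projection $R\ltimes M\to R$. Then: (i) $\beta_{0}^{R\ltimes M}(N)= \beta_{0}^{R}(N)$. (ii) $\beta_{1}^{R\ltimes M}(N)= \beta_{0}^{R}(N)\beta_{0}^{R}(M)+\beta_{1}^{R}(N)$. In particular, $\operatorname{edim}(R\ltimes M)= \beta_{0}^{R}(M)+\operatorname{edim}(R)$. (iii) $\beta_{2}^{R\ltimes M}(N)= \beta_{0}^{R}(N)\beta_{0}^{R}(M)^{2}+\beta_{0}^{R}(N)\beta_{1}^{R}(M)+\beta_{0}^{R}(M)\beta_{1}^{R}(N)+\beta_{2}^{R}(N)$. (iv) $\beta_{i}^{R\ltimes M}(N)\geq \beta_{0}^{R}(M)\beta_{i-1}^{R}(N)+\beta_{i}^{R}(N)$ for all $i\geq 0$, where $\beta_{-1}^R(N):=0$.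
   Context: For a commutative ring $R$ and an $R$-module $M$, the idealization $R\ltimes M$ is the commutative ring whose additive group is $R\oplus M$, with identity $(1,0)$ and multiplication $(r_1,m_1)(r_2,m_2)=(r_1r_2,\,r_1m_2+r_2m_1)$. If $(R,\mathfrak m,k)$ is Noetherian local and $M$ is finitely generated, then $R\ltimes M$ is a Noetherian local ring with maximal ideal $\mathfrak m\ltimes M$ and residue field $k$. The projection $R\ltimes M\to R$, $(r,m)\mapsto r$, is a ring homomorphism. For a Noetherian local ring $A$ with residue field $k$ and a finitely generated $A$-module $L$, $\beta_i^A(L)=\dim_k\operatorname{Tor}_i^A(L,k)$ is the $i$-th Betti number. $\operatorname{edim}(A)$ is the embedding dimension, i.e. the minimal number of generators of the maximal ideal of $A$. *)

theory Defs
  imports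
    "Jordan_Normal_Form.Missing_VectorSpace"
    "HOL-Algebra.Ring_Divisibility"
    "HOL-Algebra.QuotRing"
begin

section \<open>Noetherian local rings\<close>

locale noetherian_local_ring = cring R + noetherian_ring R for R (structure) +
  assumes unique_maximalideal: "\<exists>!I. maximalideal I R"

definition max_ideal :: "('a, 'r) ring_scheme \<Rightarrow> 'a set"
  where "max_ideal A = (THE I. maximalideal I A)"

definition residue_field :: "('a, 'r) ring_scheme \<Rightarrow> 'a set ring"
  where "residue_field A = A Quot (max_ideal A)"

definition edim :: "('a, 'r) ring_scheme \<Rightarrow> nat"
  where "edim A = (LEAST n. \<exists>S. finite S \<and> card S = n \<and> S \<subseteq> carrier A \<and> Idl\<^bsub>A\<^esub> S = max_ideal A)"


section \<open>Modules\<close>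

text \<open>
  The record type of modules in HOL-Algebra extends that of rings; the fields for a multiplication
  and a unit play no role for modules, and they are left undefined below.
\<close>

definition finitely_generated_module :: "('a, 'r) ring_scheme \<Rightarrow> ('a, 'b, 'm) module_scheme \<Rightarrow> bool"
  where "finitely_generated_module A M \<longleftrightarrow> Module.module A M \<and>
    (\<exists>S. finite S \<and> S \<subseteq> carrier M \<and> LinearCombinations.module.span A M S = carrier M)"

definition self_module :: "('a, 'r) ring_scheme \<Rightarrow> ('a, 'a) module"
  where "self_module A =
    \<lparr>carrier = carrier A, monoid.mult = undefined, one = undefined, zero = \<zero>\<^bsub>A\<^esub>, add = add A,
     smult = monoid.mult A\<rparr>"

definition restrict_scalars :: "('s \<Rightarrow> 'a) \<Rightarrow> ('a, 'b, 'm) module_scheme \<Rightarrow> ('s, 'b) module"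
  where "restrict_scalars \<phi> M =
    \<lparr>carrier = carrier M, monoid.mult = undefined, one = undefined, zero = \<zero>\<^bsub>M\<^esub>, add = add M,
     smult = (\<lambda>s x. \<phi> s \<odot>\<^bsub>M\<^esub> x)\<rparr>"

definition quotient_module :: "('a, 'b, 'm) module_scheme \<Rightarrow> 'b set \<Rightarrow> ('a, 'b set) module"
  where "quotient_module M S =
    \<lparr>carrier = a_rcosets\<^bsub>M\<^esub> S, monoid.mult = undefined, one = undefined, zero = S, add = set_add M,
     smult = (\<lambda>a X. \<Union>x\<in>X. S +>\<^bsub>M\<^esub> (a \<odot>\<^bsub>M\<^esub> x))\<rparr>"

text \<open>The free module on \<open>S\<close>: finitely supported functions on \<open>S\<close> (extensional, so
  that equality of elements is equality of functions).\<close>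

definition free_module :: "('a, 'r) ring_scheme \<Rightarrow> 's set \<Rightarrow> ('a, 's \<Rightarrow> 'a) module"
  where "free_module A S =
    (ring.func_space A S)\<lparr>carrier := {f \<in> S \<rightarrow>\<^sub>E carrier A. finite {s \<in> S. f s \<noteq> \<zero>\<^bsub>A\<^esub>}}\<rparr>"

definition free_basis :: "('a, 'r) ring_scheme \<Rightarrow> 's set \<Rightarrow> 's \<Rightarrow> 's \<Rightarrow> 'a"
  where "free_basis A S s = (\<lambda>t\<in>S. if t = s then \<one>\<^bsub>A\<^esub> else \<zero>\<^bsub>A\<^esub>)"

definition residue_module :: "('a, 'r) ring_scheme \<Rightarrow> ('a, 'a set) module"
  where "residue_module A = restrict_scalars (\<lambda>a. max_ideal A +>\<^bsub>A\<^esub> a) (self_module (residue_field A))"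

text \<open>If the maximal ideal annihilates \<open>V\<close>, then all representatives of a residue class act on
  \<open>V\<close> in the same way, and \<open>V\<close> is a vector space over the residue field.\<close>

definition residue_space :: "('a, 'r) ring_scheme \<Rightarrow> ('a, 'b, 'm) module_scheme \<Rightarrow> ('a set, 'b) module"
  where "residue_space A V =
    \<lparr>carrier = carrier V, monoid.mult = undefined, one = undefined, zero = \<zero>\<^bsub>V\<^esub>, add = add V,
     smult = (\<lambda>X v. the_elem ((\<lambda>a. a \<odot>\<^bsub>V\<^esub> v) ` X))\<rparr>"


section \<open>Tensor products\<close>

text \<open>\<open>M \<otimes> N\<close> is the free module on \<open>M \<times> N\<close> modulo the submodule spanned by the bilinearity
  relations.\<close>

definition tensor_relations ::
    "('a, 'r) ring_scheme \<Rightarrow> ('a, 'b, 'm) module_scheme \<Rightarrow> ('a, 'c, 'n) module_scheme \<Rightarrow> ('b \<times> 'c \<Rightarrow> 'a) set"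
  where "tensor_relations A M N =
    (let F = free_module A (carrier M \<times> carrier N);
         e = (\<lambda>x y. free_basis A (carrier M \<times> carrier N) (x, y))
     in {e (x \<oplus>\<^bsub>M\<^esub> x') y \<ominus>\<^bsub>F\<^esub> (e x y \<oplus>\<^bsub>F\<^esub> e x' y) | x x' y.
            x \<in> carrier M \<and> x' \<in> carrier M \<and> y \<in> carrier N}
      \<union> {e x (y \<oplus>\<^bsub>N\<^esub> y') \<ominus>\<^bsub>F\<^esub> (e x y \<oplus>\<^bsub>F\<^esub> e x y') | x y y'.
            x \<in> carrier M \<and> y \<in> carrier N \<and> y' \<in> carrier N}
      \<union> {e (a \<odot>\<^bsub>M\<^esub> x) y \<ominus>\<^bsub>F\<^esub> a \<odot>\<^bsub>F\<^esub> e x y | a x y.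
            a \<in> carrier A \<and> x \<in> carrier M \<and> y \<in> carrier N}
      \<union> {e x (a \<odot>\<^bsub>N\<^esub> y) \<ominus>\<^bsub>F\<^esub> a \<odot>\<^bsub>F\<^esub> e x y | a x y.
            a \<in> carrier A \<and> x \<in> carrier M \<and> y \<in> carrier N})"

definition tensor_null ::
    "('a, 'r) ring_scheme \<Rightarrow> ('a, 'b, 'm) module_scheme \<Rightarrow> ('a, 'c, 'n) module_scheme \<Rightarrow> ('b \<times> 'c \<Rightarrow> 'a) set"
  where "tensor_null A M N =
    LinearCombinations.module.span A (free_module A (carrier M \<times> carrier N)) (tensor_relations A M N)"

definition tensor_product ::
    "('a, 'r) ring_scheme \<Rightarrow> ('a, 'b, 'm) module_scheme \<Rightarrow> ('a, 'c, 'n) module_scheme \<Rightarrow>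
     ('a, ('b \<times> 'c \<Rightarrow> 'a) set) module"
  where "tensor_product A M N =
    quotient_module (free_module A (carrier M \<times> carrier N)) (tensor_null A M N)"

definition pure_tensor ::
    "('a, 'r) ring_scheme \<Rightarrow> ('a, 'b, 'm) module_scheme \<Rightarrow> ('a, 'c, 'n) module_scheme \<Rightarrow>
     'b \<Rightarrow> 'c \<Rightarrow> ('b \<times> 'c \<Rightarrow> 'a) set"
  where "pure_tensor A M N x y =
    tensor_null A M N +>\<^bsub>free_module A (carrier M \<times> carrier N)\<^esub>
      free_basis A (carrier M \<times> carrier N) (x, y)"

text \<open>The map \<open>f \<otimes> N : M \<otimes> N \<rightarrow> M' \<otimes> N\<close> induced by a module homomorphism \<open>f : M \<rightarrow> M'\<close>.
  Restricting to extensional functions makes it unique as a HOL function.\<close>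

definition tensor_map ::
    "('a, 'r) ring_scheme \<Rightarrow> ('a, 'b, 'm) module_scheme \<Rightarrow> ('a, 'c, 'l) module_scheme \<Rightarrow>
     ('a, 'd, 'n) module_scheme \<Rightarrow> ('b \<Rightarrow> 'c) \<Rightarrow> ('b \<times> 'd \<Rightarrow> 'a) set \<Rightarrow> ('c \<times> 'd \<Rightarrow> 'a) set"
  where "tensor_map A M M' N f =
    (THE h. h \<in> LinearCombinations.module_hom A (tensor_product A M N) (tensor_product A M' N) \<and>
       h \<in> extensional (carrier (tensor_product A M N)) \<and>
       (\<forall>x\<in>carrier M. \<forall>y\<in>carrier N. h (pure_tensor A M N x y) = pure_tensor A M' N (f x) y))"


section \<open>Tor and Betti numbers\<close>

text \<open>
  A resolution \<open>\<cdots> \<rightarrow> F 2 \<rightarrow> F 1 \<rightarrow> F 0 \<rightarrow> L \<rightarrow> 0\<close> by free modules of finite rank, where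
  \<open>F i\<close> is free on \<open>{..<b i}\<close>, \<open>d i : F (i + 1) \<rightarrow> F i\<close>, and \<open>\<epsilon> : F 0 \<rightarrow> L\<close> is the augmentation.
  Over a Noetherian ring every finitely generated module has one.
\<close>

definition free_resolution ::
    "('a, 'r) ring_scheme \<Rightarrow> ('a, 'l, 'm) module_scheme \<Rightarrow>
     (nat \<Rightarrow> nat) \<Rightarrow> ((nat \<Rightarrow> 'a) \<Rightarrow> 'l) \<Rightarrow> (nat \<Rightarrow> (nat \<Rightarrow> 'a) \<Rightarrow> (nat \<Rightarrow> 'a)) \<Rightarrow> bool"
  where "free_resolution A L b \<epsilon> d \<longleftrightarrow>
    (let F = (\<lambda>i. free_module A {..<b i}) in
       \<epsilon> \<in> LinearCombinations.module_hom A (F 0) L \<and>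
       (\<forall>i. d i \<in> LinearCombinations.module_hom A (F (Suc i)) (F i)) \<and>
       \<epsilon> ` carrier (F 0) = carrier L \<and>
       d 0 ` carrier (F 1) = {x \<in> carrier (F 0). \<epsilon> x = \<zero>\<^bsub>L\<^esub>} \<and>
       (\<forall>i. d (Suc i) ` carrier (F (Suc (Suc i))) = {x \<in> carrier (F (Suc i)). d i x = \<zero>\<^bsub>F i\<^esub>}))"

text \<open>
  The \<open>i\<close>-th homology of \<open>\<cdots> \<rightarrow> F 1 \<otimes> K \<rightarrow> F 0 \<otimes> K \<rightarrow> 0\<close> (the augmentation is dropped).
\<close>

definition tensor_homology ::
    "('a, 'r) ring_scheme \<Rightarrow> ('a, 'k, 'n) module_scheme \<Rightarrow>
     (nat \<Rightarrow> nat) \<Rightarrow> (nat \<Rightarrow> (nat \<Rightarrow> 'a) \<Rightarrow> (nat \<Rightarrow> 'a)) \<Rightarrow> nat \<Rightarrow>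
     ('a, ((nat \<Rightarrow> 'a) \<times> 'k \<Rightarrow> 'a) set set) module"
  where "tensor_homology A K b d i =
    (let F = (\<lambda>i. free_module A {..<b i});
         C = (\<lambda>i. tensor_product A (F i) K);
         \<delta> = (\<lambda>i. tensor_map A (F (Suc i)) (F i) K (d i));
         Z = (case i of 0 \<Rightarrow> carrier (C 0) | Suc j \<Rightarrow> {x \<in> carrier (C (Suc j)). \<delta> j x = \<zero>\<^bsub>C j\<^esub>});
         B = \<delta> i ` carrier (C (Suc i))
     in quotient_module ((C i)\<lparr>carrier := Z\<rparr>) B)"

text \<open>\<open>Tor\<^sub>i\<^sup>A(L, K)\<close> for a module \<open>L\<close> that has a resolution by free modules of finite rank.
  As usual it is determined up to isomorphism only: some resolution is chosen.\<close>

definition Tor ::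
    "('a, 'r) ring_scheme \<Rightarrow> ('a, 'l, 'm) module_scheme \<Rightarrow> ('a, 'k, 'n) module_scheme \<Rightarrow> nat \<Rightarrow>
     ('a, ((nat \<Rightarrow> 'a) \<times> 'k \<Rightarrow> 'a) set set) module"
  where "Tor A L K i =
    (let (b, \<epsilon>, d) = (SOME (b, \<epsilon>, d). free_resolution A L b \<epsilon> d) in tensor_homology A K b d i)"

definition betti :: "('a, 'r) ring_scheme \<Rightarrow> ('a, 'l, 'm) module_scheme \<Rightarrow> nat \<Rightarrow> nat"
  where "betti A L i =
    vectorspace.dim (residue_field A) (residue_space A (Tor A L (residue_module A) i))"


section \<open>Idealization\<close>

definition idealization :: "('a, 'r) ring_scheme \<Rightarrow> ('a, 'b, 'm) module_scheme \<Rightarrow> ('a \<times> 'b) ring"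
    (infixl \<open>\<ltimes>\<close> 65)
  where "R \<ltimes> M =
    \<lparr>carrier = carrier R \<times> carrier M,
     monoid.mult = (\<lambda>(r\<^sub>1, m\<^sub>1) (r\<^sub>2, m\<^sub>2). (r\<^sub>1 \<otimes>\<^bsub>R\<^esub> r\<^sub>2, r\<^sub>1 \<odot>\<^bsub>M\<^esub> m\<^sub>2 \<oplus>\<^bsub>M\<^esub> r\<^sub>2 \<odot>\<^bsub>M\<^esub> m\<^sub>1)),
     one = (\<one>\<^bsub>R\<^esub>, \<zero>\<^bsub>M\<^esub>),
     zero = (\<zero>\<^bsub>R\<^esub>, \<zero>\<^bsub>M\<^esub>),
     add = (\<lambda>(r\<^sub>1, m\<^sub>1) (r\<^sub>2, m\<^sub>2). (r\<^sub>1 \<oplus>\<^bsub>R\<^esub> r\<^sub>2, m\<^sub>1 \<oplus>\<^bsub>M\<^esub> m\<^sub>2))\<rparr>"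

end

(*
  R -> R |x M -> R is an algebra retract. If F is a minimal free resolution of R over R |x M and G
  is one of N over R, then F (x)_R G, formed along the inclusion R -> R |x M, is a minimal free
  resolution of N over R |x M: F -> R is a quasi-isomorphism and G is free over R. Hence
  b_i(N) over R |x M is the sum over q <= i of f_(i-q) times b_q(N) over R, where f_p = rank F_p.
  The exact sequence 0 -> M -> R |x M -> R -> 0 gives f_0 = 1 and f_(i+1) = b_i(M) over R |x M,
  which determines f recursively. The embedding dimension is b_1 of the residue field.
*)
theory Submission
  imports Defs
begin

text \<open>\<open>Tor\<close> is computed from an unspecified resolution picked by
  \<open>SOME\<close>, with bases \<open>{..<b i}\<close>, whereas the basis of F \<otimes> G
  consists of triples. Minimal resolutions are therefore allowed over any finite basis sets, and
  their ranks are compared with the homology of an arbitrary resolution tensored with k: the two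
  resolutions are homotopy equivalent, and the minimal one has zero differential modulo the maximal
  ideal. The complex F \<otimes> G is not formed with \<open>tensor_product\<close>. As G q has a
  finite basis, F p \<otimes> G q is the module of families in F p indexed by that basis, and the
  differential of G acts by its matrix, moved into R |x M by the inclusion. Exactness is shown on
  elements: a cycle is first mapped to G, where it bounds, and the components of a preimage are then
  found one at a time from exactness of F. Minimality holds because the inclusion maps the maximal
  ideal of R into that of R |x M.\<close>

abbreviation mhom where "mhom \<equiv> LinearCombinations.module_hom"
lemmas mhom_def = LinearCombinations.module_hom_def

section \<open>Free modules\<close>

text \<open>\<open>finsum\<close> reads only the additive structure, so sums may be moved between
  modules that differ only in their scalars, such as \<open>residue_space\<close> or
  \<open>restrict_scalars\<close> and the modules they come from.\<close>

lemma finsum_eq_of_same_group: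
  assumes "carrier M = carrier N" "add M = add N" "zero M = zero N"
  shows "finsum M f I = finsum N f I"
  using assms unfolding finsum_def finprod_def by simp

context cring
begin

abbreviation "\<F> \<equiv> free_module R"

lemma free_add: "f \<oplus>\<^bsub>\<F> S\<^esub> g = (\<lambda>v\<in>S. f v \<oplus> g v)"
  and free_zero: "\<zero>\<^bsub>\<F> S\<^esub> = (\<lambda>v\<in>S. \<zero>)"
  and free_smult: "a \<odot>\<^bsub>\<F> S\<^esub> f = (\<lambda>v\<in>S. a \<otimes> f v)"
  by (simp_all add: free_module_def func_space_def)

lemma free_apply [simp]:
  assumes "s \<in> S"
  shows "(f \<oplus>\<^bsub>\<F> S\<^esub> g) s = f s \<oplus> g s"
    and "\<zero>\<^bsub>\<F> S\<^esub> s = \<zero>"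
    and "(a \<odot>\<^bsub>\<F> S\<^esub> f) s = a \<otimes> f s"
  using assms by (simp_all add: free_add free_zero free_smult)

lemma free_carrier:
  "f \<in> carrier (\<F> S) \<longleftrightarrow> f \<in> S \<rightarrow>\<^sub>E carrier R \<and> finite {s \<in> S. f s \<noteq> \<zero>}"
  by (simp add: free_module_def)

lemma free_carrier_finite: "finite S \<Longrightarrow> carrier (\<F> S) = S \<rightarrow>\<^sub>E carrier R"
  by (auto simp: free_carrier)

lemma free_coord [simp]: "f \<in> carrier (\<F> S) \<Longrightarrow> s \<in> S \<Longrightarrow> f s \<in> carrier R"
  by (auto simp: free_carrier)

lemma free_finite_supp: "f \<in> carrier (\<F> S) \<Longrightarrow> finite {s \<in> S. f s \<noteq> \<zero>}"
  by (auto simp: free_carrier)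

lemma free_eqI:
  assumes "f \<in> carrier (\<F> S)" "g \<in> carrier (\<F> S)" "\<And>s. s \<in> S \<Longrightarrow> f s = g s"
  shows "f = g"
  using assms by (auto simp: free_carrier intro: PiE_ext)

lemma free_is_module: "Module.module R (\<F> S)"
proof -
  interpret F: Module.module R "func_space S" by (rule func_space_is_module)
  have "submodule R {f \<in> S \<rightarrow>\<^sub>E carrier R. finite {s \<in> S. f s \<noteq> \<zero>}} (func_space S)"
  proof (unfold_locales, goal_cases)
    case (2 v w)
    have "{s \<in> S. (v \<oplus>\<^bsub>func_space S\<^esub> w) s \<noteq> \<zero>} \<subseteq> {s \<in> S. v s \<noteq> \<zero>} \<union> {s \<in> S. w s \<noteq> \<zero>}"
      by (auto simp: func_space_def)
    from finite_subset[OF this] 2 show ?case by (auto simp: func_space_def conj_commute cong: conj_cong)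
  next
    case (4 c v)
    then have "{s \<in> S. (c \<odot>\<^bsub>func_space S\<^esub> v) s \<noteq> \<zero>} \<subseteq> {s \<in> S. v s \<noteq> \<zero>}"
      by (auto simp: func_space_def)
    from finite_subset[OF this] 4 show ?case by (auto simp: func_space_def conj_commute cong: conj_cong)
  qed (auto simp: func_space_def)
  from F.submodule_is_module[OF this] show ?thesis by (simp add: free_module_def)
qed

lemma free_neg:
  assumes "f \<in> carrier (\<F> S)"
  shows "\<ominus>\<^bsub>\<F> S\<^esub> f = (\<lambda>v\<in>S. \<ominus> f v)"
proof -
  interpret F: Module.module R "\<F> S" by (rule free_is_module)
  have "\<ominus>\<^bsub>\<F> S\<^esub> f = (\<ominus> \<one>) \<odot>\<^bsub>\<F> S\<^esub> f"
    using F.smult_l_minus[of \<one> f] assms by simp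
  then show ?thesis using assms by (auto simp: free_smult l_minus)
qed

lemma free_minus:
  assumes "f \<in> carrier (\<F> S)" "g \<in> carrier (\<F> S)"
  shows "f \<ominus>\<^bsub>\<F> S\<^esub> g = (\<lambda>v\<in>S. f v \<ominus> g v)"
  using assms by (auto simp: a_minus_def free_neg free_add)

lemma free_neg_apply [simp]:
  assumes "f \<in> carrier (\<F> S)" "s \<in> S"
  shows "(\<ominus>\<^bsub>\<F> S\<^esub> f) s = \<ominus> f s"
  using assms by (simp add: free_neg)

lemma free_minus_apply [simp]:
  assumes "f \<in> carrier (\<F> S)" "g \<in> carrier (\<F> S)" "s \<in> S"
  shows "(f \<ominus>\<^bsub>\<F> S\<^esub> g) s = f s \<ominus> g s"
  using assms by (simp add: free_minus)

lemma free_basis_closed [simp]: "s \<in> S \<Longrightarrow> free_basis R S s \<in> carrier (\<F> S)"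
  by (auto simp: free_carrier free_basis_def intro: finite_subset[of _ "{s}"])

lemma free_basis_apply [simp]: "t \<in> S \<Longrightarrow> free_basis R S s t = (if t = s then \<one> else \<zero>)"
  by (simp add: free_basis_def)

lemma free_finsum_apply:
  assumes "s \<in> S" "h \<in> I \<rightarrow> carrier (\<F> S)"
  shows "finsum (\<F> S) h I s = (\<Oplus>i\<in>I. h i s)"
proof -
  interpret F: Module.module R "\<F> S" by (rule free_is_module)
  show ?thesis using assms(2)
  proof (induct I rule: infinite_finite_induct)
    case (insert i I)
    have "h \<in> I \<rightarrow> carrier (\<F> S)" "h i \<in> carrier (\<F> S)"
      using insert.prems by auto
    moreover from this have "(\<lambda>i. h i s) \<in> I \<rightarrow> carrier R" "h i s \<in> carrier R"
      using assms(1) by (auto simp: Pi_iff)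
    ultimately
    show ?case using insert.hyps assms(1) by simp
  qed (use assms in simp_all)
qed

end

section \<open>Linear maps out of a free module\<close>

lemma (in mod_hom) hom_finsum:
  assumes "g \<in> I \<rightarrow> carrier M"
  shows "f (\<Oplus>\<^bsub>M\<^esub>i\<in>I. g i) = (\<Oplus>\<^bsub>N\<^esub>i\<in>I. f (g i))"
  using assms
proof (induct I rule: infinite_finite_induct)
  case (insert i I)
  then have "g \<in> I \<rightarrow> carrier M" "g i \<in> carrier M" "(\<lambda>i. f (g i)) \<in> I \<rightarrow> carrier N" "f (g i) \<in> carrier N"
    by auto
  with insert show ?case by simp
qed simp_all

text \<open>The linear extension of \<open>g\<close>. The sum runs over the support of
  \<open>x\<close> because \<open>S\<close> may be infinite, as for the pairs in a tensor product,
  and \<open>finsum\<close> over an infinite set is zero by default.\<close>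

definition free_lift :: "('a, 'r) ring_scheme \<Rightarrow> ('a, 'b, 'm) module_scheme \<Rightarrow> 's set \<Rightarrow> ('s \<Rightarrow> 'b) \<Rightarrow> ('s \<Rightarrow> 'a) \<Rightarrow> 'b"
  where "free_lift R M S g x = (\<Oplus>\<^bsub>M\<^esub>s\<in>{s \<in> S. x s \<noteq> \<zero>\<^bsub>R\<^esub>}. x s \<odot>\<^bsub>M\<^esub> g s)"

context Module.module
begin

text \<open>Terms off the support vanish. The freedom in \<open>T\<close> gives two elements and
  their sum a common index set, which turns additivity into a termwise identity.\<close>

lemma free_lift_eq:
  assumes "g \<in> S \<rightarrow> carrier M" "x \<in> carrier (\<F> S)"
    "finite T" "T \<subseteq> S" "{s \<in> S. x s \<noteq> \<zero>} \<subseteq> T"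
  shows "free_lift R M S g x = (\<Oplus>\<^bsub>M\<^esub>s\<in>T. x s \<odot>\<^bsub>M\<^esub> g s)"
  unfolding free_lift_def
proof (rule M.add.finprod_mono_neutral_cong_left)
  fix s assume "s \<in> T - {s \<in> S. x s \<noteq> \<zero>}"
  then have "x s = \<zero>" "g s \<in> carrier M" using assms by auto
  then show "x s \<odot>\<^bsub>M\<^esub> g s = \<zero>\<^bsub>M\<^esub>" by simp
next
  show "(\<lambda>s. x s \<odot>\<^bsub>M\<^esub> g s) \<in> T \<rightarrow> carrier M"
    using assms by (auto simp: Pi_iff)
qed (use assms in auto)

lemma free_lift_finite:
  assumes "finite S" "g \<in> S \<rightarrow> carrier M" "x \<in> carrier (\<F> S)"
  shows "free_lift R M S g x = (\<Oplus>\<^bsub>M\<^esub>s\<in>S. x s \<odot>\<^bsub>M\<^esub> g s)"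
  using assms by (intro free_lift_eq) auto

lemma free_lift_hom:
  assumes g: "g \<in> S \<rightarrow> carrier M"
  shows "free_lift R M S g \<in> mhom R (\<F> S) M"
proof -
  interpret F: Module.module R "\<F> S" by (rule free_is_module)
  have c: "(\<lambda>s. x s \<odot>\<^bsub>M\<^esub> g s) \<in> T \<rightarrow> carrier M" if "x \<in> carrier (\<F> S)" "T \<subseteq> S" for x T
    using that g by (auto simp: Pi_iff)
  show ?thesis unfolding mhom_def
  proof (intro CollectI conjI allI impI; (elim conjE)?)
    show "free_lift R M S g \<in> carrier (\<F> S) \<rightarrow> carrier M"
      unfolding free_lift_def by (intro Pi_I M.finsum_closed c) auto
  next
    fix x y assume x: "x \<in> carrier (\<F> S)" and y: "y \<in> carrier (\<F> S)"
    let ?T = "{s \<in> S. x s \<noteq> \<zero>} \<union> {s \<in> S. y s \<noteq> \<zero>}"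
    let ?z = "x \<oplus>\<^bsub>\<F> S\<^esub> y"
    have T: "finite ?T" "?T \<subseteq> S" using free_finite_supp[OF x] free_finite_supp[OF y] by auto
    have z: "?z \<in> carrier (\<F> S)" using x y by (rule F.M.add.m_closed)
    have "free_lift R M S g ?z = (\<Oplus>\<^bsub>M\<^esub>s\<in>?T. ?z s \<odot>\<^bsub>M\<^esub> g s)"
      using T z by (intro free_lift_eq g) auto
    also have "\<dots> = (\<Oplus>\<^bsub>M\<^esub>s\<in>?T. x s \<odot>\<^bsub>M\<^esub> g s \<oplus>\<^bsub>M\<^esub> y s \<odot>\<^bsub>M\<^esub> g s)"
      using x y g T(2) by (intro M.finsum_cong') (auto simp: smult_l_distr Pi_iff)
    also have "\<dots> = (\<Oplus>\<^bsub>M\<^esub>s\<in>?T. x s \<odot>\<^bsub>M\<^esub> g s) \<oplus>\<^bsub>M\<^esub> (\<Oplus>\<^bsub>M\<^esub>s\<in>?T. y s \<odot>\<^bsub>M\<^esub> g s)"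
      by (intro M.finsum_addf c x y T)
    also have "\<dots> = free_lift R M S g x \<oplus>\<^bsub>M\<^esub> free_lift R M S g y"
      using free_lift_eq[OF g x T] free_lift_eq[OF g y T] by auto
    finally show "free_lift R M S g ?z = free_lift R M S g x \<oplus>\<^bsub>M\<^esub> free_lift R M S g y" .
  next
    fix a x assume a: "a \<in> carrier R" and x: "x \<in> carrier (\<F> S)"
    let ?T = "{s \<in> S. x s \<noteq> \<zero>}"
    let ?z = "a \<odot>\<^bsub>\<F> S\<^esub> x"
    have T: "finite ?T" "?T \<subseteq> S" using free_finite_supp[OF x] by auto
    have z: "?z \<in> carrier (\<F> S)" using a x by (rule F.smult_closed)
    have "free_lift R M S g ?z = (\<Oplus>\<^bsub>M\<^esub>s\<in>?T. ?z s \<odot>\<^bsub>M\<^esub> g s)"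
      using T z a x by (intro free_lift_eq g) auto
    also have "\<dots> = (\<Oplus>\<^bsub>M\<^esub>s\<in>?T. a \<odot>\<^bsub>M\<^esub> (x s \<odot>\<^bsub>M\<^esub> g s))"
      using a x g T(2) by (intro M.finsum_cong') (auto simp: smult_assoc1 Pi_iff)
    also have "\<dots> = a \<odot>\<^bsub>M\<^esub> (\<Oplus>\<^bsub>M\<^esub>s\<in>?T. x s \<odot>\<^bsub>M\<^esub> g s)"
      using finsum_smult[OF a c[OF x T(2)]] by simp
    finally show "free_lift R M S g ?z = a \<odot>\<^bsub>M\<^esub> free_lift R M S g x"
      by (simp add: free_lift_def)
  qed
qed

lemma free_lift_basis:
  assumes "g \<in> S \<rightarrow> carrier M" "s \<in> S"
  shows "free_lift R M S g (free_basis R S s) = g s"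
proof -
  have "free_lift R M S g (free_basis R S s) = (\<Oplus>\<^bsub>M\<^esub>t\<in>{s}. free_basis R S s t \<odot>\<^bsub>M\<^esub> g t)"
    using assms by (intro free_lift_eq) (auto split: if_splits)
  also have "\<dots> = g s" using assms by (simp add: Pi_iff)
  finally show ?thesis .
qed

end

lemma (in cring) free_expand:
  assumes "x \<in> carrier (free_module R S)"
  shows "free_lift R (free_module R S) S (free_basis R S) x = x"
proof -
  interpret F: Module.module R "free_module R S" by (rule free_is_module)
  let ?L = "free_lift R (free_module R S) S (free_basis R S)"
  have L: "?L x \<in> carrier (free_module R S)"
    using F.free_lift_hom[of "free_basis R S" S] assms by (auto simp: mhom_def)
  show ?thesis
  proof (rule free_eqI[OF L assms])
    fix s assume s: "s \<in> S"
    let ?T = "{s \<in> S. x s \<noteq> \<zero>}"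
    have "?L x s = (\<Oplus>t\<in>?T. (x t \<odot>\<^bsub>free_module R S\<^esub> free_basis R S t) s)"
      unfolding free_lift_def using assms s
      by (intro free_finsum_apply Pi_I F.smult_closed) auto
    also have "\<dots> = (\<Oplus>t\<in>?T. if s = t then x t else \<zero>)"
      using assms s by (intro finsum_cong') auto
    \<comment> \<open>The sum runs over the support of \<open>x\<close>, which misses
      \<open>s\<close> when \<open>x s = \<zero>\<close>.\<close>
    also have "\<dots> = x s"
    proof (cases "x s = \<zero>")
      case True
      then have "(\<Oplus>t\<in>?T. if s = t then x t else \<zero>) = (\<Oplus>t\<in>?T. \<zero>)"
        by (intro finsum_cong') auto
      with True show ?thesis by simp
    next
      case False
      then show ?thesis using assms s free_finite_supp[OF assms]
        by (intro finsum_singleton) (auto intro: free_coord)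
    qed
    finally show "?L x s = x s" .
  qed
qed

lemma hom_free_lift:
  assumes "Module.module R M" "f \<in> mhom R (free_module R S) M" "x \<in> carrier (free_module R S)"
  shows "f x = free_lift R M S (\<lambda>s. f (free_basis R S s)) x"
proof -
  interpret M: Module.module R M by fact
  interpret F: Module.module R "free_module R S" by (rule M.free_is_module)
  interpret f: mod_hom R "free_module R S" M f by unfold_locales (rule assms(2))
  let ?T = "{s \<in> S. x s \<noteq> \<zero>\<^bsub>R\<^esub>}"
  have "f x = f (free_lift R (free_module R S) S (free_basis R S) x)"
    using M.free_expand[OF assms(3)] by simp
  also have "\<dots> = (\<Oplus>\<^bsub>M\<^esub>s\<in>?T. f (x s \<odot>\<^bsub>free_module R S\<^esub> free_basis R S s))"
    unfolding free_lift_def using assms(3) by (intro f.hom_finsum Pi_I F.smult_closed) auto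
  also have "\<dots> = (\<Oplus>\<^bsub>M\<^esub>s\<in>?T. x s \<odot>\<^bsub>M\<^esub> f (free_basis R S s))"
    using assms(3) by (intro M.M.finsum_cong') auto
  finally show ?thesis by (simp add: free_lift_def)
qed

section \<open>Local rings and residue spaces\<close>

text \<open>Locality in the form used for computations: everything outside the maximal ideal is
  invertible. No chain condition is included, so this property and the Noetherian one pass to R |x M
  separately.\<close>

locale local_ring = cring R for R (structure) +
  assumes max_ideal_ideal: "ideal (max_ideal R) R"
    and one_notin_max_ideal: "\<one> \<notin> max_ideal R"
    and Units_if_notin: "a \<in> carrier R \<Longrightarrow> a \<notin> max_ideal R \<Longrightarrow> a \<in> Units R"

lemma (in cring) ideal_criterion:
  assumes "I \<subseteq> carrier R" "\<zero> \<in> I"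
    and add: "\<And>a b. a \<in> I \<Longrightarrow> b \<in> I \<Longrightarrow> a \<oplus> b \<in> I"
    and mult: "\<And>a x. a \<in> I \<Longrightarrow> x \<in> carrier R \<Longrightarrow> x \<otimes> a \<in> I"
  shows "ideal I R"
proof (rule idealI[OF ring_axioms])
  have c: "a \<in> carrier R" if "a \<in> I" for a using assms(1) that by blast
  show "subgroup I (add_monoid R)"
  proof (rule add.subgroupI)
    show "I \<noteq> {}" using assms(2) by blast
    fix a assume "a \<in> I"
    then show "\<ominus> a \<in> I" using mult[of a "\<ominus> \<one>"] c[of a] by (simp add: l_minus)
  qed (use assms(1) add in simp_all)
  fix a x assume "a \<in> I" "x \<in> carrier R"
  then show "x \<otimes> a \<in> I" "a \<otimes> x \<in> I" using mult[of a x] c[of a] by (simp_all add: m_comm)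
qed

text \<open>An ideal not contained in \<open>I\<close> contains a unit and is the whole ring. So
  every proper ideal lies in \<open>I\<close>, which makes \<open>I\<close> the only maximal ideal
  and determines the \<open>THE\<close> in \<open>max_ideal\<close>.\<close>

lemma (in cring) max_idealI:
  assumes I: "ideal I R" "\<one> \<notin> I" and units: "\<And>a. a \<in> carrier R \<Longrightarrow> a \<notin> I \<Longrightarrow> a \<in> Units R"
  shows "maximalideal I R" and "max_ideal R = I" and "local_ring R"
proof -
  interpret I: ideal I R by (rule I)
  have full: "J = carrier R" if "ideal J R" "a \<in> J" "a \<notin> I" for J a
  proof -
    interpret J: ideal J R by fact
    have "a \<in> carrier R" using that(2) J.a_subset by blast
    with units that(3) have u: "a \<in> Units R" by blast
    then have "inv a \<otimes> a \<in> J" using that(2) by (intro J.I_l_closed) simp_all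
    then show ?thesis using u J.one_imp_carrier by simp
  qed
  have in_or: "J \<subseteq> I \<or> J = carrier R" if "ideal J R" for J
    using full[OF that] by blast
  have ne: "carrier R \<noteq> I" using I(2) one_closed by metis
  show max: "maximalideal I R"
  proof (rule maximalidealI[OF I(1) ne])
    fix J assume "ideal J R" "I \<subseteq> J"
    then show "J = I \<or> J = carrier R" using in_or by blast
  qed
  have "J = I" if "maximalideal J R" for J
  proof -
    interpret J: maximalideal J R by fact
    have "J \<subseteq> I" using in_or[OF J.is_ideal] J.I_notcarr by blast
    then show ?thesis using J.I_maximal[OF I(1)] I.a_subset ne by blast
  qed
  with max show m: "max_ideal R = I"
    unfolding max_ideal_def by (intro the_equality)
  show "local_ring R"
    unfolding local_ring_def local_ring_axioms_def m using I units is_cring by blast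
qed

section \<open>Quotient modules\<close>

context Module.module
begin

text \<open>Transport of structure: every element of \<open>Q\<close> is some
  \<open>\<pi> x\<close>, so each module axiom for \<open>Q\<close> is the image of the same axiom
  in \<open>M\<close>. \<open>Q\<close> may be a bare record; quotients and the residue field obtain
  their module structure in this way.\<close>

lemma module_surjI:
  assumes \<pi>: "\<pi> ` carrier M = carrier Q" "\<pi> \<zero>\<^bsub>M\<^esub> = \<zero>\<^bsub>Q\<^esub>"
    and add: "\<And>x y. x \<in> carrier M \<Longrightarrow> y \<in> carrier M \<Longrightarrow> \<pi> (x \<oplus>\<^bsub>M\<^esub> y) = \<pi> x \<oplus>\<^bsub>Q\<^esub> \<pi> y"
    and smult: "\<And>a x. a \<in> carrier R \<Longrightarrow> x \<in> carrier M \<Longrightarrow> \<pi> (a \<odot>\<^bsub>M\<^esub> x) = a \<odot>\<^bsub>Q\<^esub> \<pi> x"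
  shows "Module.module R Q" and "\<pi> \<in> mhom R M Q"
proof -
  note a = add[symmetric] and s = smult[symmetric]
  have E: "\<exists>x\<in>carrier M. X = \<pi> x" if "X \<in> carrier Q" for X using that \<pi> by auto
  have C: "\<pi> x \<in> carrier Q" if "x \<in> carrier M" for x using that \<pi> by auto
  show "\<pi> \<in> mhom R M Q" using C add smult by (auto simp: mhom_def)
  show "Module.module R Q"
  proof (rule module_criteria, goal_cases)
    case 1 show ?case by (rule R.is_cring)
  next
    case 2 show ?case using C[OF M.zero_closed] \<pi> by simp
  next
    case 4
    show ?case
    proof
      fix v assume "v \<in> carrier Q"
      then obtain x where x: "x \<in> carrier M" "v = \<pi> x" using E by blast
      then have "v \<oplus>\<^bsub>Q\<^esub> \<pi> (\<ominus>\<^bsub>M\<^esub> x) = \<pi> (x \<oplus>\<^bsub>M\<^esub> \<ominus>\<^bsub>M\<^esub> x)" by (simp add: add)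
      then show "\<exists>w\<in>carrier Q. v \<oplus>\<^bsub>Q\<^esub> w = \<zero>\<^bsub>Q\<^esub>"
        using x C \<pi> by (intro bexI[of _ "\<pi> (\<ominus>\<^bsub>M\<^esub> x)"]) (auto simp: M.r_neg)
    qed
  next
    case 8
    show ?case
    proof
      fix v assume "v \<in> carrier Q"
      then obtain x where x: "x \<in> carrier M" "v = \<pi> x" using E by blast
      then show "v \<oplus>\<^bsub>Q\<^esub> \<zero>\<^bsub>Q\<^esub> = v" using a[of x "\<zero>\<^bsub>M\<^esub>"] \<pi> by simp
    qed
  next
    case 3 show ?case unfolding \<pi>(1)[symmetric] by (auto simp: a)
  next
    case 5 show ?case unfolding \<pi>(1)[symmetric] by (auto simp: s)
  next
    case 6 show ?case unfolding \<pi>(1)[symmetric] by (auto simp: a M.a_comm)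
  next
    case 7 show ?case unfolding \<pi>(1)[symmetric] by (auto simp: a M.a_assoc)
  next
    case 9 show ?case unfolding \<pi>(1)[symmetric] by (auto simp: s smult_assoc1)
  next
    case 10 show ?case unfolding \<pi>(1)[symmetric] by (auto simp: s)
  next
    case 11 show ?case unfolding \<pi>(1)[symmetric] by (auto simp: s a smult_l_distr)
  next
    case 12 show ?case unfolding \<pi>(1)[symmetric] by (auto simp: s a smult_r_distr)
  qed
qed

text \<open>Negation is multiplication by \<open>\<ominus> \<one>\<close>, so a submodule is an
  additive subgroup; this makes the coset theory of abelian groups available.\<close>

lemma submodule_abelian_subgroup:
  assumes "submodule R S M" shows "abelian_subgroup S M"
proof -
  interpret S: submodule R S M by fact
  have "\<ominus>\<^bsub>M\<^esub> x \<in> S" if "x \<in> S" for x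
    using S.smult_closed[of "\<ominus> \<one>" x] smult_l_minus[of \<one> x] that subsetD[OF S.subset that] by simp
  then have "additive_subgroup S M"
    by unfold_locales (use S.subset in \<open>auto simp: a_inv_def\<close>)
  then show ?thesis by (rule abelian_subgroupI3) (rule M.abelian_group_axioms)
qed

lemma submodule_minus_closed:
  assumes "submodule R S M" "x \<in> S" "y \<in> S"
  shows "x \<ominus>\<^bsub>M\<^esub> y \<in> S"
  using abelian_subgroup.axioms(1)[OF submodule_abelian_subgroup[OF assms(1)]] assms
  by (auto simp: a_minus_def additive_subgroup.a_closed additive_subgroup.a_inv_closed)

lemma
  assumes S: "submodule R S M"
  shows quotient_carrier: "carrier (quotient_module M S) = (\<lambda>x. S +>\<^bsub>M\<^esub> x) ` carrier M"
    and quotient_zero: "\<zero>\<^bsub>quotient_module M S\<^esub> = S"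
    and quotient_is_module: "Module.module R (quotient_module M S)"
    and quotient_hom: "(\<lambda>x. S +>\<^bsub>M\<^esub> x) \<in> mhom R M (quotient_module M S)"
    and quotient_eq_iff: "\<And>x y. x \<in> carrier M \<Longrightarrow> y \<in> carrier M \<Longrightarrow> S +>\<^bsub>M\<^esub> x = S +>\<^bsub>M\<^esub> y \<longleftrightarrow> x \<ominus>\<^bsub>M\<^esub> y \<in> S"
    and quotient_eq_zero_iff: "\<And>x. x \<in> carrier M \<Longrightarrow> S +>\<^bsub>M\<^esub> x = S \<longleftrightarrow> x \<in> S"
proof -
  interpret S: submodule R S M by fact
  interpret aS: abelian_subgroup S M by (rule submodule_abelian_subgroup[OF S])
  show c: "carrier (quotient_module M S) = (\<lambda>x. S +>\<^bsub>M\<^esub> x) ` carrier M"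
    by (auto simp: quotient_module_def A_RCOSETS_def')
  show z: "\<zero>\<^bsub>quotient_module M S\<^esub> = S" by (simp add: quotient_module_def)
  show eq0: "S +>\<^bsub>M\<^esub> x = S \<longleftrightarrow> x \<in> S" if "x \<in> carrier M" for x
    using aS.a_rcos_const aS.a_rcos_self[OF that] by auto
  show eq: "S +>\<^bsub>M\<^esub> x = S +>\<^bsub>M\<^esub> y \<longleftrightarrow> x \<ominus>\<^bsub>M\<^esub> y \<in> S" if "x \<in> carrier M" "y \<in> carrier M" for x y
  proof
    assume "S +>\<^bsub>M\<^esub> x = S +>\<^bsub>M\<^esub> y"
    then have "x \<in> S +>\<^bsub>M\<^esub> y" using aS.a_rcos_self[OF that(1)] by simp
    then show "x \<ominus>\<^bsub>M\<^esub> y \<in> S" using aS.a_rcos_module[OF that(2,1)] by (simp add: a_minus_def)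
  next
    assume "x \<ominus>\<^bsub>M\<^esub> y \<in> S"
    then have "x \<in> S +>\<^bsub>M\<^esub> y" using aS.a_rcos_module[OF that(2,1)] by (simp add: a_minus_def)
    then show "S +>\<^bsub>M\<^esub> x = S +>\<^bsub>M\<^esub> y" using aS.a_repr_independence'[OF _ that(2)] by simp
  qed
  \<comment> \<open>Scalar multiplication on the quotient is a union over all representatives of the
    coset. The union is a single coset because the products from two representatives differ by
    \<open>a\<close> times an element of \<open>S\<close>.\<close>
  have smult: "S +>\<^bsub>M\<^esub> (a \<odot>\<^bsub>M\<^esub> x) = a \<odot>\<^bsub>quotient_module M S\<^esub> (S +>\<^bsub>M\<^esub> x)"
    if "a \<in> carrier R" "x \<in> carrier M" for a x
  proof -
    have "S +>\<^bsub>M\<^esub> (a \<odot>\<^bsub>M\<^esub> y) = S +>\<^bsub>M\<^esub> (a \<odot>\<^bsub>M\<^esub> x)" if y: "y \<in> S +>\<^bsub>M\<^esub> x" for y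
    proof -
      obtain h where h: "h \<in> S" "y = h \<oplus>\<^bsub>M\<^esub> x" using y by (auto simp: a_r_coset_def')
      then have hM: "h \<in> carrier M" using S.subset by auto
      have "a \<odot>\<^bsub>M\<^esub> y \<ominus>\<^bsub>M\<^esub> a \<odot>\<^bsub>M\<^esub> x = a \<odot>\<^bsub>M\<^esub> h"
        using h(2) hM \<open>a \<in> carrier R\<close> \<open>x \<in> carrier M\<close>
        by (simp add: smult_r_distr M.minus_eq M.a_assoc M.r_neg)
      then show ?thesis using h hM \<open>a \<in> carrier R\<close> \<open>x \<in> carrier M\<close> by (subst eq) auto
    qed
    then have "(\<Union>y\<in>S +>\<^bsub>M\<^esub> x. S +>\<^bsub>M\<^esub> (a \<odot>\<^bsub>M\<^esub> y)) = S +>\<^bsub>M\<^esub> (a \<odot>\<^bsub>M\<^esub> x)"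
      using aS.a_rcos_self[OF that(2)] by (intro SUP_eq_const) blast+
    then show ?thesis by (simp add: quotient_module_def)
  qed
  have add: "S +>\<^bsub>M\<^esub> (x \<oplus>\<^bsub>M\<^esub> y) = (S +>\<^bsub>M\<^esub> x) \<oplus>\<^bsub>quotient_module M S\<^esub> (S +>\<^bsub>M\<^esub> y)"
    if "x \<in> carrier M" "y \<in> carrier M" for x y
    using that by (simp add: quotient_module_def aS.a_rcos_sum)
  have zero: "S +>\<^bsub>M\<^esub> \<zero>\<^bsub>M\<^esub> = \<zero>\<^bsub>quotient_module M S\<^esub>"
    unfolding z by (rule eq0[THEN iffD2]) simp_all
  show "Module.module R (quotient_module M S)" "(\<lambda>x. S +>\<^bsub>M\<^esub> x) \<in> mhom R M (quotient_module M S)"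
    by (rule module_surjI[where \<pi> = "\<lambda>x. S +>\<^bsub>M\<^esub> x", OF c[symmetric] zero add smult]; assumption)+
qed

end

section \<open>The ring and its residue field as modules\<close>

lemma (in cring) self_is_module: "Module.module R (self_module R)"
proof (rule module_criteria, goal_cases)
  case 4
  show ?case
  proof
    fix v assume "v \<in> carrier (self_module R)"
    then show "\<exists>w\<in>carrier (self_module R). v \<oplus>\<^bsub>self_module R\<^esub> w = \<zero>\<^bsub>self_module R\<^esub>"
      by (intro bexI[of _ "\<ominus> v"]) (simp_all add: self_module_def r_neg)
  qed
qed (simp_all add: self_module_def l_distr r_distr a_ac m_ac is_cring)

lemma self_module_simps [simp]:
  "carrier (self_module R) = carrier R" "\<zero>\<^bsub>self_module R\<^esub> = \<zero>\<^bsub>R\<^esub>"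
  "x \<oplus>\<^bsub>self_module R\<^esub> y = x \<oplus>\<^bsub>R\<^esub> y" "x \<odot>\<^bsub>self_module R\<^esub> y = x \<otimes>\<^bsub>R\<^esub> y"
  by (simp_all add: self_module_def)

context local_ring
begin

abbreviation "\<mm> \<equiv> max_ideal R"
abbreviation "\<kk> \<equiv> residue_module R"

sublocale mm: ideal "\<mm>" R by (rule max_ideal_ideal)

lemma max_ideal_maximal: "maximalideal (\<mm>) R"
  by (rule max_idealI(1)) (use max_ideal_ideal one_notin_max_ideal Units_if_notin in auto)

lemma residue_field_is_field: "field (residue_field R)"
  unfolding residue_field_def
  by (rule maximalideal.quotient_is_field[OF max_ideal_maximal is_cring])

lemma residue_field_simps:
  "carrier (residue_field R) = (\<lambda>a. \<mm> +> a) ` carrier R"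
  "\<zero>\<^bsub>residue_field R\<^esub> = \<mm>" "\<one>\<^bsub>residue_field R\<^esub> = \<mm> +> \<one>"
  "a \<in> carrier R \<Longrightarrow> b \<in> carrier R \<Longrightarrow>
    (\<mm> +> a) \<oplus>\<^bsub>residue_field R\<^esub> (\<mm> +> b) = \<mm> +> (a \<oplus> b)"
  "a \<in> carrier R \<Longrightarrow> b \<in> carrier R \<Longrightarrow>
    (\<mm> +> a) \<otimes>\<^bsub>residue_field R\<^esub> (\<mm> +> b) = \<mm> +> (a \<otimes> b)"
  by (auto simp: residue_field_def FactRing_def A_RCOSETS_def' mm.a_rcos_sum mm.rcoset_mult_add)

lemma residue_eq_zero_iff:
  assumes "a \<in> carrier R"
  shows "\<mm> +> a = \<mm> \<longleftrightarrow> a \<in> \<mm>"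
  using assms mm.a_rcos_const mm.a_rcos_self by auto

lemma
  shows residue_module_is_module: "Module.module R \<kk>"
    and residue_hom: "(\<lambda>a. \<mm> +> a) \<in> mhom R (self_module R) \<kk>"
    and residue_module_carrier: "carrier \<kk> = (\<lambda>a. \<mm> +> a) ` carrier R"
    and residue_module_zero: "\<zero>\<^bsub>\<kk>\<^esub> = \<mm>"
proof -
  interpret S: Module.module R "self_module R" by (rule self_is_module)
  show c: "carrier \<kk> = (\<lambda>a. \<mm> +> a) ` carrier R"
    by (simp add: residue_module_def restrict_scalars_def residue_field_simps)
  show z: "\<zero>\<^bsub>\<kk>\<^esub> = \<mm>"
    by (simp add: residue_module_def restrict_scalars_def residue_field_simps)
  show "Module.module R \<kk>" "(\<lambda>a. \<mm> +> a) \<in> mhom R (self_module R) \<kk>"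
    by (rule S.module_surjI[where \<pi> = "\<lambda>a. \<mm> +> a"]; use c z residue_eq_zero_iff[OF zero_closed] in
      \<open>simp add: residue_module_def restrict_scalars_def residue_field_simps\<close>)+
qed

end

section \<open>Tensor products with the residue field\<close>

lemma mod_homI: "Module.module R M \<Longrightarrow> Module.module R N \<Longrightarrow> f \<in> mhom R M N \<Longrightarrow> mod_hom R M N f"
  by (simp add: mod_hom_def mod_hom_axioms_def)

lemma mhom_closed: "f \<in> mhom R M N \<Longrightarrow> x \<in> carrier M \<Longrightarrow> f x \<in> carrier N"
  by (auto simp: mhom_def)

lemma mhom_comp: "f \<in> mhom R L M \<Longrightarrow> g \<in> mhom R M N \<Longrightarrow> (\<lambda>x. g (f x)) \<in> mhom R L N"
  by (auto simp: mhom_def Pi_iff)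

lemma mhom_cong:
  assumes "f \<in> mhom R M N" "\<And>x. x \<in> carrier M \<Longrightarrow> g x = f x" "Module.module R M"
  shows "g \<in> mhom R M N"
proof -
  interpret M: Module.module R M by fact
  show ?thesis using assms(1,2) by (auto simp: mhom_def)
qed

lemma hom_free_eqI:
  assumes "Module.module R M" "f \<in> mhom R (free_module R S) M" "g \<in> mhom R (free_module R S) M"
    "\<And>s. s \<in> S \<Longrightarrow> f (free_basis R S s) = g (free_basis R S s)" "x \<in> carrier (free_module R S)"
  shows "f x = g x"
proof -
  interpret M: Module.module R M by fact
  have "free_lift R M S (\<lambda>s. f (free_basis R S s)) x = free_lift R M S (\<lambda>s. g (free_basis R S s)) x"
    unfolding free_lift_def using assms(4)  M.free_coord[OF assms(5)]
    by (intro M.M.finsum_cong') (auto intro!: M.smult_closed mhom_closed[OF assms(3)])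
  then show ?thesis
    using hom_free_lift[OF assms(1,2,5)] hom_free_lift[OF assms(1,3,5)] by simp
qed

locale two_modules = M: Module.module R M + N: Module.module R N
  for R (structure) and M :: "('a, 'b, 'm) module_scheme" (structure) and N :: "('a, 'c, 'n) module_scheme" (structure)
begin

abbreviation "pairs \<equiv> free_module R (carrier M \<times> carrier N)"

sublocale P: Module.module R pairs by (rule M.free_is_module)

lemma relations_closed: "tensor_relations R M N \<subseteq> carrier pairs"
  unfolding tensor_relations_def Let_def
  by (auto intro!: P.M.minus_closed P.M.add.m_closed P.smult_closed M.free_basis_closed
      M.M.add.m_closed N.M.add.m_closed M.smult_closed N.smult_closed)

lemma null_submodule: "submodule R (tensor_null R M N) pairs"
  unfolding tensor_null_def by (rule P.span_is_submodule[OF relations_closed])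

lemma relations_null: "u \<in> tensor_relations R M N \<Longrightarrow> u \<in> tensor_null R M N"
  unfolding tensor_null_def using P.in_own_span[OF relations_closed] by blast

lemma tensor_is_module: "Module.module R (tensor_product R M N)"
  unfolding tensor_product_def by (rule P.quotient_is_module[OF null_submodule])

sublocale T: Module.module R "tensor_product R M N" by (rule tensor_is_module)

lemma tensor_coset_hom: "(\<lambda>u. tensor_null R M N +>\<^bsub>pairs\<^esub> u) \<in> mhom R pairs (tensor_product R M N)"
  unfolding tensor_product_def by (rule P.quotient_hom[OF null_submodule])

sublocale q: mod_hom R pairs "tensor_product R M N" "\<lambda>u. tensor_null R M N +>\<^bsub>pairs\<^esub> u"
  by unfold_locales (rule tensor_coset_hom)

lemma pure_closed: "x \<in> carrier M \<Longrightarrow> y \<in> carrier N \<Longrightarrow> pure_tensor R M N x y \<in> carrier (tensor_product R M N)"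
  unfolding pure_tensor_def by (intro q.f_im M.free_basis_closed) simp

lemma coset_eqI:
  assumes "u \<ominus>\<^bsub>pairs\<^esub> v \<in> tensor_relations R M N" "u \<in> carrier pairs" "v \<in> carrier pairs"
  shows "tensor_null R M N +>\<^bsub>pairs\<^esub> u = tensor_null R M N +>\<^bsub>pairs\<^esub> v"
  using assms by (subst P.quotient_eq_iff[OF null_submodule]) (auto intro: relations_null)

lemma pure_add_left:
  assumes "x \<in> carrier M" "x' \<in> carrier M" "y \<in> carrier N"
  shows "pure_tensor R M N (x \<oplus>\<^bsub>M\<^esub> x') y =
    pure_tensor R M N x y \<oplus>\<^bsub>tensor_product R M N\<^esub> pure_tensor R M N x' y"
  unfolding pure_tensor_def using assms
  by (subst q.f_add[symmetric]; (intro coset_eqI)?) (auto simp: tensor_relations_def Let_def)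

lemma pure_smult_left:
  assumes "x \<in> carrier M" "a \<in> carrier R" "y \<in> carrier N"
  shows "pure_tensor R M N (a \<odot>\<^bsub>M\<^esub> x) y = a \<odot>\<^bsub>tensor_product R M N\<^esub> pure_tensor R M N x y"
  unfolding pure_tensor_def using assms
  by (subst q.f_smult[symmetric]; (intro coset_eqI)?) (auto simp: tensor_relations_def Let_def)

lemma pure_smult_right:
  assumes "x \<in> carrier M" "a \<in> carrier R" "y \<in> carrier N"
  shows "pure_tensor R M N x (a \<odot>\<^bsub>N\<^esub> y) = a \<odot>\<^bsub>tensor_product R M N\<^esub> pure_tensor R M N x y"
  unfolding pure_tensor_def using assms
  by (subst q.f_smult[symmetric]; (intro coset_eqI)?) (auto simp: tensor_relations_def Let_def)

lemma tensor_obtain: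
  assumes "t \<in> carrier (tensor_product R M N)"
  obtains u where "u \<in> carrier pairs" "t = tensor_null R M N +>\<^bsub>pairs\<^esub> u"
  using assms P.quotient_carrier[OF null_submodule] unfolding tensor_product_def by auto

text \<open>Uniqueness in the universal property: after composition with the projection from the
  free module on pairs, both maps are determined by the basis elements, whose images are the pure
  tensors.\<close>

lemma tensor_hom_eqI:
  assumes "Module.module R L" "f \<in> mhom R (tensor_product R M N) L" "g \<in> mhom R (tensor_product R M N) L"
    "\<And>x y. x \<in> carrier M \<Longrightarrow> y \<in> carrier N \<Longrightarrow> f (pure_tensor R M N x y) = g (pure_tensor R M N x y)"
    "t \<in> carrier (tensor_product R M N)"
  shows "f t = g t"
proof -
  obtain u where u: "u \<in> carrier pairs" "t = tensor_null R M N +>\<^bsub>pairs\<^esub> u"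
    using tensor_obtain[OF assms(5)] .
  show ?thesis unfolding u(2)
    by (rule hom_free_eqI[OF assms(1) mhom_comp[OF tensor_coset_hom assms(2)]
          mhom_comp[OF tensor_coset_hom assms(3)] _ u(1)])
      (use assms(4) in \<open>auto simp: pure_tensor_def\<close>)
qed

end

section \<open>Reduction of a free module modulo the maximal ideal\<close>

context local_ring
begin

text \<open>The map x \<mapsto> x \<otimes> 1 from F to F \<otimes> k. It turns out to be onto with
  kernel mF, so that F \<otimes> k can be handled through representatives in F.\<close>

definition residue_tensor :: "'s set \<Rightarrow> ('s \<Rightarrow> 'a) \<Rightarrow> (('s \<Rightarrow> 'a) \<times> 'a set \<Rightarrow> 'a) set"
  where "residue_tensor S x = pure_tensor R (\<F> S) \<kk> x (\<mm> +> \<one>)"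

abbreviation "reduced S \<equiv> tensor_product R (\<F> S) \<kk>"

lemma two_modules_residue: "two_modules R (\<F> S) \<kk>"
  by (simp add: two_modules_def free_is_module residue_module_is_module)

lemma reduced_is_module: "Module.module R (reduced S)"
  by (rule two_modules.tensor_is_module[OF two_modules_residue])

lemma residue_smult:
  assumes "a \<in> carrier R" "b \<in> carrier R"
  shows "a \<odot>\<^bsub>\<kk>\<^esub> (\<mm> +> b) = \<mm> +> (a \<otimes> b)"
  using assms by (simp add: residue_module_def restrict_scalars_def residue_field_simps)

lemma residue_in_carrier: "b \<in> carrier R \<Longrightarrow> \<mm> +> b \<in> carrier \<kk>"
  by (simp add: residue_module_carrier)

lemma residue_tensor_hom: "residue_tensor S \<in> mhom R (\<F> S) (reduced S)"
proof -
  interpret two_modules R "\<F> S" "\<kk>" by (rule two_modules_residue)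
  show ?thesis unfolding residue_tensor_def mhom_def
    using pure_closed pure_add_left pure_smult_left residue_in_carrier[OF one_closed] by auto
qed

text \<open>A scalar moves across the tensor sign: \<open>\<mm> +> a\<close> is \<open>a\<close>
  times the class of \<open>\<one>\<close>. Hence every pure tensor has the form y \<otimes>
  1.\<close>

lemma pure_residue:
  assumes "x \<in> carrier (\<F> S)" "a \<in> carrier R"
  shows "pure_tensor R (\<F> S) \<kk> x (\<mm> +> a) =
    residue_tensor S (a \<odot>\<^bsub>\<F> S\<^esub> x)"
proof -
  interpret two_modules R "\<F> S" "\<kk>" by (rule two_modules_residue)
  have "\<mm> +> a = a \<odot>\<^bsub>\<kk>\<^esub> (\<mm> +> \<one>)"
    using assms by (simp add: residue_smult)
  with assms show ?thesis unfolding residue_tensor_def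
    by (simp add: pure_smult_left pure_smult_right residue_in_carrier)
qed

lemma residue_tensor_surj:
  assumes "t \<in> carrier (reduced S)"
  obtains x where "x \<in> carrier (\<F> S)" "t = residue_tensor S x"
proof -
  interpret two_modules R "\<F> S" "\<kk>" by (rule two_modules_residue)
  obtain u where u: "u \<in> carrier pairs" "t = tensor_null R (\<F> S) \<kk> +>\<^bsub>pairs\<^esub> u"
    using tensor_obtain[OF assms] .
  \<comment> \<open>An arbitrary choice of representatives suffices: the pairs are the basis of a
    free module, so \<open>g\<close> below extends linearly whatever its values are.\<close>
  define rep where "rep k = (SOME a. a \<in> carrier R \<and> k = \<mm> +> a)" for k
  have rep: "rep k \<in> carrier R" "k = \<mm> +> rep k" if "k \<in> carrier \<kk>" for k
  proof -
    have "\<exists>a. a \<in> carrier R \<and> k = \<mm> +> a" using that unfolding residue_module_carrier by blast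
    from someI_ex[OF this] show "rep k \<in> carrier R" "k = \<mm> +> rep k" unfolding rep_def by auto
  qed
  define g where "g = (\<lambda>(x, k). rep k \<odot>\<^bsub>\<F> S\<^esub> x)"
  have g: "g \<in> carrier (\<F> S) \<times> carrier \<kk> \<rightarrow> carrier (\<F> S)"
    unfolding g_def using rep(1) by (auto intro!: M.smult_closed)
  let ?l = "free_lift R (\<F> S) (carrier (\<F> S) \<times> carrier \<kk>) g"
  have l: "?l \<in> mhom R pairs (\<F> S)" by (rule M.free_lift_hom[OF g])
  have "t = residue_tensor S (?l u)" unfolding u(2)
  proof (rule hom_free_eqI[OF reduced_is_module tensor_coset_hom mhom_comp[OF l residue_tensor_hom] _ u(1)])
    fix p assume p: "p \<in> carrier (\<F> S) \<times> carrier \<kk>"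
    then obtain x k where xk: "p = (x, k)" "x \<in> carrier (\<F> S)" "k \<in> carrier \<kk>" by blast
    have "residue_tensor S (?l (free_basis R (carrier (\<F> S) \<times> carrier \<kk>) p)) =
        residue_tensor S (rep k \<odot>\<^bsub>\<F> S\<^esub> x)"
      using M.free_lift_basis[OF g p] xk by (simp add: g_def)
    also have "\<dots> = pure_tensor R (\<F> S) \<kk> x k"
      using pure_residue[OF xk(2) rep(1)[OF xk(3)]] rep(2)[OF xk(3)] by simp
    finally show "tensor_null R (\<F> S) \<kk> +>\<^bsub>pairs\<^esub>
        free_basis R (carrier (\<F> S) \<times> carrier \<kk>) p =
      residue_tensor S (?l (free_basis R (carrier (\<F> S) \<times> carrier \<kk>) p))"
      by (simp add: pure_tensor_def xk)
  qed
  with that mhom_closed[OF l u(1)] show ?thesis by blast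
qed

lemma residue_tensor_max_ideal:
  assumes x: "x \<in> carrier (\<F> S)" and m: "\<And>s. s \<in> S \<Longrightarrow> x s \<in> \<mm>"
  shows "residue_tensor S x = \<zero>\<^bsub>reduced S\<^esub>"
proof -
  interpret two_modules R "\<F> S" "\<kk>" by (rule two_modules_residue)
  interpret \<kappa>: mod_hom R "\<F> S" "reduced S" "residue_tensor S"
    by unfold_locales (rule residue_tensor_hom)
  have z: "a \<odot>\<^bsub>reduced S\<^esub> residue_tensor S y = \<zero>\<^bsub>reduced S\<^esub>"
    if "a \<in> \<mm>" "y \<in> carrier (\<F> S)" for a y
  proof -
    have a: "a \<in> carrier R" using that mm.a_subset by blast
    have "a \<odot>\<^bsub>reduced S\<^esub> residue_tensor S y = residue_tensor S (a \<odot>\<^bsub>\<F> S\<^esub> y)"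
      using a that by simp
    also have "\<dots> = pure_tensor R (\<F> S) \<kk> y (\<mm> +> a)"
      using pure_residue[OF that(2) a] by simp
    \<comment> \<open>As \<open>a\<close> lies in the maximal ideal, its class is zero; writing this
      zero as a multiple by \<open>\<zero>\<close> lets the scalar be pulled out of the
      tensor.\<close>
    also have "\<mm> +> a = \<zero> \<odot>\<^bsub>\<kk>\<^esub> (\<mm> +> \<one>)"
      using residue_smult[of \<zero> \<one>] residue_eq_zero_iff[OF a] residue_eq_zero_iff[OF zero_closed] that by simp
    also have "pure_tensor R (\<F> S) \<kk> y \<dots> = \<zero>\<^bsub>reduced S\<^esub>"
      using that residue_in_carrier[OF one_closed]
      by (subst pure_smult_right) (auto simp: pure_closed)
    finally show ?thesis .
  qed
  have "residue_tensor S x = free_lift R (reduced S) S (\<lambda>s. residue_tensor S (free_basis R S s)) x"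
    by (rule hom_free_lift[OF reduced_is_module residue_tensor_hom x])
  also have "\<dots> = \<zero>\<^bsub>reduced S\<^esub>"
    unfolding free_lift_def using m z by (intro T.finsum_all0) auto
  finally show ?thesis .
qed

text \<open>From left to right, a functional detects the coordinate at \<open>s\<close>: the map
  taking (x, c) to \<open>x s\<close> times c is bilinear, so its extension \<open>E\<close> to the
  free module on pairs kills all tensor relations, while it takes (x, 1) to the class of
  \<open>x s\<close>.\<close>

lemma residue_tensor_eq_zero_iff:
  fixes S :: "'s set"
  assumes x: "x \<in> carrier (\<F> S)"
  shows "residue_tensor S x = \<zero>\<^bsub>reduced S\<^esub> \<longleftrightarrow> (\<forall>s\<in>S. x s \<in> \<mm>)"
proof
  interpret two_modules R "\<F> S" "\<kk>" by (rule two_modules_residue)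
  assume zero: "residue_tensor S x = \<zero>\<^bsub>reduced S\<^esub>"
  show "\<forall>s\<in>S. x s \<in> \<mm>"
  proof
    fix s assume s: "s \<in> S"
    let ?C = "carrier (\<F> S) \<times> carrier \<kk>"
    define g where "g = (\<lambda>(x :: 's \<Rightarrow> 'a, k). x s \<odot>\<^bsub>\<kk>\<^esub> k)"
    have g: "g \<in> ?C \<rightarrow> carrier \<kk>" using s by (auto simp: g_def)
    define E where "E = free_lift R \<kk> ?C g"
    have E: "E \<in> mhom R pairs \<kk>" unfolding E_def by (rule N.free_lift_hom[OF g])
    interpret E: mod_hom R pairs "\<kk>" E by unfold_locales (rule E)
    have Eb: "E (free_basis R ?C (y, k)) = y s \<odot>\<^bsub>\<kk>\<^esub> k"
      if "y \<in> carrier (\<F> S)" "k \<in> carrier \<kk>" for y k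
      unfolding E_def using N.free_lift_basis[OF g] that by (simp add: g_def)
    have comm: "a \<odot>\<^bsub>\<kk>\<^esub> (b \<odot>\<^bsub>\<kk>\<^esub> k) = b \<odot>\<^bsub>\<kk>\<^esub> (a \<odot>\<^bsub>\<kk>\<^esub> k)"
      if "a \<in> carrier R" "b \<in> carrier R" "k \<in> carrier \<kk>" for a b k
      using that by (metis N.smult_assoc1 m_comm)
    have "tensor_relations R (\<F> S) \<kk> \<subseteq> E.ker"
    proof
      fix u assume u: "u \<in> tensor_relations R (\<F> S) \<kk>"
      then have "u \<in> carrier pairs" using relations_closed by blast
      moreover have "E u = \<zero>\<^bsub>\<kk>\<^esub>"
        using u s comm unfolding tensor_relations_def Let_def
        by (auto simp: Eb N.smult_l_distr N.smult_r_distr N.smult_assoc1 N.M.minus_eq N.M.r_neg)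
      ultimately show "u \<in> E.ker" by (simp add: E.ker_def)
    qed
    then have "tensor_null R (\<F> S) \<kk> \<subseteq> E.ker"
      unfolding tensor_null_def by (rule P.span_is_subset[OF _ E.ker_is_submodule])
    moreover have "free_basis R ?C (x, \<mm> +> \<one>) \<in> tensor_null R (\<F> S) \<kk>"
      using zero x P.quotient_eq_zero_iff[OF null_submodule] P.quotient_zero[OF null_submodule]
      unfolding residue_tensor_def pure_tensor_def tensor_product_def
      by (simp add: residue_in_carrier)
    ultimately have "E (free_basis R ?C (x, \<mm> +> \<one>)) = \<zero>\<^bsub>\<kk>\<^esub>"
      unfolding E.ker_def by blast
    then have "x s \<odot>\<^bsub>\<kk>\<^esub> (\<mm> +> \<one>) = \<mm>"
      using x by (simp add: Eb residue_in_carrier residue_module_zero)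
    then show "x s \<in> \<mm>" using x s by (simp add: residue_smult residue_eq_zero_iff)
  qed
qed (use residue_tensor_max_ideal[OF x] in blast)

lemma residue_tensor_eq_iff:
  assumes "x \<in> carrier (\<F> S)" "y \<in> carrier (\<F> S)"
  shows "residue_tensor S x = residue_tensor S y \<longleftrightarrow> (\<forall>s\<in>S. x s \<ominus> y s \<in> \<mm>)"
proof -
  interpret F: Module.module R "\<F> S" by (rule free_is_module)
  interpret T: Module.module R "reduced S" by (rule reduced_is_module)
  interpret \<kappa>: mod_hom R "\<F> S" "reduced S" "residue_tensor S"
    by unfold_locales (rule residue_tensor_hom)
  have "residue_tensor S x = residue_tensor S y \<longleftrightarrow> residue_tensor S (x \<ominus>\<^bsub>\<F> S\<^esub> y) = \<zero>\<^bsub>reduced S\<^esub>"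
    using assms by (simp)
  then show ?thesis
    using residue_tensor_eq_zero_iff[of "x \<ominus>\<^bsub>\<F> S\<^esub> y" S] assms by simp
qed

lemma max_ideal_finsum:
  assumes "\<And>i. i \<in> I \<Longrightarrow> f i \<in> \<mm>"
  shows "(\<Oplus>i\<in>I. f i) \<in> \<mm>"
  using assms
proof (induct I rule: infinite_finite_induct)
  case (insert i I)
  moreover have "f \<in> insert i I \<rightarrow> carrier R" using insert.prems mm.a_subset by blast
  ultimately show ?case by (subst finsum_insert) auto
qed simp_all

text \<open>d x is a combination of the images of the basis elements with coefficients
  \<open>x s\<close>, so mF goes into mF'. For this reason linear maps can be reduced modulo the
  maximal ideal on representatives.\<close>

lemma hom_max_ideal:
  assumes d: "d \<in> mhom R (\<F> S) (\<F> S')" and x: "x \<in> carrier (\<F> S)"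
    and m: "\<And>s. s \<in> S \<Longrightarrow> x s \<in> \<mm>" and t: "t \<in> S'"
  shows "d x t \<in> \<mm>"
proof -
  interpret F: Module.module R "\<F> S'" by (rule free_is_module)
  let ?T = "{s \<in> S. x s \<noteq> \<zero>}"
  have c: "d (free_basis R S s) \<in> carrier (\<F> S')" if "s \<in> S" for s
    using that mhom_closed[OF d] by simp
  have ct: "d (free_basis R S s) t \<in> carrier R" if "s \<in> S" for s
    using free_coord[OF c[OF that] t] .
  have "d x t = (\<Oplus>s\<in>?T. (x s \<odot>\<^bsub>\<F> S'\<^esub> d (free_basis R S s)) t)"
    unfolding hom_free_lift[OF free_is_module d x] free_lift_def
    using x c t by (intro free_finsum_apply) auto
  also have "\<dots> \<in> \<mm>"
    using m ct t by (intro max_ideal_finsum) (auto intro!: mm.I_r_closed)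
  finally show ?thesis .
qed

end

section \<open>Induced maps, and dimension over the residue field\<close>

context local_ring
begin

text \<open>\<open>tensor_map\<close> is a definite description, so existence and uniqueness are
  both owed. Existence: x \<otimes> 1 \<mapsto> d x \<otimes> 1 does not depend on the
  representative, by \<open>hom_max_ideal\<close>. Uniqueness: agreement on pure tensors, together
  with extensionality.\<close>

lemma
  assumes d: "d \<in> mhom R (\<F> S) (\<F> S')"
  defines "\<delta> \<equiv> tensor_map R (\<F> S) (\<F> S') \<kk> d"
  shows tensor_map_hom: "\<delta> \<in> mhom R (reduced S) (reduced S')"
    and tensor_map_residue_tensor:
      "\<And>x. x \<in> carrier (\<F> S) \<Longrightarrow> \<delta> (residue_tensor S x) = residue_tensor S' (d x)"
proof -
  interpret F: Module.module R "\<F> S" by (rule free_is_module)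
  interpret F': Module.module R "\<F> S'" by (rule free_is_module)
  interpret T: Module.module R "reduced S" by (rule reduced_is_module)
  interpret T': Module.module R "reduced S'" by (rule reduced_is_module)
  interpret \<kappa>: mod_hom R "\<F> S" "reduced S" "residue_tensor S"
    by unfold_locales (rule residue_tensor_hom)
  interpret \<kappa>': mod_hom R "\<F> S'" "reduced S'" "residue_tensor S'"
    by unfold_locales (rule residue_tensor_hom)
  interpret d: mod_hom R "\<F> S" "\<F> S'" d by unfold_locales (rule d)
  let ?P = "\<lambda>h. h \<in> mhom R (reduced S) (reduced S') \<and> h \<in> extensional (carrier (reduced S)) \<and>
     (\<forall>x\<in>carrier (\<F> S). \<forall>y\<in>carrier \<kk>.
        h (pure_tensor R (\<F> S) \<kk> x y) =
        pure_tensor R (\<F> S') \<kk> (d x) y)"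
  define h where "h = (\<lambda>t\<in>carrier (reduced S).
    residue_tensor S' (d (SOME x. x \<in> carrier (\<F> S) \<and> residue_tensor S x = t)))"
  have h: "h (residue_tensor S x) = residue_tensor S' (d x)" if x: "x \<in> carrier (\<F> S)" for x
  proof -
    let ?x = "SOME y. y \<in> carrier (\<F> S) \<and> residue_tensor S y = residue_tensor S x"
    have y: "?x \<in> carrier (\<F> S)" "residue_tensor S ?x = residue_tensor S x"
      using someI[of "\<lambda>y. y \<in> carrier (\<F> S) \<and> residue_tensor S y = residue_tensor S x" x] x by auto
    then have "\<forall>s\<in>S. (?x \<ominus>\<^bsub>\<F> S\<^esub> x) s \<in> \<mm>"
      using residue_tensor_eq_iff[OF y(1) x] x by simp
    then have "\<forall>s\<in>S'. d (?x \<ominus>\<^bsub>\<F> S\<^esub> x) s \<in> \<mm>"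
      using hom_max_ideal[OF d F.M.minus_closed[OF y(1) x]] by blast
    then have "residue_tensor S' (d ?x) = residue_tensor S' (d x)"
      using y(1) x by (subst residue_tensor_eq_iff) auto
    then show ?thesis using x by (simp add: h_def)
  qed
  have "?P h"
  proof (intro conjI ballI)
    show "h \<in> mhom R (reduced S) (reduced S')"
      unfolding mhom_def
    proof (intro CollectI conjI allI impI Pi_I; (elim conjE)?)
      fix t assume "t \<in> carrier (reduced S)"
      then obtain x where "x \<in> carrier (\<F> S)" "t = residue_tensor S x" by (rule residue_tensor_surj)
      then show "h t \<in> carrier (reduced S')" using h by simp
    next
      fix t u assume "t \<in> carrier (reduced S)" "u \<in> carrier (reduced S)"
      then obtain x y where xy: "x \<in> carrier (\<F> S)" "t = residue_tensor S x"
        "y \<in> carrier (\<F> S)" "u = residue_tensor S y" by (metis residue_tensor_surj)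
      then show "h (t \<oplus>\<^bsub>reduced S\<^esub> u) = h t \<oplus>\<^bsub>reduced S'\<^esub> h u"
        using h[of "x \<oplus>\<^bsub>\<F> S\<^esub> y"] h by simp
    next
      fix a t assume a: "a \<in> carrier R" and "t \<in> carrier (reduced S)"
      then obtain x where x: "x \<in> carrier (\<F> S)" "t = residue_tensor S x" by (metis residue_tensor_surj)
      then show "h (a \<odot>\<^bsub>reduced S\<^esub> t) = a \<odot>\<^bsub>reduced S'\<^esub> h t"
        using h[of "a \<odot>\<^bsub>\<F> S\<^esub> x"] h a by simp
    qed
    show "h \<in> extensional (carrier (reduced S))" by (simp add: h_def)
    fix x y assume x: "x \<in> carrier (\<F> S)" and "y \<in> carrier \<kk>"
    then obtain a where a: "a \<in> carrier R" "y = \<mm> +> a" by (auto simp: residue_module_carrier)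
    have "h (residue_tensor S (a \<odot>\<^bsub>\<F> S\<^esub> x)) = residue_tensor S' (d (a \<odot>\<^bsub>\<F> S\<^esub> x))"
      by (rule h) (use a x in simp)
    also have "d (a \<odot>\<^bsub>\<F> S\<^esub> x) = a \<odot>\<^bsub>\<F> S'\<^esub> d x" using a x by simp
    finally show "h (pure_tensor R (\<F> S) \<kk> x y) =
        pure_tensor R (\<F> S') \<kk> (d x) y"
      unfolding a(2) pure_residue[OF x a(1)] pure_residue[OF d.f_im[OF x] a(1)] .
  qed
  moreover have "g = h" if "?P g" for g
  proof (rule extensionalityI)
    show "g \<in> extensional (carrier (reduced S))" "h \<in> extensional (carrier (reduced S))"
      using that \<open>?P h\<close> by blast+
    fix t assume t: "t \<in> carrier (reduced S)"
    show "g t = h t"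
      by (rule two_modules.tensor_hom_eqI[OF two_modules_residue reduced_is_module[of S'] _ _ _ t])
        (use that \<open>?P h\<close> in simp_all)
  qed
  ultimately have "\<delta> = h"
    unfolding \<delta>_def tensor_map_def by (intro the_equality)
  with \<open>?P h\<close> h show "\<delta> \<in> mhom R (reduced S) (reduced S')"
    "\<And>x. x \<in> carrier (\<F> S) \<Longrightarrow> \<delta> (residue_tensor S x) = residue_tensor S' (d x)"
    by auto
qed

text \<open>\<open>V\<close> is presented as F/mF. The maximal ideal then kills \<open>V\<close>, so
  \<open>residue_space\<close> is a vector space, and the images of the free basis form a basis of
  it.\<close>

lemma dim_residue_space:
  assumes V: "Module.module R V" and \<theta>: "\<theta> \<in> mhom R (\<F> S) V" and S: "finite S"
    and surj: "\<theta> ` carrier (\<F> S) = carrier V"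
    and ker: "\<And>x. x \<in> carrier (\<F> S) \<Longrightarrow> \<theta> x = \<zero>\<^bsub>V\<^esub> \<longleftrightarrow> (\<forall>s\<in>S. x s \<in> \<mm>)"
  shows "vectorspace.dim (residue_field R) (residue_space R V) = card S"
proof -
  let ?K = "residue_field R" and ?W = "residue_space R V" and ?F = "\<F> S"
  interpret V: Module.module R V by (rule V)
  interpret F: Module.module R ?F by (rule free_is_module)
  interpret \<theta>: mod_hom R ?F V \<theta> by unfold_locales (rule \<theta>)
  interpret K: field ?K by (rule residue_field_is_field)
  have W [simp]: "carrier ?W = carrier V" "\<zero>\<^bsub>?W\<^esub> = \<zero>\<^bsub>V\<^esub>" "add ?W = add V"
    by (simp_all add: residue_space_def)
  have kill: "a \<odot>\<^bsub>V\<^esub> v = \<zero>\<^bsub>V\<^esub>" if a: "a \<in> \<mm>" and v: "v \<in> carrier V" for a v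
  proof -
    obtain x where x: "x \<in> carrier ?F" "v = \<theta> x" using v surj by blast
    have aR: "a \<in> carrier R" using a mm.a_subset by blast
    have "\<theta> (a \<odot>\<^bsub>?F\<^esub> x) = \<zero>\<^bsub>V\<^esub>"
      using a aR x by (subst ker) (auto intro: mm.I_r_closed)
    then show ?thesis using x aR by simp
  qed
  \<comment> \<open>\<open>the_elem\<close> asks for a singleton: the representatives of a class act
    on \<open>v\<close> alike, because they differ by elements that kill \<open>v\<close>.\<close>
  have sm: "(\<mm> +> a) \<odot>\<^bsub>?W\<^esub> v = a \<odot>\<^bsub>V\<^esub> v" if a: "a \<in> carrier R" and v: "v \<in> carrier V" for a v
  proof -
    have "b \<odot>\<^bsub>V\<^esub> v = a \<odot>\<^bsub>V\<^esub> v" if b: "b \<in> \<mm> +> a" for b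
    proof -
      obtain h where h: "h \<in> \<mm>" "b = h \<oplus> a" using b by (auto simp: a_r_coset_def')
      have "h \<in> carrier R" using h mm.a_subset by blast
      then show ?thesis using h a v kill[OF h(1) v] by (simp add: V.smult_l_distr)
    qed
    moreover have "a \<in> \<mm> +> a" using a by (rule mm.a_rcos_self)
    ultimately have "(\<lambda>b. b \<odot>\<^bsub>V\<^esub> v) ` (\<mm> +> a) = {a \<odot>\<^bsub>V\<^esub> v}" by blast
    then show ?thesis by (simp add: residue_space_def)
  qed
  have "Module.module ?K ?W"
  proof (rule Module.moduleI)
    show "cring ?K" by (rule K.is_cring)
    show "abelian_group ?W"
    proof (rule abelian_groupI)
      fix v assume "v \<in> carrier ?W"
      then show "\<exists>w\<in>carrier ?W. w \<oplus>\<^bsub>?W\<^esub> v = \<zero>\<^bsub>?W\<^esub>"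
        by (intro bexI[of _ "\<ominus>\<^bsub>V\<^esub> v"]) (simp_all add: V.M.l_neg)
    qed (simp_all add: V.M.a_ac)
  qed (auto simp: residue_field_simps sm V.smult_l_distr V.smult_r_distr V.smult_assoc1)
  then interpret W: vectorspace ?K ?W
    by (simp add: vectorspace_def K.field_axioms)
  have fs: "finsum ?W f I = finsum V f I" for f :: "'z \<Rightarrow> _" and I
    by (rule finsum_eq_of_same_group) simp_all
  let ?b = "\<lambda>s. \<theta> (free_basis R S s)"
  have bV: "?b \<in> S \<rightarrow> carrier V" by auto
  have ex: "\<theta> x = (\<Oplus>\<^bsub>V\<^esub>s\<in>S. x s \<odot>\<^bsub>V\<^esub> ?b s)" if "x \<in> carrier ?F" for x
    using hom_free_lift[OF V \<theta> that] V.free_lift_finite[OF S bV that] by simp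
  \<comment> \<open>The difference of two distinct basis vectors has coordinate
    \<open>\<one>\<close> at \<open>s\<close>, outside the maximal ideal, and so is not in the
    kernel.\<close>
  have inj: "inj_on ?b S"
  proof (rule inj_onI)
    fix s t assume st: "s \<in> S" "t \<in> S" "?b s = ?b t"
    then have "\<theta> (free_basis R S s \<ominus>\<^bsub>?F\<^esub> free_basis R S t) = \<zero>\<^bsub>V\<^esub>" by (simp add: V.M.minus_eq V.M.r_neg)
    then have "(free_basis R S s \<ominus>\<^bsub>?F\<^esub> free_basis R S t) s \<in> \<mm>"
      using st ker[OF F.M.minus_closed[OF free_basis_closed free_basis_closed]] by blast
    then show "s = t" using st one_notin_max_ideal by (cases "s = t") (simp_all add: minus_eq)
  qed
  have lc: "W.lincomb a (?b ` S) = (\<Oplus>\<^bsub>V\<^esub>s\<in>S. a (?b s) \<odot>\<^bsub>?W\<^esub> ?b s)"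
    if "a \<in> ?b ` S \<rightarrow> carrier ?K" for a
    unfolding W.lincomb_def fs using that bV
    by (subst V.M.finsum_reindex[OF _ inj]) (auto intro!: W.smult_closed[unfolded W])
  have "W.basis (?b ` S)"
    unfolding W.basis_def
  proof (intro conjI)
    show sub: "?b ` S \<subseteq> carrier ?W" using bV by auto
    show "W.gen_set (?b ` S)"
    proof
      show "W.span (?b ` S) \<subseteq> carrier ?W" using W.span_is_submodule[OF sub] by (simp add: submodule_def)
      show "carrier ?W \<subseteq> W.span (?b ` S)"
      proof
        fix v assume "v \<in> carrier ?W"
        then obtain x where x: "x \<in> carrier ?F" "v = \<theta> x" using surj by auto
        \<comment> \<open>\<open>lincomb\<close> attaches coefficients to vectors and not to
          indices; injectivity of the basis map permits the passage through
          \<open>inv_into\<close>.\<close>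
        define a where "a w = \<mm> +> x (inv_into S ?b w)" for w
        have a: "a (?b s) = \<mm> +> x s" if "s \<in> S" for s
          unfolding a_def using inv_into_f_f[OF inj that] by simp
        have aK: "a \<in> ?b ` S \<rightarrow> carrier ?K" using a x by (auto simp: residue_field_simps)
        have "W.lincomb a (?b ` S) = (\<Oplus>\<^bsub>V\<^esub>s\<in>S. x s \<odot>\<^bsub>V\<^esub> ?b s)"
          unfolding lc[OF aK] using x by (intro V.M.finsum_cong') (simp_all add: a sm Pi_iff)
        then have "W.lincomb a (?b ` S) = v" unfolding x(2) ex[OF x(1)] .
        then show "v \<in> W.span (?b ` S)" using S aK unfolding W.span_def by blast
      qed
    qed
    show "W.lin_indpt (?b ` S)"
    proof (rule W.finite_lin_indpt2)
      show "finite (?b ` S)" using S by simp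
      show "?b ` S \<subseteq> carrier ?W" by (rule sub)
      fix a assume a: "a \<in> ?b ` S \<rightarrow> carrier ?K" and z: "W.lincomb a (?b ` S) = \<zero>\<^bsub>?W\<^esub>"
      have "\<forall>s\<in>S. \<exists>r. r \<in> carrier R \<and> a (?b s) = \<mm> +> r"
        using a by (auto simp: residue_field_simps Pi_iff)
      then obtain r where r: "\<And>s. s \<in> S \<Longrightarrow> r s \<in> carrier R" "\<And>s. s \<in> S \<Longrightarrow> a (?b s) = \<mm> +> r s"
        by metis
      let ?x = "\<lambda>s\<in>S. r s"
      have x: "?x \<in> carrier ?F" using r S by (auto simp: free_carrier_finite)
      have "\<theta> ?x = (\<Oplus>\<^bsub>V\<^esub>s\<in>S. a (?b s) \<odot>\<^bsub>?W\<^esub> ?b s)"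
        unfolding ex[OF x] using r by (intro V.M.finsum_cong') (simp_all add: sm Pi_iff)
      also have "\<dots> = \<zero>\<^bsub>V\<^esub>" using z unfolding lc[OF a] by simp
      finally have "\<forall>s\<in>S. r s \<in> \<mm>" using ker[OF x] by simp
      then show "\<forall>v\<in>?b ` S. a v = \<zero>\<^bsub>?K\<^esub>"
        using r residue_eq_zero_iff by (simp add: residue_field_simps)
    qed
  qed
  then have "W.dim = card (?b ` S)" using S by (intro W.dim_basis) auto
  then show ?thesis using card_image[OF inj] by simp
qed

end

section \<open>Comparison of free resolutions\<close>

text \<open>\<open>free_resolution\<close> with arbitrary basis sets in place of
  \<open>{..<b i}\<close>, so that the complex F \<otimes> G, whose basis consists of triples, falls
  under it.\<close>

definition resolution ::
    "('a, 'r) ring_scheme \<Rightarrow> ('a, 'l, 'm) module_scheme \<Rightarrow>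
     (nat \<Rightarrow> 's set) \<Rightarrow> (('s \<Rightarrow> 'a) \<Rightarrow> 'l) \<Rightarrow> (nat \<Rightarrow> ('s \<Rightarrow> 'a) \<Rightarrow> ('s \<Rightarrow> 'a)) \<Rightarrow> bool"
  where "resolution A L S \<epsilon> d \<longleftrightarrow>
    (let F = (\<lambda>i. free_module A (S i)) in
       \<epsilon> \<in> mhom A (F 0) L \<and>
       (\<forall>i. d i \<in> mhom A (F (Suc i)) (F i)) \<and>
       \<epsilon> ` carrier (F 0) = carrier L \<and>
       d 0 ` carrier (F 1) = {x \<in> carrier (F 0). \<epsilon> x = \<zero>\<^bsub>L\<^esub>} \<and>
       (\<forall>i. d (Suc i) ` carrier (F (Suc (Suc i))) = {x \<in> carrier (F (Suc i)). d i x = \<zero>\<^bsub>F i\<^esub>}))"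

lemma free_resolution_eq_resolution: "free_resolution A L b \<epsilon> d \<longleftrightarrow> resolution A L (\<lambda>i. {..<b i}) \<epsilon> d"
  unfolding free_resolution_def resolution_def by simp

lemma minus_zero_right: "abelian_group G \<Longrightarrow> x \<in> carrier G \<Longrightarrow> x \<ominus>\<^bsub>G\<^esub> \<zero>\<^bsub>G\<^esub> = x"
  by (metis abelian_group.a_group abelian_group.minus_eq abelian_group.r_neg abelian_monoid.r_zero
      abelian_group.a_inv_closed abelian_group.axioms(1) abelian_group.l_neg abelian_monoid.l_zero abelian_monoid.zero_closed)

lemma mhom_minus:
  assumes "Module.module R M" "Module.module R N" "f \<in> mhom R M N" "g \<in> mhom R M N"
  shows "(\<lambda>x. f x \<ominus>\<^bsub>N\<^esub> g x) \<in> mhom R M N"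
proof -
  interpret N: Module.module R N by fact
  interpret f: mod_hom R M N f by (rule mod_homI) fact+
  interpret g: mod_hom R M N g by (rule mod_homI) fact+
  show ?thesis unfolding mhom_def
    by (auto simp: N.M.minus_eq N.M.minus_add N.smult_r_distr N.smult_r_minus N.M.a_ac)
qed

locale free_res = L: Module.module R L
  for R (structure) and L :: "('a, 'l, 'm) module_scheme" and S :: "nat \<Rightarrow> 's set" and \<epsilon> d +
  assumes res: "resolution R L S \<epsilon> d"
begin

abbreviation "F i \<equiv> free_module R (S i)"

sublocale F: Module.module R "F i" for i by (rule L.free_is_module)

lemma aug_hom: "\<epsilon> \<in> mhom R (F 0) L" and d_hom: "d i \<in> mhom R (F (Suc i)) (F i)"
  and aug_surj: "\<epsilon> ` carrier (F 0) = carrier L"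
  and exact_0: "d 0 ` carrier (F (Suc 0)) = {x \<in> carrier (F 0). \<epsilon> x = \<zero>\<^bsub>L\<^esub>}"
  and exact_Suc: "d (Suc i) ` carrier (F (Suc (Suc i))) = {x \<in> carrier (F (Suc i)). d i x = \<zero>\<^bsub>F i\<^esub>}"
  using res unfolding resolution_def Let_def by simp_all

sublocale aug: mod_hom R "F 0" L \<epsilon> by unfold_locales (rule aug_hom)
sublocale d: mod_hom R "F (Suc i)" "F i" "d i" for i by unfold_locales (rule d_hom)

lemma d_d: "x \<in> carrier (F (Suc (Suc i))) \<Longrightarrow> d i (d (Suc i) x) = \<zero>\<^bsub>F i\<^esub>"
  using exact_Suc[of i] by blast

lemma aug_d: "x \<in> carrier (F (Suc 0)) \<Longrightarrow> \<epsilon> (d 0 x) = \<zero>\<^bsub>L\<^esub>"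
  using exact_0 by blast

lemma exact_0E:
  assumes "x \<in> carrier (F 0)" "\<epsilon> x = \<zero>\<^bsub>L\<^esub>"
  obtains y where "y \<in> carrier (F (Suc 0))" "x = d 0 y"
  using exact_0 assms by blast

lemma exact_SucE:
  assumes "x \<in> carrier (F (Suc i))" "d i x = \<zero>\<^bsub>F i\<^esub>"
  obtains y where "y \<in> carrier (F (Suc (Suc i)))" "x = d (Suc i) y"
  using exact_Suc[of i] assms by blast

end

text \<open>Free modules are projective: it is enough to choose preimages for the values of
  \<open>g\<close> on the basis.\<close>

lemma free_lift_through:
  assumes M: "Module.module R M" and N: "Module.module R N"
    and g: "g \<in> mhom R (free_module R S) N" and p: "p \<in> mhom R M N"
    and img: "\<And>x. x \<in> carrier (free_module R S) \<Longrightarrow> \<exists>m\<in>carrier M. p m = g x"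
  shows "\<exists>f\<in>mhom R (free_module R S) M. \<forall>x\<in>carrier (free_module R S). p (f x) = g x"
proof -
  interpret M: Module.module R M by (rule M)
  have "\<forall>s\<in>S. \<exists>m. m \<in> carrier M \<and> p m = g (free_basis R S s)" using img[OF M.free_basis_closed] by blast
  then obtain c where c: "\<And>s. s \<in> S \<Longrightarrow> c s \<in> carrier M" "\<And>s. s \<in> S \<Longrightarrow> p (c s) = g (free_basis R S s)"
    by metis
  have cS: "c \<in> S \<rightarrow> carrier M" using c by auto
  note f = M.free_lift_hom[OF cS]
  have "p (free_lift R M S c x) = g x" if "x \<in> carrier (free_module R S)" for x
    by (rule hom_free_eqI[OF N mhom_comp[OF f p] g _ that]) (simp add: M.free_lift_basis[OF cS] c)
  with f show ?thesis by blast
qed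

definition chain_map ::
    "('a, 'r) ring_scheme \<Rightarrow> (nat \<Rightarrow> 's set) \<Rightarrow> (('s \<Rightarrow> 'a) \<Rightarrow> 'l) \<Rightarrow> (nat \<Rightarrow> ('s \<Rightarrow> 'a) \<Rightarrow> ('s \<Rightarrow> 'a)) \<Rightarrow>
     (nat \<Rightarrow> 't set) \<Rightarrow> (('t \<Rightarrow> 'a) \<Rightarrow> 'l) \<Rightarrow> (nat \<Rightarrow> ('t \<Rightarrow> 'a) \<Rightarrow> ('t \<Rightarrow> 'a)) \<Rightarrow>
     (nat \<Rightarrow> ('s \<Rightarrow> 'a) \<Rightarrow> ('t \<Rightarrow> 'a)) \<Rightarrow> bool"
  where "chain_map R S \<epsilon> d S' \<epsilon>' d' \<phi> \<longleftrightarrow>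
    (\<forall>i. \<phi> i \<in> mhom R (free_module R (S i)) (free_module R (S' i))) \<and>
    (\<forall>x\<in>carrier (free_module R (S 0)). \<epsilon>' (\<phi> 0 x) = \<epsilon> x) \<and>
    (\<forall>i. \<forall>x\<in>carrier (free_module R (S (Suc i))). d' i (\<phi> (Suc i) x) = \<phi> i (d i x))"

lemma chain_mapD:
  assumes "chain_map R S \<epsilon> d S' \<epsilon>' d' \<phi>"
  shows "\<phi> i \<in> mhom R (free_module R (S i)) (free_module R (S' i))"
    and "x \<in> carrier (free_module R (S 0)) \<Longrightarrow> \<epsilon>' (\<phi> 0 x) = \<epsilon> x"
    and "y \<in> carrier (free_module R (S (Suc i))) \<Longrightarrow> d' i (\<phi> (Suc i) y) = \<phi> i (d i y)"
  using assms unfolding chain_map_def by blast+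

lemma chain_map_exists:
  assumes "free_res R L S \<epsilon> d" "free_res R L S' \<epsilon>' d'"
  shows "\<exists>\<phi>. chain_map R S \<epsilon> d S' \<epsilon>' d' \<phi>"
proof -
  interpret A: free_res R L S \<epsilon> d by fact
  interpret B: free_res R L S' \<epsilon>' d' by fact
  \<comment> \<open>The last conjunct is the solvability of the next step. It follows from exactness
    at the augmentation in degree 0 and from exactness of \<open>d'\<close> later; carrying it along
    makes the choice step uniform. The conjunct for \<open>i = 0\<close> ties the start to the
    augmentations.\<close>
  let ?P = "\<lambda>i \<phi>. \<phi> \<in> mhom R (A.F i) (B.F i) \<and> (i = 0 \<longrightarrow> (\<forall>x\<in>carrier (A.F 0). \<epsilon>' (\<phi> x) = \<epsilon> x)) \<and>
    (\<forall>x\<in>carrier (A.F (Suc i)). \<exists>y\<in>carrier (B.F (Suc i)). d' i y = \<phi> (d i x))"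
  let ?Q = "\<lambda>i \<phi> \<psi>. \<forall>x\<in>carrier (A.F (Suc i)). d' i (\<psi> x) = \<phi> (d i x)"
  have ex: "\<exists>\<phi>. \<forall>i. ?P i (\<phi> i) \<and> ?Q i (\<phi> i) (\<phi> (Suc i))"
  proof (rule dependent_nat_choice)
    have "\<exists>m\<in>carrier (B.F 0). \<epsilon>' m = \<epsilon> x" if "x \<in> carrier (A.F 0)" for x
    proof -
      have "\<epsilon> x \<in> \<epsilon>' ` carrier (B.F 0)" using B.aug_surj that by simp
      then show ?thesis by auto
    qed
    then obtain \<phi> where \<phi>: "\<phi> \<in> mhom R (A.F 0) (B.F 0)" "\<And>x. x \<in> carrier (A.F 0) \<Longrightarrow> \<epsilon>' (\<phi> x) = \<epsilon> x"
      using free_lift_through[OF B.F.module_axioms A.L.module_axioms A.aug_hom B.aug_hom] by blast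
    moreover have "\<exists>y\<in>carrier (B.F (Suc 0)). d' 0 y = \<phi> (d 0 x)" if x: "x \<in> carrier (A.F (Suc 0))" for x
    proof (rule B.exact_0E)
      show "\<phi> (d 0 x) \<in> carrier (B.F 0)" using x mhom_closed[OF \<phi>(1)] by simp
      show "\<epsilon>' (\<phi> (d 0 x)) = \<zero>\<^bsub>L\<^esub>" using x \<phi>(2) A.aug_d by simp
    qed auto
    ultimately show "\<exists>\<phi>. ?P 0 \<phi>" by blast
  next
    fix \<phi> i assume P: "?P i \<phi>"
    then interpret \<phi>: mod_hom R "A.F i" "B.F i" \<phi> by (intro mod_homI A.F.module_axioms B.F.module_axioms) simp
    have "\<exists>m\<in>carrier (B.F (Suc i)). d' i m = \<phi> (d i x)" if "x \<in> carrier (A.F (Suc i))" for x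
      using P that by blast
    then obtain \<psi> where \<psi>: "\<psi> \<in> mhom R (A.F (Suc i)) (B.F (Suc i))"
        "\<And>x. x \<in> carrier (A.F (Suc i)) \<Longrightarrow> d' i (\<psi> x) = \<phi> (d i x)"
      using free_lift_through[OF B.F.module_axioms B.F.module_axioms mhom_comp[OF A.d_hom \<phi>.f_hom] B.d_hom] by blast
    have "\<exists>y\<in>carrier (B.F (Suc (Suc i))). d' (Suc i) y = \<psi> (d (Suc i) x)"
      if x: "x \<in> carrier (A.F (Suc (Suc i)))" for x
    proof (rule B.exact_SucE)
      show "\<psi> (d (Suc i) x) \<in> carrier (B.F (Suc i))" using x mhom_closed[OF \<psi>(1)] by simp
      show "d' i (\<psi> (d (Suc i) x)) = \<zero>\<^bsub>B.F i\<^esub>" using x \<psi>(2) A.d_d by simp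
    qed auto
    with \<psi> show "\<exists>\<psi>. ?P (Suc i) \<psi> \<and> ?Q i \<phi> \<psi>" by auto
  qed
  then obtain \<phi> where \<phi>: "\<forall>i. ?P i (\<phi> i) \<and> ?Q i (\<phi> i) (\<phi> (Suc i))" by (elim exE)
  show ?thesis unfolding chain_map_def by (intro exI[of _ \<phi>]) (use \<phi> in blast)
qed

text \<open>The homotopy is solved for degree by degree. The right-hand side \<phi> - h d is a cycle
  because d' h = \<phi> - h d holds one degree lower and d d = 0; exactness then lifts it.\<close>

lemma null_homotopy_exists:
  assumes "free_res R L S \<epsilon> d" "free_res R L S' \<epsilon>' d'"
    and \<phi>: "\<And>i. \<phi> i \<in> mhom R (free_module R (S i)) (free_module R (S' i))"
    and \<phi>0: "\<And>x. x \<in> carrier (free_module R (S 0)) \<Longrightarrow> \<epsilon>' (\<phi> 0 x) = \<zero>\<^bsub>L\<^esub>"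
    and \<phi>d: "\<And>i x. x \<in> carrier (free_module R (S (Suc i))) \<Longrightarrow> d' i (\<phi> (Suc i) x) = \<phi> i (d i x)"
  obtains h where "\<And>i. h i \<in> mhom R (free_module R (S i)) (free_module R (S' (Suc i)))"
    "\<And>x. x \<in> carrier (free_module R (S 0)) \<Longrightarrow> d' 0 (h 0 x) = \<phi> 0 x"
    "\<And>i x. x \<in> carrier (free_module R (S (Suc i))) \<Longrightarrow>
      d' (Suc i) (h (Suc i) x) = \<phi> (Suc i) x \<ominus>\<^bsub>free_module R (S' (Suc i))\<^esub> h i (d i x)"
proof -
  interpret A: free_res R L S \<epsilon> d by fact
  interpret B: free_res R L S' \<epsilon>' d' by fact
  interpret \<phi>: mod_hom R "A.F i" "B.F i" "\<phi> i" for i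
    by (rule mod_homI[OF A.F.module_axioms B.F.module_axioms \<phi>])
  \<comment> \<open>As for chain maps, the invariant records that the right-hand side of the next
    equation is a cycle.\<close>
  let ?P = "\<lambda>i h. h \<in> mhom R (A.F i) (B.F (Suc i)) \<and> (i = 0 \<longrightarrow> (\<forall>x\<in>carrier (A.F 0). d' 0 (h x) = \<phi> 0 x)) \<and>
    (\<forall>x\<in>carrier (A.F (Suc i)). d' i (\<phi> (Suc i) x \<ominus>\<^bsub>B.F (Suc i)\<^esub> h (d i x)) = \<zero>\<^bsub>B.F i\<^esub>)"
  let ?Q = "\<lambda>i h k. \<forall>x\<in>carrier (A.F (Suc i)). d' (Suc i) (k x) = \<phi> (Suc i) x \<ominus>\<^bsub>B.F (Suc i)\<^esub> h (d i x)"
  have ex: "\<exists>h. \<forall>i. ?P i (h i) \<and> ?Q i (h i) (h (Suc i))"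
  proof (rule dependent_nat_choice)
    have "\<exists>m\<in>carrier (B.F (Suc 0)). d' 0 m = \<phi> 0 x" if x: "x \<in> carrier (A.F 0)" for x
      by (rule B.exact_0E[of "\<phi> 0 x"]) (use x \<phi>0 in auto)
    then obtain h where h: "h \<in> mhom R (A.F 0) (B.F (Suc 0))" "\<And>x. x \<in> carrier (A.F 0) \<Longrightarrow> d' 0 (h x) = \<phi> 0 x"
      using free_lift_through[OF B.F.module_axioms B.F.module_axioms \<phi> B.d_hom] by blast
    have "d' 0 (\<phi> (Suc 0) x \<ominus>\<^bsub>B.F (Suc 0)\<^esub> h (d 0 x)) = \<zero>\<^bsub>B.F 0\<^esub>" if x: "x \<in> carrier (A.F (Suc 0))" for x
      using x h(2) \<phi>d mhom_closed[OF h(1)] by (simp add: B.F.M.minus_eq B.F.M.r_neg)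
    with h show "\<exists>h. ?P 0 h" by blast
  next
    fix h i assume P: "?P i h"
    then interpret h: mod_hom R "A.F i" "B.F (Suc i)" h by (intro mod_homI A.F.module_axioms B.F.module_axioms) simp
    let ?g = "\<lambda>x. \<phi> (Suc i) x \<ominus>\<^bsub>B.F (Suc i)\<^esub> h (d i x)"
    have g: "?g \<in> mhom R (A.F (Suc i)) (B.F (Suc i))"
      by (rule mhom_minus[OF A.F.module_axioms B.F.module_axioms \<phi> mhom_comp[OF A.d_hom h.f_hom]])
    have "\<exists>m\<in>carrier (B.F (Suc (Suc i))). d' (Suc i) m = ?g x" if x: "x \<in> carrier (A.F (Suc i))" for x
      by (rule B.exact_SucE[of "?g x" i]) (use x P mhom_closed[OF g] in auto)
    then obtain k where k: "k \<in> mhom R (A.F (Suc i)) (B.F (Suc (Suc i)))"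
        "\<And>x. x \<in> carrier (A.F (Suc i)) \<Longrightarrow> d' (Suc i) (k x) = ?g x"
      using free_lift_through[OF B.F.module_axioms B.F.module_axioms g B.d_hom] by blast
    have "d' (Suc i) (\<phi> (Suc (Suc i)) x \<ominus>\<^bsub>B.F (Suc (Suc i))\<^esub> k (d (Suc i) x)) = \<zero>\<^bsub>B.F (Suc i)\<^esub>"
      if x: "x \<in> carrier (A.F (Suc (Suc i)))" for x
      using x k(2)[of "d (Suc i) x"] \<phi>d mhom_closed[OF k(1)] A.d_d
      by (simp add: minus_zero_right[OF B.F.M.abelian_group_axioms])
    with k show "\<exists>k. ?P (Suc i) k \<and> ?Q i h k" by auto
  qed
  then obtain h where h: "\<forall>i. ?P i (h i) \<and> ?Q i (h i) (h (Suc i))" by (elim exE)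
  show thesis by (rule that[of h]) (insert h, metis+)
qed

text \<open>The difference \<psi> \<phi> - id becomes zero under the augmentation, hence is
  null-homotopic. Exchanging the two resolutions treats the other composite.\<close>

lemma homotopy_exists:
  assumes A: "free_res R L S \<epsilon> d" and B: "free_res R L S' \<epsilon>' d'"
    and \<phi>: "chain_map R S \<epsilon> d S' \<epsilon>' d' \<phi>" and \<psi>: "chain_map R S' \<epsilon>' d' S \<epsilon> d \<psi>"
  shows "\<exists>h. (\<forall>i. h i \<in> mhom R (free_module R (S i)) (free_module R (S (Suc i)))) \<and>
    (\<forall>x\<in>carrier (free_module R (S 0)). \<psi> 0 (\<phi> 0 x) \<ominus>\<^bsub>free_module R (S 0)\<^esub> x = d 0 (h 0 x)) \<and>
    (\<forall>i. \<forall>x\<in>carrier (free_module R (S (Suc i))).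
      \<psi> (Suc i) (\<phi> (Suc i) x) \<ominus>\<^bsub>free_module R (S (Suc i))\<^esub> x =
      d (Suc i) (h (Suc i) x) \<oplus>\<^bsub>free_module R (S (Suc i))\<^esub> h i (d i x))"
proof -
  note \<phi> = chain_mapD[OF \<phi>] and \<psi> = chain_mapD[OF \<psi>]
  interpret A: free_res R L S \<epsilon> d by fact
  interpret B: free_res R L S' \<epsilon>' d' by fact
  interpret \<phi>: mod_hom R "A.F i" "B.F i" "\<phi> i" for i by (rule mod_homI[OF A.F.module_axioms B.F.module_axioms \<phi>(1)])
  interpret \<psi>: mod_hom R "B.F i" "A.F i" "\<psi> i" for i by (rule mod_homI[OF B.F.module_axioms A.F.module_axioms \<psi>(1)])
  let ?f = "\<lambda>i x. \<psi> i (\<phi> i x) \<ominus>\<^bsub>A.F i\<^esub> x"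
  have id: "(\<lambda>x. x) \<in> mhom R (A.F i) (A.F i)" for i by (simp add: mhom_def)
  have f: "?f i \<in> mhom R (A.F i) (A.F i)" for i
    by (rule mhom_minus[OF A.F.module_axioms A.F.module_axioms mhom_comp[OF \<phi>(1) \<psi>(1)] id])
  have f0: "\<epsilon> (?f 0 x) = \<zero>\<^bsub>L\<^esub>" if "x \<in> carrier (A.F 0)" for x
    using that \<phi>(2) \<psi>(2) by (simp add: A.L.M.minus_eq A.L.M.r_neg)
  have fd: "d i (?f (Suc i) x) = ?f i (d i x)" if "x \<in> carrier (A.F (Suc i))" for i x
    using that \<phi>(3) \<psi>(3) by simp
  show ?thesis
  proof (rule null_homotopy_exists[where \<phi> = "?f", OF A A f f0 fd])
    fix h assume h: "\<And>i. h i \<in> mhom R (A.F i) (A.F (Suc i))"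
      "\<And>x. x \<in> carrier (A.F 0) \<Longrightarrow> d 0 (h 0 x) = ?f 0 x"
      "\<And>i x. x \<in> carrier (A.F (Suc i)) \<Longrightarrow> d (Suc i) (h (Suc i) x) = ?f (Suc i) x \<ominus>\<^bsub>A.F (Suc i)\<^esub> h i (d i x)"
    have "?f (Suc i) x = d (Suc i) (h (Suc i) x) \<oplus>\<^bsub>A.F (Suc i)\<^esub> h i (d i x)" if x: "x \<in> carrier (A.F (Suc i))" for i x
      unfolding h(3)[OF x] using x mhom_closed[OF h(1)] by (simp add: A.F.M.minus_eq A.F.M.a_assoc A.F.M.l_neg)
    then show ?thesis using h(1,2) by (intro exI[of _ h]) simp
  qed
qed

lemma (in abelian_group) add_diff_self:
  "x \<in> carrier G \<Longrightarrow> y \<in> carrier G \<Longrightarrow> x \<oplus> (y \<ominus> x) = y"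
  by (simp add: minus_eq a_comm[of y "\<ominus> x"] r_neg2)

section \<open>Tor read off a minimal resolution\<close>

context local_ring
begin

text \<open>Minimality is the condition that each differential has image in mF, that is, that it
  vanishes after tensoring with k.\<close>

definition minimal_resolution ::
    "('a, 'l, 'm) module_scheme \<Rightarrow> (nat \<Rightarrow> 's set) \<Rightarrow> (('s \<Rightarrow> 'a) \<Rightarrow> 'l) \<Rightarrow> (nat \<Rightarrow> ('s \<Rightarrow> 'a) \<Rightarrow> ('s \<Rightarrow> 'a)) \<Rightarrow> bool"
  where "minimal_resolution L S \<epsilon> d \<longleftrightarrow> free_res R L S \<epsilon> d \<and> (\<forall>i. finite (S i)) \<and>
    (\<forall>i. \<forall>x\<in>carrier (\<F> (S (Suc i))). \<forall>s\<in>S i. d i x s \<in> \<mm>)"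

text \<open>Let A be the minimal resolution, B the given one, \<phi> : B \<rightarrow> A and \<psi>
  : A \<rightarrow> B comparison maps. Sending g to the class of \<psi> g \<otimes> 1 presents the
  homology of B \<otimes> k in degree i as A_i / m A_i: since the differential of A is zero modulo
  m, every element of A_i reduces to a cycle and only zero reduces to a boundary.\<close>

lemma dim_tensor_homology:
  assumes min: "minimal_resolution L S \<epsilon> d" and res: "free_resolution R L b \<epsilon>' d'"
  shows "vectorspace.dim (residue_field R) (residue_space R (tensor_homology R \<kk> b d' i)) = card (S i)"
proof -
  have A: "free_res R L S \<epsilon> d" using min by (simp add: minimal_resolution_def)
  interpret A: free_res R L S \<epsilon> d by (rule A)
  have B: "free_res R L (\<lambda>i. {..<b i}) \<epsilon>' d'"
    using res by (simp add: free_res_def free_res_axioms_def A.L.module_axioms free_resolution_eq_resolution)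
  interpret B: free_res R L "\<lambda>i. {..<b i}" \<epsilon>' d' by (rule B)
  have dm: "d j x s \<in> \<mm>" if "x \<in> carrier (A.F (Suc j))" "s \<in> S j" for j x s
    using min that by (simp add: minimal_resolution_def)
  have fin: "finite (S j)" for j using min by (simp add: minimal_resolution_def)
  obtain \<phi> where \<phi>0: "chain_map R (\<lambda>i. {..<b i}) \<epsilon>' d' S \<epsilon> d \<phi>" using chain_map_exists[OF B A] ..
  obtain \<psi> where \<psi>0: "chain_map R S \<epsilon> d (\<lambda>i. {..<b i}) \<epsilon>' d' \<psi>" using chain_map_exists[OF A B] ..
  note \<phi> = chain_mapD[OF \<phi>0] and \<psi> = chain_mapD[OF \<psi>0]
  obtain h where h: "\<forall>j. h j \<in> mhom R (A.F j) (A.F (Suc j))"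
    "\<forall>x\<in>carrier (A.F 0). \<phi> 0 (\<psi> 0 x) \<ominus>\<^bsub>A.F 0\<^esub> x = d 0 (h 0 x)"
    "\<forall>j. \<forall>x\<in>carrier (A.F (Suc j)). \<phi> (Suc j) (\<psi> (Suc j) x) \<ominus>\<^bsub>A.F (Suc j)\<^esub> x =
      d (Suc j) (h (Suc j) x) \<oplus>\<^bsub>A.F (Suc j)\<^esub> h j (d j x)"
    using homotopy_exists[OF A B \<psi>0 \<phi>0] by (elim exE conjE)
  obtain k where k: "\<forall>j. k j \<in> mhom R (B.F j) (B.F (Suc j))"
    "\<forall>x\<in>carrier (B.F 0). \<psi> 0 (\<phi> 0 x) \<ominus>\<^bsub>B.F 0\<^esub> x = d' 0 (k 0 x)"
    "\<forall>j. \<forall>x\<in>carrier (B.F (Suc j)). \<psi> (Suc j) (\<phi> (Suc j) x) \<ominus>\<^bsub>B.F (Suc j)\<^esub> x =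
      d' (Suc j) (k (Suc j) x) \<oplus>\<^bsub>B.F (Suc j)\<^esub> k j (d' j x)"
    using homotopy_exists[OF B A \<phi>0 \<psi>0] by (elim exE conjE)
  note h = h[rule_format] and k = k[rule_format]
  interpret \<phi>: mod_hom R "B.F j" "A.F j" "\<phi> j" for j by (rule mod_homI[OF B.F.module_axioms A.F.module_axioms \<phi>(1)])
  interpret \<psi>: mod_hom R "A.F j" "B.F j" "\<psi> j" for j by (rule mod_homI[OF A.F.module_axioms B.F.module_axioms \<psi>(1)])
  interpret h: mod_hom R "A.F j" "A.F (Suc j)" "h j" for j by (rule mod_homI[OF A.F.module_axioms A.F.module_axioms h(1)])
  interpret k: mod_hom R "B.F j" "B.F (Suc j)" "k j" for j by (rule mod_homI[OF B.F.module_axioms B.F.module_axioms k(1)])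

  let ?C = "\<lambda>j. reduced {..<b j}" and ?\<kappa> = "\<lambda>j. residue_tensor {..<b j}"
  let ?\<delta> = "\<lambda>j. tensor_map R (B.F (Suc j)) (B.F j) \<kk> (d' j)"
  interpret C: Module.module R "?C j" for j by (rule reduced_is_module)
  interpret \<kappa>: mod_hom R "B.F j" "?C j" "?\<kappa> j" for j
    by (rule mod_homI[OF B.F.module_axioms reduced_is_module residue_tensor_hom])
  interpret \<delta>: mod_hom R "?C (Suc j)" "?C j" "?\<delta> j" for j
    by (rule mod_homI[OF reduced_is_module reduced_is_module tensor_map_hom[OF B.d_hom]])
  have \<delta>\<kappa>: "?\<delta> j (?\<kappa> (Suc j) x) = ?\<kappa> j (d' j x)" if "x \<in> carrier (B.F (Suc j))" for j x
    by (rule tensor_map_residue_tensor[OF B.d_hom that])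
  define Z where "Z = (case i of 0 \<Rightarrow> carrier (?C 0) | Suc j \<Rightarrow> {x \<in> carrier (?C (Suc j)). ?\<delta> j x = \<zero>\<^bsub>?C j\<^esub>})"
  define B where "B = ?\<delta> i ` carrier (?C (Suc i))"
  define V where "V = quotient_module ((?C i)\<lparr>carrier := Z\<rparr>) B"
  have V_eq: "tensor_homology R \<kk> b d' i = V"
    unfolding tensor_homology_def V_def Z_def B_def Let_def by (cases i) simp_all
  have subZ: "submodule R Z (?C i)"
  proof (cases i)
    case 0
    then show ?thesis using C.carrier_is_submodule unfolding Z_def by unfold_locales auto
  next
    case (Suc j)
    then show ?thesis using \<delta>.ker_is_submodule[of j] unfolding Z_def \<delta>.ker_def by simp
  qed
  interpret Z: submodule R Z "?C i" by (rule subZ)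
  have ZC: "Z \<subseteq> carrier (?C i)" by (rule Z.subset)
  interpret ZM: Module.module R "(?C i)\<lparr>carrier := Z\<rparr>" by (rule C.submodule_is_module[OF subZ])
  \<comment> \<open>Cycles are recognised on representatives: the differential must have all
    coordinates in the maximal ideal. In degree 0 the condition is empty.\<close>
  have in_Z: "?\<kappa> i x \<in> Z \<longleftrightarrow> (\<forall>j. i = Suc j \<longrightarrow> (\<forall>s<b j. d' j x s \<in> \<mm>))"
    if x: "x \<in> carrier (B.F i)" for x
  proof (cases i)
    case (Suc j)
    then show ?thesis using x residue_tensor_eq_zero_iff[of "d' j x" "{..<b j}"]
      unfolding Z_def by (auto simp: \<delta>\<kappa>)
  qed (use x in \<open>simp add: Z_def\<close>)
  have B_iff: "t \<in> B \<longleftrightarrow> (\<exists>y\<in>carrier (B.F (Suc i)). t = ?\<kappa> i (d' i y))" for t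
  proof
    assume "t \<in> B"
    then obtain u where "u \<in> carrier (?C (Suc i))" "t = ?\<delta> i u" unfolding B_def by blast
    then show "\<exists>y\<in>carrier (B.F (Suc i)). t = ?\<kappa> i (d' i y)" using \<delta>\<kappa> by (metis residue_tensor_surj)
  next
    assume "\<exists>y\<in>carrier (B.F (Suc i)). t = ?\<kappa> i (d' i y)"
    then obtain y where "y \<in> carrier (B.F (Suc i))" "t = ?\<kappa> i (d' i y)" by blast
    then show "t \<in> B" unfolding B_def using \<delta>\<kappa> \<kappa>.f_im by (metis image_eqI)
  qed
  have BZ: "B \<subseteq> Z"
  proof
    fix t assume "t \<in> B"
    then obtain y where y: "y \<in> carrier (B.F (Suc i))" "t = ?\<kappa> i (d' i y)" unfolding B_iff by blast
    then show "t \<in> Z" by (auto simp: in_Z B.d_d)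
  qed
  have subB: "submodule R B ((?C i)\<lparr>carrier := Z\<rparr>)"
    using BZ \<delta>.im_is_submodule[of i] ZM.module_axioms unfolding \<delta>.im_def B_def[symmetric] submodule_def by auto
  interpret q: mod_hom R "(?C i)\<lparr>carrier := Z\<rparr>" V "\<lambda>t. B +>\<^bsub>(?C i)\<lparr>carrier := Z\<rparr>\<^esub> t"
    unfolding V_def by (rule mod_homI[OF ZM.module_axioms ZM.quotient_is_module[OF subB] ZM.quotient_hom[OF subB]])
  define \<theta> where "\<theta> g = B +>\<^bsub>(?C i)\<lparr>carrier := Z\<rparr>\<^esub> ?\<kappa> i (\<psi> i g)" for g
  have \<psi>Z: "?\<kappa> i (\<psi> i g) \<in> Z" if g: "g \<in> carrier (A.F i)" for g
  proof -
    have "d' j (\<psi> i g) s \<in> \<mm>" if "i = Suc j" "s < b j" for j s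
      using hom_max_ideal[OF \<psi>(1)[of j], of "d j g" s] dm[of g j] g that \<psi>(3)[of g j] by simp
    then show ?thesis using g by (simp add: in_Z)
  qed
  have \<psi>hom: "(\<lambda>g. ?\<kappa> i (\<psi> i g)) \<in> mhom R (A.F i) ((?C i)\<lparr>carrier := Z\<rparr>)"
    using \<psi>Z by (simp add: mhom_def)
  have \<theta>: "\<theta> \<in> mhom R (A.F i) V"
    using mhom_comp[OF \<psi>hom q.f_hom] unfolding \<theta>_def .
  have zeroB: "\<zero>\<^bsub>V\<^esub> = B" unfolding V_def by (rule ZM.quotient_zero[OF subB])
  \<comment> \<open>This gives surjectivity of \<open>\<theta>\<close>. For a cycle,
    \<open>d' j x\<close> has coordinates in m, so the homotopy term \<open>k j (d' j x)\<close>
    disappears in B \<otimes> k, and \<psi> \<phi> x differs from x by a boundary. In degree 0 that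
    term is absent and zero takes its place.\<close>
  have claim1: "\<exists>y\<in>carrier (B.F (Suc i)). ?\<kappa> i (\<psi> i (\<phi> i x)) = ?\<kappa> i x \<oplus>\<^bsub>?C i\<^esub> ?\<kappa> i (d' i y)"
    if x: "x \<in> carrier (B.F i)" and xZ: "?\<kappa> i x \<in> Z" for x
  proof -
    have "\<exists>w\<in>carrier (B.F i). \<psi> i (\<phi> i x) \<ominus>\<^bsub>B.F i\<^esub> x = d' i (k i x) \<oplus>\<^bsub>B.F i\<^esub> w \<and> (\<forall>s<b i. w s \<in> \<mm>)"
    proof (cases i)
      case 0
      then show ?thesis using k(2) x by (intro bexI[of _ "\<zero>\<^bsub>B.F i\<^esub>"]) auto
    next
      case (Suc j)
      have "\<forall>s<b j. d' j x s \<in> \<mm>" using in_Z[OF x] xZ Suc by blast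
      then have "k j (d' j x) s \<in> \<mm>" if "s < b i" for s
        using hom_max_ideal[OF k(1)[of j], of "d' j x" s] x Suc that by simp
      then show ?thesis using k(3) x Suc by (intro bexI[of _ "k j (d' j x)"]) auto
    qed
    then obtain w where w: "w \<in> carrier (B.F i)" "\<psi> i (\<phi> i x) \<ominus>\<^bsub>B.F i\<^esub> x = d' i (k i x) \<oplus>\<^bsub>B.F i\<^esub> w"
      "\<And>s. s < b i \<Longrightarrow> w s \<in> \<mm>" by blast
    have "\<psi> i (\<phi> i x) = x \<oplus>\<^bsub>B.F i\<^esub> (\<psi> i (\<phi> i x) \<ominus>\<^bsub>B.F i\<^esub> x)"
      using x by (simp add: B.F.M.add_diff_self)
    then have "?\<kappa> i (\<psi> i (\<phi> i x)) = ?\<kappa> i (x \<oplus>\<^bsub>B.F i\<^esub> (d' i (k i x) \<oplus>\<^bsub>B.F i\<^esub> w))"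
      using w(2) by simp
    also have "\<dots> = ?\<kappa> i x \<oplus>\<^bsub>?C i\<^esub> ?\<kappa> i (d' i (k i x))"
      using x w(1) residue_tensor_max_ideal[OF w(1)] w(3) by simp
    finally show ?thesis using x by (intro bexI[of _ "k i x"]) auto
  qed
  \<comment> \<open>On the minimal side both homotopy terms contain a differential of A and lie in
    m, so \<phi> \<psi> is the identity modulo m.\<close>
  have claim2: "\<forall>s\<in>S i. \<phi> i (\<psi> i g) s \<ominus> g s \<in> \<mm>" if g: "g \<in> carrier (A.F i)" for g
  proof
    fix s assume s: "s \<in> S i"
    have "(\<phi> i (\<psi> i g) \<ominus>\<^bsub>A.F i\<^esub> g) s \<in> \<mm>"
    proof (cases i)
      case 0
      then show ?thesis using h(2)[of g] g s dm by simp
    next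
      case (Suc j)
      have "h j (d j g) s \<in> \<mm>"
        using hom_max_ideal[OF h(1)[of j], of "d j g" s] dm g s Suc by simp
      then show ?thesis using h(3)[of g j] g s dm Suc by (simp add: mm.a_closed)
    qed
    then show "\<phi> i (\<psi> i g) s \<ominus> g s \<in> \<mm>" using g s by simp
  qed
  have surj: "\<theta> ` carrier (A.F i) = carrier V"
  proof
    show "\<theta> ` carrier (A.F i) \<subseteq> carrier V" using mhom_closed[OF \<theta>] by blast
    show "carrier V \<subseteq> \<theta> ` carrier (A.F i)"
    proof
      fix v assume "v \<in> carrier V"
      then obtain t where t: "t \<in> Z" "v = B +>\<^bsub>(?C i)\<lparr>carrier := Z\<rparr>\<^esub> t"
        using ZM.quotient_carrier[OF subB] unfolding V_def by auto
      obtain x where x: "x \<in> carrier (B.F i)" "t = ?\<kappa> i x" using residue_tensor_surj[OF subsetD[OF ZC t(1)]] .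
      obtain y where y: "y \<in> carrier (B.F (Suc i))" "?\<kappa> i (\<psi> i (\<phi> i x)) = t \<oplus>\<^bsub>?C i\<^esub> ?\<kappa> i (d' i y)"
        using claim1[OF x(1)] t(1) x(2) by blast
      have yB: "?\<kappa> i (d' i y) \<in> B" using y(1) unfolding B_iff by blast
      have "\<theta> (\<phi> i x) = B +>\<^bsub>(?C i)\<lparr>carrier := Z\<rparr>\<^esub> (t \<oplus>\<^bsub>(?C i)\<lparr>carrier := Z\<rparr>\<^esub> ?\<kappa> i (d' i y))"
        unfolding \<theta>_def y(2) by simp
      also have "\<dots> = v \<oplus>\<^bsub>V\<^esub> B"
      proof -
        have yZ: "?\<kappa> i (d' i y) \<in> Z" using yB BZ by blast
        then have "B +>\<^bsub>(?C i)\<lparr>carrier := Z\<rparr>\<^esub> ?\<kappa> i (d' i y) = B"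
          using ZM.quotient_eq_zero_iff[OF subB, of "?\<kappa> i (d' i y)"] yB by simp
        then show ?thesis using q.f_add[of t "?\<kappa> i (d' i y)"] t yZ by simp
      qed
      also have "\<dots> = v" using \<open>v \<in> carrier V\<close> q.N.M.r_zero zeroB by simp
      finally show "v \<in> \<theta> ` carrier (A.F i)" using x by (intro image_eqI[of _ _ "\<phi> i x"]) auto
    qed
  qed
  have ker: "\<theta> g = \<zero>\<^bsub>V\<^esub> \<longleftrightarrow> (\<forall>s\<in>S i. g s \<in> \<mm>)" if g: "g \<in> carrier (A.F i)" for g
  proof -
    have "\<theta> g = \<zero>\<^bsub>V\<^esub> \<longleftrightarrow> ?\<kappa> i (\<psi> i g) \<in> B"
      unfolding zeroB \<theta>_def using ZM.quotient_eq_zero_iff[OF subB, of "?\<kappa> i (\<psi> i g)"] \<psi>Z[OF g] by simp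
    also have "\<dots> \<longleftrightarrow> (\<forall>s\<in>S i. g s \<in> \<mm>)"
    proof
      \<comment> \<open>If \<psi> g is a boundary d' y modulo m, then \<phi> \<psi> g is congruent
        to \<phi> d' y = d \<phi> y, which lies in m by minimality; and \<phi> \<psi> g is congruent
        to g.\<close>
      assume "?\<kappa> i (\<psi> i g) \<in> B"
      then obtain y where y: "y \<in> carrier (B.F (Suc i))" "?\<kappa> i (\<psi> i g) = ?\<kappa> i (d' i y)" unfolding B_iff by blast
      then have "\<forall>s<b i. (\<psi> i g \<ominus>\<^bsub>B.F i\<^esub> d' i y) s \<in> \<mm>"
        using residue_tensor_eq_iff[of "\<psi> i g" "{..<b i}" "d' i y"] g by simp
      then have m1: "\<phi> i (\<psi> i g \<ominus>\<^bsub>B.F i\<^esub> d' i y) s \<in> \<mm>" if "s \<in> S i" for s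
        using hom_max_ideal[OF \<phi>(1)[of i], of "\<psi> i g \<ominus>\<^bsub>B.F i\<^esub> d' i y" s] g y(1) that by simp
      show "\<forall>s\<in>S i. g s \<in> \<mm>"
      proof
        fix s assume s: "s \<in> S i"
        have c: "\<phi> i (\<psi> i g) s \<in> carrier R" "\<phi> i (d' i y) s \<in> carrier R" "g s \<in> carrier R"
          using s g y(1) free_coord[of "\<phi> i (\<psi> i g)" "S i" s] free_coord[of "\<phi> i (d' i y)" "S i" s] by auto
        have 1: "\<phi> i (\<psi> i g) s \<ominus> \<phi> i (d' i y) s \<in> \<mm>" using m1[OF s] g y(1) s by simp
        have 2: "\<phi> i (d' i y) s \<in> \<mm>"
          using \<phi>(3)[OF y(1)] dm[of "\<phi> (Suc i) y" i s] s y(1) by simp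
        have 3: "\<phi> i (\<psi> i g) s \<ominus> g s \<in> \<mm>" using claim2[OF g] s by blast
        have "g s = (\<phi> i (\<psi> i g) s \<ominus> \<phi> i (d' i y) s) \<oplus> \<phi> i (d' i y) s \<oplus> \<ominus> (\<phi> i (\<psi> i g) s \<ominus> g s)"
          using c by (simp add: minus_eq minus_add a_ac r_neg r_neg1 r_neg2)
        also have "\<dots> \<in> \<mm>" using 1 2 3 by (intro mm.a_closed mm.a_inv_closed)
        finally show "g s \<in> \<mm>" .
      qed
    next
      assume "\<forall>s\<in>S i. g s \<in> \<mm>"
      then have "\<forall>s<b i. \<psi> i g s \<in> \<mm>" using hom_max_ideal[OF \<psi>(1)[of i] g] by simp
      then have "?\<kappa> i (\<psi> i g) = \<zero>\<^bsub>?C i\<^esub>" using g by (intro residue_tensor_max_ideal) auto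
      then show "?\<kappa> i (\<psi> i g) \<in> B" using subB unfolding submodule_def by simp
    qed
    finally show ?thesis .
  qed
  show ?thesis unfolding V_eq
    by (rule dim_residue_space[OF q.N.module_axioms \<theta> fin surj ker])
qed

text \<open>The given \<open>free_resolution\<close> ensures that the \<open>SOME\<close> in
  \<open>Tor\<close> returns a resolution; whichever it returns, \<open>dim_tensor_homology\<close>
  yields the same dimension.\<close>

lemma betti_eqI:
  assumes "minimal_resolution L S \<epsilon> d" "free_resolution R L b \<epsilon>' d'"
  shows "betti R L i = card (S i)"
proof -
  let ?t = "SOME (b, \<epsilon>, d). free_resolution R L b \<epsilon> d"
  obtain b0 \<epsilon>0 d0 where t: "?t = (b0, \<epsilon>0, d0)" by (cases ?t)
  have "case ?t of (b, \<epsilon>, d) \<Rightarrow> free_resolution R L b \<epsilon> d"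
    by (rule someI[of _ "(b, \<epsilon>', d')"]) (use assms(2) in simp)
  then have "free_resolution R L b0 \<epsilon>0 d0" unfolding t by simp
  from dim_tensor_homology[OF assms(1) this] show ?thesis
    unfolding betti_def Tor_def t by simp
qed

end

section \<open>Minimal resolutions over Noetherian local rings\<close>

text \<open>A non-unit \<open>a\<close> lies in an ideal maximal among those that contain
  \<open>a\<close> but not \<open>\<one>\<close>. Zorn's lemma applies because a nonempty chain of
  ideals in a Noetherian ring contains its union. Such an ideal is a maximal ideal, hence the unique
  one.\<close>

lemma noetherian_local_imp_local:
  fixes R (structure)
  assumes "noetherian_local_ring R" shows "local_ring R"
proof -
  interpret noetherian_local_ring R by fact
  have ex: "\<exists>!I. maximalideal I R" by (rule unique_maximalideal)
  then have m: "maximalideal (max_ideal R) R" unfolding max_ideal_def by (rule theI')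
  interpret m: maximalideal "max_ideal R" R by (rule m)
  have "a \<in> Units R" if a: "a \<in> carrier R" "a \<notin> max_ideal R" for a
  proof (rule ccontr)
    assume nu: "a \<notin> Units R"
    let ?A = "{J. ideal J R \<and> a \<in> J \<and> \<one> \<notin> J}"
    have "PIdl a \<in> ?A"
    proof -
      have "\<one> \<notin> PIdl a"
      proof
        assume "\<one> \<in> PIdl a"
        then obtain b where "b \<in> carrier R" "\<one> = b \<otimes> a" by (auto simp: cgenideal_def)
        then have "a \<in> Units R" using a unfolding Units_def by (auto simp: m_comm intro!: bexI[of _ b])
        with nu show False by simp
      qed
      then show ?thesis using a cgenideal_ideal cgenideal_self by simp
    qed
    then have ne: "?A \<noteq> {}" by blast
    have chain: "\<Union> C \<in> ?A" if "C \<noteq> {}" "subset.chain ?A C" for C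
    proof -
      have "subset.chain {I. ideal I R} C" "C \<subseteq> ?A" using that(2) unfolding subset.chain_def by auto
      then have "\<Union> C \<in> C" using ideal_chain_is_trivial that(1) by blast
      then show ?thesis using \<open>C \<subseteq> ?A\<close> by blast
    qed
    have "\<exists>J\<in>?A. \<forall>X\<in>?A. J \<subseteq> X \<longrightarrow> X = J"
      by (rule subset_Zorn_nonempty[OF ne]) (rule chain)
    then obtain J where J: "J \<in> ?A" "\<And>X. X \<in> ?A \<Longrightarrow> J \<subseteq> X \<Longrightarrow> X = J" by blast
    have "maximalideal J R"
    proof (rule maximalidealI)
      show "ideal J R" "carrier R \<noteq> J" using J(1) by auto
      fix X assume X: "ideal X R" "J \<subseteq> X"
      interpret X: ideal X R by (rule X)
      show "X = J \<or> X = carrier R" using X J X.one_imp_carrier by blast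
    qed
    with ex m have "J = max_ideal R" by blast
    with J(1) a show False by blast
  qed
  moreover have "\<one> \<notin> max_ideal R" using m.one_imp_carrier m.I_notcarr by blast
  ultimately show ?thesis
    unfolding local_ring_def local_ring_axioms_def using m.is_ideal is_cring by blast
qed

section \<open>Finite generation of submodules of free modules\<close>

context Module.module
begin

lemma submodule_finsum_closed:
  assumes S: "submodule R S M" and f: "\<And>i. i \<in> I \<Longrightarrow> f i \<in> S"
  shows "(\<Oplus>\<^bsub>M\<^esub>i\<in>I. f i) \<in> S"
  using f
proof (induct I rule: infinite_finite_induct)
  case (insert i I)
  interpret S: submodule R S M by (rule S)
  have "f \<in> insert i I \<rightarrow> carrier M" using insert.prems S.subset by blast
  then show ?case using insert by (subst M.finsum_insert) auto
qed (use S in \<open>simp_all add: submodule_def\<close>)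

lemma free_lift_image:
  assumes S: "finite S" and c: "c \<in> S \<rightarrow> carrier M"
  shows "free_lift R M S c ` carrier (\<F> S) = span (c ` S)"
proof -
  interpret f: mod_hom R "\<F> S" M "free_lift R M S c"
    by (rule mod_homI[OF free_is_module module_axioms free_lift_hom[OF c]])
  have sub: "c ` S \<subseteq> carrier M" using c by auto
  interpret Sp: submodule R "span (c ` S)" M by (rule span_is_submodule[OF sub])
  have cs: "c s \<in> span (c ` S)" if "s \<in> S" for s using in_own_span[OF sub] that by blast
  show ?thesis
  proof
    show "free_lift R M S c ` carrier (\<F> S) \<subseteq> span (c ` S)"
    proof clarify
      fix x assume x: "x \<in> carrier (\<F> S)"
      show "free_lift R M S c x \<in> span (c ` S)"
        unfolding free_lift_finite[OF S c x] using x cs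
        by (intro submodule_finsum_closed[OF Sp.submodule_axioms] Sp.smult_closed) auto
    qed
    have "c ` S \<subseteq> f.im"
    proof clarify
      fix s assume "s \<in> S"
      then show "c s \<in> f.im" unfolding f.im_def
        using free_lift_basis[OF c] free_basis_closed by (metis image_eqI)
    qed
    then have "span (c ` S) \<subseteq> f.im" by (rule span_is_subset[OF _ f.im_is_submodule])
    then show "span (c ` S) \<subseteq> free_lift R M S c ` carrier (\<F> S)" unfolding f.im_def .
  qed
qed

end

lemma (in cring) coord_hom:
  assumes "s \<in> S" shows "(\<lambda>x. x s) \<in> mhom R (free_module R S) (self_module R)"
  using assms by (simp add: mhom_def)

text \<open>Generating sets of the maximal ideal, as counted by \<open>edim\<close>, thereby become
  spanning sets in a module, to which minimal covers apply.\<close>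

lemma (in cring) span_self_module:
  assumes S: "S \<subseteq> carrier R"
  shows "LinearCombinations.module.span R (self_module R) S = Idl S"
proof -
  interpret M: Module.module R "self_module R" by (rule self_is_module)
  have S': "S \<subseteq> carrier (self_module R)" using S by simp
  interpret Sp: submodule R "M.span S" "self_module R" by (rule M.span_is_submodule[OF S'])
  interpret I: ideal "Idl S" R by (rule genideal_ideal[OF S])
  have "submodule R (Idl S) (self_module R)"
    by unfold_locales (use I.a_subset in \<open>auto intro: I.I_l_closed\<close>)
  then have "M.span S \<subseteq> Idl S" using genideal_self[OF S] by (rule M.span_is_subset[rotated])
  moreover have "ideal (M.span S) R"
    using Sp.subset Sp.m_closed Sp.smult_closed Sp.zero_closed by (intro ideal_criterion) simp_all
  then have "Idl S \<subseteq> M.span S" using M.in_own_span[OF S'] by (rule genideal_minimal)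
  ultimately show ?thesis by blast
qed

text \<open>Induction on the set \<open>U\<close> of coordinates in which the elements of \<open>K\<close> may be nonzero.\<close>

lemma free_submodule_finitely_generated:
  fixes R (structure)
  assumes "cring R" and noeth: "noetherian_ring R" and T: "finite T" and K: "submodule R K (free_module R T)"
  shows "\<exists>G. finite G \<and> G \<subseteq> K \<and> LinearCombinations.module.span R (free_module R T) G = K"
proof -
  interpret cring R by fact
  interpret noetherian_ring R by fact
  let ?F = "free_module R T"
  interpret F: Module.module R ?F by (rule free_is_module)
  have "\<exists>G. finite G \<and> G \<subseteq> K \<and> F.span G = K"
    if "finite U" "U \<subseteq> T" "submodule R K ?F" "\<And>x t. x \<in> K \<Longrightarrow> t \<in> T - U \<Longrightarrow> x t = \<zero>\<^bsub>R\<^esub>" for U K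
    using that
  proof (induct U arbitrary: K rule: finite_induct)
    case empty
    interpret K: submodule R K ?F by (rule empty)
    have "K = {\<zero>\<^bsub>?F\<^esub>}"
    proof
      show "K \<subseteq> {\<zero>\<^bsub>?F\<^esub>}"
      proof
        fix x assume x: "x \<in> K"
        then have "x = \<zero>\<^bsub>?F\<^esub>" using K.subset empty(3) by (intro free_eqI[of x T]) auto
        then show "x \<in> {\<zero>\<^bsub>?F\<^esub>}" by simp
      qed
    qed simp
    moreover have "F.span {} = {\<zero>\<^bsub>?F\<^esub>}" unfolding F.span_def F.lincomb_def by auto
    ultimately show ?case by (intro exI[of _ "{}"]) simp
  next
    case (insert u U)
    interpret K: submodule R K ?F by (rule insert)
    have uT: "u \<in> T" using insert by blast
    have KF: "x \<in> carrier ?F" if "x \<in> K" for x using K.subset that by blast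
    \<comment> \<open>The \<open>u\<close>-coordinates of \<open>K\<close> form an ideal, which is
      finitely generated because the ring is Noetherian; \<open>g\<close> will lift its generators
      \<open>A\<close> back to \<open>K\<close>.\<close>
    let ?I = "(\<lambda>x. x u) ` K"
    have proj: "ideal ((\<lambda>x. x u) ` H) R" if H: "submodule R H ?F" for H
    proof (rule ideal_criterion)
      interpret H: submodule R H ?F by (rule H)
      show "(\<lambda>x. x u) ` H \<subseteq> carrier R" using free_coord[OF _ uT] H.subset by blast
      show "\<zero> \<in> (\<lambda>x. x u) ` H" using uT by (intro image_eqI[of _ _ "\<zero>\<^bsub>?F\<^esub>"]) simp_all
      fix a assume "a \<in> (\<lambda>x. x u) ` H"
      then obtain x where x: "x \<in> H" "a = x u" by blast
      show "r \<otimes> a \<in> (\<lambda>x. x u) ` H" if "r \<in> carrier R" for r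
        using x that uT by (intro image_eqI[of _ _ "r \<odot>\<^bsub>?F\<^esub> x"]) auto
      fix b assume "b \<in> (\<lambda>x. x u) ` H"
      then obtain y where y: "y \<in> H" "b = y u" by blast
      show "a \<oplus> b \<in> (\<lambda>x. x u) ` H"
        using x y uT by (intro image_eqI[of _ _ "x \<oplus>\<^bsub>?F\<^esub> y"]) auto
    qed
    obtain A where fg: "A \<subseteq> carrier R \<and> finite A \<and> ?I = Idl A"
      using finetely_gen[OF proj[OF insert.prems(2)]] ..
    note A = fg[THEN conjunct1] fg[THEN conjunct2, THEN conjunct1] fg[THEN conjunct2, THEN conjunct2]
    have AI: "A \<subseteq> ?I" unfolding A(3) by (rule genideal_self[OF A(1)])
    have "\<forall>a\<in>A. \<exists>x. x \<in> K \<and> x u = a"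
    proof
      fix a assume "a \<in> A"
      then have "a \<in> ?I" using AI ..
      then show "\<exists>x. x \<in> K \<and> x u = a" by auto
    qed
    then obtain g where g: "\<And>a. a \<in> A \<Longrightarrow> g a \<in> K" "\<And>a. a \<in> A \<Longrightarrow> g a u = a" by metis
    have gK: "g ` A \<subseteq> K" using g by blast
    then have gF: "g ` A \<subseteq> carrier ?F" using KF by blast
    \<comment> \<open>Elements of \<open>K\<close> that vanish at \<open>u\<close> are supported in
      \<open>U\<close>, so the induction hypothesis supplies generators for them.\<close>
    let ?K' = "{x \<in> K. x u = \<zero>\<^bsub>R\<^esub>}"
    have K': "submodule R ?K' ?F"
      by unfold_locales (use KF uT in auto)
    have "\<exists>G. finite G \<and> G \<subseteq> ?K' \<and> F.span G = ?K'"
    proof (rule insert.hyps(3)[OF _ K'])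
      show "U \<subseteq> T" using insert by blast
      fix x t assume "x \<in> ?K'" "t \<in> T - U"
      then show "x t = \<zero>\<^bsub>R\<^esub>" using insert.prems(3)[of x t] by (cases "t = u") auto
    qed
    then obtain G where G: "finite G" "G \<subseteq> ?K'" "F.span G = ?K'" by blast
    let ?G = "g ` A \<union> G"
    have GK: "?G \<subseteq> K" using gK G by blast
    then have GF: "?G \<subseteq> carrier ?F" using KF by blast
    interpret Sp: submodule R "F.span ?G" ?F by (rule F.span_is_submodule[OF GF])
    have "K \<subseteq> F.span ?G"
    proof
      fix x assume x: "x \<in> K"
      have "A \<subseteq> (\<lambda>x. x u) ` F.span (g ` A)"
      proof
        fix a assume a: "a \<in> A"
        then have "g a \<in> F.span (g ` A)" using F.in_own_span[OF gF] by blast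
        then show "a \<in> (\<lambda>x. x u) ` F.span (g ` A)" using g(2)[OF a] by (intro image_eqI[of _ _ "g a"]) simp_all
      qed
      then have "Idl A \<subseteq> (\<lambda>x. x u) ` F.span (g ` A)"
        by (rule genideal_minimal[OF proj[OF F.span_is_submodule[OF gF]]])
      \<comment> \<open>\<open>y\<close> agrees with \<open>x\<close> at \<open>u\<close>, so their
        difference lies in \<open>?K'\<close>, which \<open>G\<close> spans.\<close>
      then obtain y where y: "y \<in> F.span (g ` A)" "x u = y u" using A(3) x by blast
      have yK: "y \<in> K" using F.span_is_subset[OF gK insert.prems(2)] y by blast
      have "x \<ominus>\<^bsub>?F\<^esub> y \<in> ?K'"
        using F.submodule_minus_closed[OF insert.prems(2) x yK] KF[OF x] KF[OF yK] uT y(2) free_coord[OF KF[OF yK] uT]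
        by (simp add: minus_eq r_neg)
      then have "x \<ominus>\<^bsub>?F\<^esub> y \<in> F.span ?G" using F.span_is_monotone[of G ?G] G(3) by blast
      moreover have "y \<in> F.span ?G" using F.span_is_monotone[of "g ` A" ?G] y by blast
      ultimately have "y \<oplus>\<^bsub>?F\<^esub> (x \<ominus>\<^bsub>?F\<^esub> y) \<in> F.span ?G" by blast
      then show "x \<in> F.span ?G" using F.M.add_diff_self[of y x] KF x yK by simp
    qed
    moreover have "F.span ?G \<subseteq> K" by (rule F.span_is_subset[OF GK insert.prems(2)])
    ultimately show ?case using GK G(1) A(2) by (intro exI[of _ ?G]) blast
  qed
  from this[OF T subset_refl K] show ?thesis by blast
qed

section \<open>Minimal covers and minimal resolutions\<close>

context local_ring
begin

text \<open>A free cover with kernel in mF. The target \<open>M\<close> and the image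
  \<open>K\<close> are kept apart, so that kernels inside free modules and the maximal ideal inside
  \<open>self_module R\<close> can be covered as they stand.\<close>

definition minimal_cover :: "('a, 'x, 'y) module_scheme \<Rightarrow> 'x set \<Rightarrow> nat \<Rightarrow> ((nat \<Rightarrow> 'a) \<Rightarrow> 'x) \<Rightarrow> bool"
  where "minimal_cover M K n \<delta> \<longleftrightarrow> \<delta> \<in> mhom R (\<F> {..<n}) M \<and>
    \<delta> ` carrier (\<F> {..<n}) = K \<and>
    (\<forall>x\<in>carrier (\<F> {..<n}). \<delta> x = \<zero>\<^bsub>M\<^esub> \<longrightarrow> (\<forall>s<n. x s \<in> \<mm>))"

text \<open>A generating set of least size has no relation with a unit coefficient, since such a
  relation would express one generator through the others. In a local ring this puts all
  coefficients of all relations in m.\<close>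

lemma minimal_cover_exists:
  assumes M: "Module.module R M" and G: "finite G" "G \<subseteq> carrier M" "LinearCombinations.module.span R M G = K"
    and least: "\<And>G'. finite G' \<Longrightarrow> G' \<subseteq> carrier M \<Longrightarrow> LinearCombinations.module.span R M G' = K \<Longrightarrow> card G \<le> card G'"
  shows "\<exists>\<delta>. minimal_cover M K (card G) \<delta>"
proof -
  interpret M: Module.module R M by (rule M)
  let ?n = "card G" and ?F = "\<F> {..<card G}"
  interpret F: Module.module R ?F by (rule free_is_module)
  obtain c where c: "bij_betw c {..<?n} G" using ex_bij_betw_nat_finite[OF G(1)] by (auto simp: atLeast0LessThan)
  have img: "c ` {..<?n} = G" and inj: "inj_on c {..<?n}" using c by (auto simp: bij_betw_def)
  have cM: "c \<in> {..<?n} \<rightarrow> carrier M" using img G by blast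
  let ?\<delta> = "free_lift R M {..<?n} c"
  note \<delta> = M.free_lift_hom[OF cM]
  interpret \<delta>: mod_hom R ?F M ?\<delta> by (rule mod_homI[OF free_is_module M \<delta>])
  have "x s \<in> \<mm>" if x: "x \<in> carrier ?F" "?\<delta> x = \<zero>\<^bsub>M\<^esub>" and s: "s < ?n" for x s
  proof (rule ccontr)
    assume "x s \<notin> \<mm>"
    then have u: "x s \<in> Units R" using Units_if_notin x s by simp
    let ?G = "G - {c s}"
    have GM: "?G \<subseteq> carrier M" using G by blast
    interpret Sp: submodule R "M.span ?G" M by (rule M.span_is_submodule[OF GM])
    \<comment> \<open>The relation is normalised to coefficient \<open>\<one>\<close> at
      \<open>s\<close>, and that basis vector is subtracted: \<open>?z\<close> avoids the generator
      \<open>c s\<close> and yet maps to its negative.\<close>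
    let ?y = "inv (x s) \<odot>\<^bsub>?F\<^esub> x"
    let ?z = "?y \<ominus>\<^bsub>?F\<^esub> free_basis R {..<?n} s"
    have y: "?y \<in> carrier ?F" "?\<delta> ?y = \<zero>\<^bsub>M\<^esub>" using x u by simp_all
    have b: "free_basis R {..<?n} s \<in> carrier ?F" using s by simp
    have z: "?z \<in> carrier ?F" using y b by blast
    have zs: "?z s = \<zero>" using u y(1) b s x(1) by (simp add: minus_eq r_neg)
    have "?\<delta> ?z \<in> M.span ?G"
      unfolding M.free_lift_finite[OF finite_lessThan cM z]
    proof (rule M.submodule_finsum_closed[OF Sp.submodule_axioms])
      fix t assume t: "t \<in> {..<?n}"
      show "?z t \<odot>\<^bsub>M\<^esub> c t \<in> M.span ?G"
      proof (cases "t = s")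
        case True
        then show ?thesis using zs cM t by (auto simp: Pi_iff)
      next
        case False
        then have "c t \<in> ?G" using inj img s t by (auto dest: inj_onD)
        then have "c t \<in> M.span ?G" using M.in_own_span[OF GM] by blast
        moreover have "?z t \<in> carrier R" using free_coord[OF z t] .
        ultimately show ?thesis by (intro Sp.smult_closed)
      qed
    qed
    moreover have "?\<delta> ?z = \<ominus>\<^bsub>M\<^esub> c s"
      using y b s cM M.free_lift_basis[OF cM, of s] by (simp add: M.M.minus_eq Pi_iff)
    ultimately have "(\<ominus> \<one>) \<odot>\<^bsub>M\<^esub> (\<ominus>\<^bsub>M\<^esub> c s) \<in> M.span ?G" by (intro Sp.smult_closed) simp_all
    then have cs: "c s \<in> M.span ?G" using cM s by (simp add: M.smult_l_minus Pi_iff)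
    have "G \<subseteq> M.span ?G" using cs M.in_own_span[OF GM] by blast
    then have "M.span G \<subseteq> M.span ?G" by (rule M.span_is_subset[OF _ Sp.submodule_axioms])
    then have "M.span ?G = K" using M.span_is_monotone[of ?G G] G(3) by blast
    then have "card G \<le> card ?G" using G GM by (intro least) auto
    moreover have "c s \<in> G" using img s by blast
    ultimately show False using card_Diff1_less[OF G(1)] by (meson leD)
  qed
  moreover have "?\<delta> ` carrier ?F = K" using M.free_lift_image[OF finite_lessThan cM] img G(3) by simp
  ultimately show ?thesis unfolding minimal_cover_def using \<delta> by blast
qed

lemma minimal_cover_exists':
  assumes M: "Module.module R M" and G: "finite G" "G \<subseteq> carrier M" "LinearCombinations.module.span R M G = K"
  shows "\<exists>n \<delta>. minimal_cover M K n \<delta>"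
proof -
  let ?P = "\<lambda>n. \<exists>G. finite G \<and> card G = n \<and> G \<subseteq> carrier M \<and> LinearCombinations.module.span R M G = K"
  have "?P (LEAST n. ?P n)" by (rule LeastI[of ?P "card G"]) (use G in blast)
  then obtain H where H: "finite H" "card H = (LEAST n. ?P n)" "H \<subseteq> carrier M" "LinearCombinations.module.span R M H = K"
    by blast
  have "\<exists>\<delta>. minimal_cover M K (card H) \<delta>"
    by (rule minimal_cover_exists[OF M H(1,3,4)]) (unfold H(2), rule Least_le, blast)
  then show ?thesis by blast
qed

lemma submodule_cover_exists:
  assumes noeth: "noetherian_ring R" and K: "submodule R K (\<F> {..<m :: nat})"
  shows "\<exists>n \<delta>. minimal_cover (\<F> {..<m}) K n \<delta>"
proof -
  obtain G where "finite G \<and> G \<subseteq> K \<and> LinearCombinations.module.span R (\<F> {..<m}) G = K"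
    using free_submodule_finitely_generated[OF is_cring noeth finite_lessThan K] ..
  then have G: "finite G" "G \<subseteq> K" "LinearCombinations.module.span R (\<F> {..<m}) G = K" by simp_all
  have "G \<subseteq> carrier (\<F> {..<m})" using G(2) K by (auto simp: submodule_def)
  from minimal_cover_exists'[OF free_is_module G(1) this G(3)] show ?thesis .
qed

text \<open>The first two covers are prescribed so that \<open>b 0\<close> and \<open>b 1\<close>
  are known; this is what computes the first two Betti numbers of the residue field. Each later
  kernel is covered minimally by dependent choice.\<close>

lemma minimal_resolution_extend:
  assumes noeth: "noetherian_ring R" and L: "Module.module R L"
    and \<epsilon>: "minimal_cover L (carrier L) n \<epsilon>"
    and \<delta>: "minimal_cover (\<F> {..<n}) {x \<in> carrier (\<F> {..<n}). \<epsilon> x = \<zero>\<^bsub>L\<^esub>} n' \<delta>"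
  shows "\<exists>b d. minimal_resolution L (\<lambda>i. {..<b i}) \<epsilon> d \<and> b 0 = n \<and> b 1 = n'"
proof -
  let ?F = "\<lambda>n. \<F> {..<n :: nat}"
  let ?ker = "\<lambda>n n' \<delta>. {x \<in> carrier (?F n'). \<delta> x = \<zero>\<^bsub>?F n\<^esub>}"
  \<comment> \<open>A state is a map together with the ranks of its target and its source. All free
    modules here share one type, so a single sequence of states can be chosen.\<close>
  let ?P = "\<lambda>i :: nat. \<lambda>(m, m', \<gamma>). \<gamma> \<in> mhom R (?F m') (?F m) \<and>
    (\<forall>x\<in>carrier (?F m'). \<gamma> x = \<zero>\<^bsub>?F m\<^esub> \<longrightarrow> (\<forall>s<m'. x s \<in> \<mm>)) \<and>
    (i = 0 \<longrightarrow> (m, m', \<gamma>) = (n, n', \<delta>))"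
  let ?Q = "\<lambda>i (n, n', \<delta>) (m, m', \<gamma>). m = n' \<and> \<gamma> ` carrier (?F m') = ?ker n n' \<delta>"
  have "\<exists>s. \<forall>i. ?P i (s i) \<and> ?Q i (s i) (s (Suc i))"
  proof (rule dependent_nat_choice)
    show "\<exists>s. ?P 0 s"
      by (rule exI[of _ "(n, n', \<delta>)"]) (use \<delta> in \<open>simp add: minimal_cover_def\<close>)
  next
    fix s i assume P: "?P i s"
    obtain m m' \<gamma> where s: "s = (m, m', \<gamma>)" by (cases s)
    then have \<gamma>: "\<gamma> \<in> mhom R (?F m') (?F m)" using P by simp
    interpret \<gamma>: mod_hom R "?F m'" "?F m" \<gamma> by (rule mod_homI[OF free_is_module free_is_module \<gamma>])
    interpret F: Module.module R "?F m'" by (rule free_is_module)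
    have ker: "submodule R (?ker m m' \<gamma>) (?F m')" using \<gamma>.ker_is_submodule unfolding \<gamma>.ker_def .
    obtain k where "\<exists>\<beta>. minimal_cover (?F m') (?ker m m' \<gamma>) k \<beta>"
      using submodule_cover_exists[OF noeth ker] ..
    then obtain \<beta> where k: "minimal_cover (?F m') (?ker m m' \<gamma>) k \<beta>" ..
    show "\<exists>t. ?P (Suc i) t \<and> ?Q i s t"
      by (rule exI[of _ "(m', k, \<beta>)"]) (use k s in \<open>simp add: minimal_cover_def\<close>)
  qed
  then obtain s where s: "\<forall>i. ?P i (s i) \<and> ?Q i (s i) (s (Suc i))" ..
  have s: "?P i (s i)" "?Q i (s i) (s (Suc i))" for i
    using s[THEN spec, of i] by (rule conjunct1, rule conjunct2)
  define b where "b i = fst (s i)" for i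
  define d where "d i = snd (snd (s i))" for i
  have bs: "fst (snd (s i)) = b (Suc i)" for i
    using s(2)[of i] by (simp add: b_def split_beta)
  have s_eq: "s i = (b i, b (Suc i), d i)" for i
    using bs[of i] by (simp add: b_def d_def prod_eq_iff)
  note s = s[unfolded s_eq prod.case]
  have d: "d i \<in> mhom R (?F (b (Suc i))) (?F (b i))" for i using s(1)[of i] by blast
  have dker: "x s \<in> \<mm>" if "x \<in> carrier (?F (b (Suc i)))" "d i x = \<zero>\<^bsub>?F (b i)\<^esub>" "s < b (Suc i)" for i x s
    using s(1)[of i] that by blast
  have dim: "d (Suc i) ` carrier (?F (b (Suc (Suc i)))) = ?ker (b i) (b (Suc i)) (d i)" for i
    using s(2)[of i] by blast
  have b0: "b 0 = n" "b 1 = n'" "d 0 = \<delta>" using s(1)[of 0] by auto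
  have d0: "d 0 ` carrier (?F (b 1)) = {x \<in> carrier (?F (b 0)). \<epsilon> x = \<zero>\<^bsub>L\<^esub>}"
    using \<delta> b0 by (simp add: minimal_cover_def)
  have "resolution R L (\<lambda>i. {..<b i}) \<epsilon> d"
    unfolding resolution_def Let_def using d dim d0 b0 \<epsilon> by (simp add: minimal_cover_def)
  \<comment> \<open>The image of \<open>d i\<close> is the kernel of the preceding cover, which is
    \<open>\<epsilon>\<close> for \<open>i = 0\<close>, and kernels of minimal covers lie in
    mF.\<close>
  moreover have "d i x s \<in> \<mm>" if x: "x \<in> carrier (?F (b (Suc i)))" and s: "s < b i" for i x s
  proof (cases i)
    case 0
    have "d 0 x \<in> {x \<in> carrier (?F (b 0)). \<epsilon> x = \<zero>\<^bsub>L\<^esub>}" using d0 x 0 by auto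
    then show ?thesis using \<epsilon> b0 0 s by (simp add: minimal_cover_def)
  next
    case (Suc j)
    have "d (Suc j) x \<in> ?ker (b j) (b (Suc j)) (d j)" using dim[of j] x Suc by blast
    then show ?thesis using dker[of "d i x" j s] Suc s by simp
  qed
  ultimately show ?thesis
    unfolding minimal_resolution_def free_res_def free_res_axioms_def using L b0 by blast
qed

lemma minimal_resolution_exists:
  assumes noeth: "noetherian_ring R" and L: "finitely_generated_module R L"
  shows "\<exists>b \<epsilon> d. minimal_resolution L (\<lambda>i. {..<b i :: nat}) \<epsilon> d"
proof -
  interpret L: Module.module R L using L by (simp add: finitely_generated_module_def)
  have "\<exists>H. finite H \<and> H \<subseteq> carrier L \<and> L.span H = carrier L"
    using L by (simp add: finitely_generated_module_def)
  then obtain H where "finite H \<and> H \<subseteq> carrier L \<and> L.span H = carrier L" ..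
  then have H: "finite H" "H \<subseteq> carrier L" "L.span H = carrier L" by simp_all
  obtain n where "\<exists>\<epsilon>. minimal_cover L (carrier L) n \<epsilon>"
    using minimal_cover_exists'[OF L.module_axioms H] ..
  then obtain \<epsilon> where \<epsilon>: "minimal_cover L (carrier L) n \<epsilon>" ..
  then have "\<epsilon> \<in> mhom R (\<F> {..<n}) L" by (simp add: minimal_cover_def)
  then interpret \<epsilon>: mod_hom R "\<F> {..<n}" L \<epsilon> by (rule mod_homI[OF free_is_module L.module_axioms])
  let ?K = "{x \<in> carrier (\<F> {..<n}). \<epsilon> x = \<zero>\<^bsub>L\<^esub>}"
  have "submodule R ?K (\<F> {..<n})" using \<epsilon>.ker_is_submodule unfolding \<epsilon>.ker_def .
  from submodule_cover_exists[OF noeth this]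
  obtain n' where "\<exists>\<delta>. minimal_cover (\<F> {..<n}) ?K n' \<delta>" ..
  then obtain \<delta> where "minimal_cover (\<F> {..<n}) ?K n' \<delta>" ..
  from minimal_resolution_extend[OF noeth L.module_axioms \<epsilon> this]
  obtain b d where "minimal_resolution L (\<lambda>i. {..<b i}) \<epsilon> d" by (elim exE conjE)
  then show ?thesis by (intro exI)
qed

lemma minimal_resolution_imp_free: "minimal_resolution L (\<lambda>i. {..<b i}) \<epsilon> d \<Longrightarrow> free_resolution R L b \<epsilon> d"
  by (simp add: minimal_resolution_def free_res_def free_res_axioms_def free_resolution_eq_resolution)

text \<open>\<open>minimal_resolution_exists\<close> supplies the resolution with bases
  \<open>{..<b i}\<close> that \<open>Tor\<close> asks for, while the sets \<open>S i\<close> may be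
  of another kind.\<close>

lemma betti_minimal_resolution:
  assumes "noetherian_ring R" "finitely_generated_module R L" "minimal_resolution L S \<epsilon> d"
  shows "betti R L i = card (S i)"
  using minimal_resolution_exists[OF assms(1,2)] betti_eqI[OF assms(3)] minimal_resolution_imp_free by blast

text \<open>\<open>L\<close> is R/m up to isomorphism. Its first cover is R \<rightarrow> R/m with
  kernel m, and a least generating set of m gives the second. \<open>L\<close> is kept general
  because k also occurs as a module over R |x M by restriction of scalars.\<close>

lemma betti_cyclic_residue:
  assumes noeth: "noetherian_ring R" and L: "Module.module R L"
    and \<theta>: "\<theta> \<in> mhom R (self_module R) L" "\<theta> ` carrier R = carrier L"
    and \<theta>_ker: "\<And>a. a \<in> carrier R \<Longrightarrow> \<theta> a = \<zero>\<^bsub>L\<^esub> \<longleftrightarrow> a \<in> \<mm>"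
  shows "betti R L 0 = 1" and "betti R L 1 = edim R"
proof -
  interpret S: Module.module R "self_module R" by (rule self_is_module)
  let ?F = "\<F> {..<1 :: nat}"
  let ?P = "\<lambda>n. \<exists>S. finite S \<and> card S = n \<and> S \<subseteq> carrier R \<and> Idl S = \<mm>"
  obtain A where A: "A \<subseteq> carrier R" "finite A" "\<mm> = Idl A"
    using noetherian_ring.finetely_gen[OF noeth max_ideal_ideal] by blast
  have "?P (edim R)" unfolding edim_def by (rule LeastI[of ?P "card A"]) (use A in blast)
  then obtain H where H: "finite H" "card H = edim R" "H \<subseteq> carrier R" "Idl H = \<mm>" by blast
  have "\<exists>\<delta>. minimal_cover (self_module R) (\<mm>) (card H) \<delta>"
  proof (rule minimal_cover_exists[OF self_is_module H(1)])
    show "H \<subseteq> carrier (self_module R)" "S.span H = \<mm>" using H span_self_module by simp_all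
    fix G assume "finite G" "G \<subseteq> carrier (self_module R)" "S.span G = \<mm>"
    then have "?P (card G)" using span_self_module by auto
    then show "card H \<le> card G" unfolding H(2) edim_def by (rule Least_le)
  qed
  then obtain \<delta> where \<delta>: "minimal_cover (self_module R) (\<mm>) (edim R) \<delta>" using H by auto
  \<comment> \<open>The identification of R with the free module of rank one; it takes m to the
    kernel \<open>?K\<close>.\<close>
  let ?i = "\<lambda>a. \<lambda>t\<in>{..<1 :: nat}. a"
  let ?\<epsilon> = "\<lambda>x :: nat \<Rightarrow> 'a. \<theta> (x 0)"
  have \<epsilon>: "?\<epsilon> \<in> mhom R ?F L" by (rule mhom_comp[OF coord_hom \<theta>(1)]) simp
  have ker: "?\<epsilon> x = \<zero>\<^bsub>L\<^esub> \<longleftrightarrow> x 0 \<in> \<mm>" if "x \<in> carrier ?F" for x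
    by (rule \<theta>_ker) (rule free_coord[OF that], simp)
  have surj: "?\<epsilon> ` carrier ?F = carrier L"
  proof
    show "carrier L \<subseteq> ?\<epsilon> ` carrier ?F"
    proof
      fix y assume "y \<in> carrier L"
      then have "y \<in> \<theta> ` carrier R" by (simp add: \<theta>(2))
      then obtain a where a: "a \<in> carrier R" "y = \<theta> a" by blast
      then have "?i a \<in> carrier ?F" by (simp add: free_carrier_finite)
      then show "y \<in> ?\<epsilon> ` carrier ?F" using a by (intro image_eqI[of _ _ "?i a"]) simp_all
    qed
  qed (rule image_subsetI, rule mhom_closed[OF \<epsilon>])
  have i: "?i \<in> mhom R (self_module R) ?F"
    by (auto simp: mhom_def free_carrier_finite free_add free_smult)
  let ?K = "{x \<in> carrier ?F. ?\<epsilon> x = \<zero>\<^bsub>L\<^esub>}"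
  have K: "?i ` \<mm> = ?K"
  proof
    show "?i ` \<mm> \<subseteq> ?K"
    proof clarify
      fix a assume a: "a \<in> \<mm>"
      then have "?i a \<in> carrier ?F" using mm.a_subset by (auto simp: free_carrier_finite)
      then show "?i a \<in> carrier ?F \<and> ?\<epsilon> (?i a) = \<zero>\<^bsub>L\<^esub>" using \<theta>_ker[OF mm.Icarr[OF a]] a by simp
    qed
    show "?K \<subseteq> ?i ` \<mm>"
    proof clarify
      fix x assume x: "x \<in> carrier ?F" "?\<epsilon> x = \<zero>\<^bsub>L\<^esub>"
      then have m: "x 0 \<in> \<mm>" using ker by blast
      have "?i (x 0) \<in> carrier ?F" using x by (auto simp: free_carrier_finite)
      then have "x = ?i (x 0)" using x by (intro free_eqI[of x "{..<1}"]) auto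
      with m show "x \<in> ?i ` \<mm>" by blast
    qed
  qed
  have cover: "minimal_cover ?F ?K (edim R) (\<lambda>x. ?i (\<delta> x))"
    unfolding minimal_cover_def
  proof (intro conjI ballI impI allI)
    show "(\<lambda>x. ?i (\<delta> x)) \<in> mhom R (\<F> {..<edim R}) ?F"
      using \<delta> i by (auto simp: minimal_cover_def intro: mhom_comp)
    have "(\<lambda>x. ?i (\<delta> x)) ` carrier (\<F> {..<edim R}) = ?i ` (\<delta> ` carrier (\<F> {..<edim R}))"
      by (rule image_image[symmetric])
    then show "(\<lambda>x. ?i (\<delta> x)) ` carrier (\<F> {..<edim R}) = ?K"
      using \<delta> K by (simp add: minimal_cover_def)
    fix x s assume x: "x \<in> carrier (\<F> {..<edim R})" "?i (\<delta> x) = \<zero>\<^bsub>?F\<^esub>" "s < edim R"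
    then have "?i (\<delta> x) 0 = \<zero>\<^bsub>?F\<^esub> 0" by simp
    then have "\<delta> x = \<zero>" by simp
    then show "x s \<in> \<mm>" using \<delta> x by (simp add: minimal_cover_def)
  qed
  have "minimal_cover L (carrier L) 1 ?\<epsilon>"
    unfolding minimal_cover_def using \<epsilon> surj ker by simp
  from minimal_resolution_extend[OF noeth L this cover] obtain b d where
    b: "minimal_resolution L (\<lambda>i. {..<b i}) ?\<epsilon> d" "b 0 = 1" "b 1 = edim R" by blast
  from betti_eqI[OF b(1) minimal_resolution_imp_free[OF b(1)]] show "betti R L 0 = 1" "betti R L 1 = edim R"
    using b(2,3) by simp_all
qed

end

section \<open>Algebra retracts and the total complex\<close>

lemma restrict_scalars_simps [simp]:
  "carrier (restrict_scalars \<phi> N) = carrier N" "\<zero>\<^bsub>restrict_scalars \<phi> N\<^esub> = \<zero>\<^bsub>N\<^esub>"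
  "add (restrict_scalars \<phi> N) = add N" "a \<odot>\<^bsub>restrict_scalars \<phi> N\<^esub> x = \<phi> a \<odot>\<^bsub>N\<^esub> x"
  by (simp_all add: restrict_scalars_def)

lemma restrict_scalars_module:
  assumes A: "cring A" and \<phi>: "\<phi> \<in> ring_hom A R" and N: "Module.module R N"
  shows "Module.module A (restrict_scalars \<phi> N)"
proof -
  interpret N: Module.module R N by (rule N)
  have add: "add (restrict_scalars \<phi> N) = add N" by simp
  have "abelian_group (restrict_scalars \<phi> N)"
  proof (rule abelian_groupI)
    fix x assume "x \<in> carrier (restrict_scalars \<phi> N)"
    then show "\<exists>y\<in>carrier (restrict_scalars \<phi> N). y \<oplus>\<^bsub>restrict_scalars \<phi> N\<^esub> x = \<zero>\<^bsub>restrict_scalars \<phi> N\<^esub>"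
      by (intro bexI[of _ "\<ominus>\<^bsub>N\<^esub> x"]) (simp_all add: N.M.l_neg)
  qed (simp_all add: N.M.a_ac)
  then show ?thesis using A ring_hom_memE[OF \<phi>]
    by (intro Module.moduleI) (simp_all add: N.smult_l_distr N.smult_r_distr N.smult_assoc1)
qed

context Module.module
begin

lemma mhom_add:
  assumes L: "Module.module R L" and f: "f \<in> mhom R L M" and g: "g \<in> mhom R L M"
  shows "(\<lambda>x. f x \<oplus>\<^bsub>M\<^esub> g x) \<in> mhom R L M"
proof -
  interpret f: mod_hom R L M f by (rule mod_homI[OF L module_axioms f])
  interpret g: mod_hom R L M g by (rule mod_homI[OF L module_axioms g])
  show ?thesis unfolding mhom_def by (auto simp: smult_r_distr M.a_ac)
qed

lemma mhom_smult:
  assumes L: "Module.module R L" and f: "f \<in> mhom R L M" and a: "a \<in> carrier R"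
  shows "(\<lambda>x. a \<odot>\<^bsub>M\<^esub> f x) \<in> mhom R L M"
proof -
  interpret f: mod_hom R L M f by (rule mod_homI[OF L module_axioms f])
  have "a \<odot>\<^bsub>M\<^esub> (r \<odot>\<^bsub>M\<^esub> f x) = r \<odot>\<^bsub>M\<^esub> (a \<odot>\<^bsub>M\<^esub> f x)" if "r \<in> carrier R" "x \<in> carrier L" for r x
    using that a smult_assoc1[of a r "f x"] smult_assoc1[of r a "f x"] by (simp add: R.m_comm)
  then show ?thesis unfolding mhom_def using a by (auto simp: smult_r_distr)
qed

lemma mhom_finsum:
  assumes L: "Module.module R L" and f: "\<And>i. i \<in> I \<Longrightarrow> f i \<in> mhom R L M"
  shows "(\<lambda>x. \<Oplus>\<^bsub>M\<^esub>i\<in>I. f i x) \<in> mhom R L M"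
  using f
proof (induct I rule: infinite_finite_induct)
  case (insert i I)
  have hom: "f i \<in> mhom R L M" "(\<lambda>x. \<Oplus>\<^bsub>M\<^esub>i\<in>I. f i x) \<in> mhom R L M" using insert by simp_all
  have c: "f j x \<in> carrier M" if "j \<in> insert i I" "x \<in> carrier L" for j x
    using mhom_closed[OF insert.prems[OF that(1)] that(2)] .
  show ?case
  proof (rule mhom_cong[OF mhom_add[OF L hom] _ L])
    fix x assume x: "x \<in> carrier L"
    show "(\<Oplus>\<^bsub>M\<^esub>i\<in>insert i I. f i x) = f i x \<oplus>\<^bsub>M\<^esub> (\<Oplus>\<^bsub>M\<^esub>i\<in>I. f i x)"
      using insert.hyps c x by (intro M.finsum_insert) auto
  qed
qed (simp_all add: mhom_def)

end

context cring
begin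

lemma hom_into_free:
  assumes S: "finite S" and f: "\<And>s. s \<in> S \<Longrightarrow> (\<lambda>x. f x s) \<in> mhom R L (self_module R)"
  shows "(\<lambda>x. \<lambda>s\<in>S. f x s) \<in> mhom R L (\<F> S)"
proof -
  have "f x s \<in> carrier R" if "x \<in> carrier L" "s \<in> S" for x s
    using mhom_closed[OF f[OF that(2)] that(1)] by simp
  then show ?thesis using f unfolding mhom_def
    by (auto simp: free_carrier_finite[OF S] free_add free_smult intro!: restrict_ext)
qed

end

text \<open>F resolves R over A, which acts on R through \<open>\<rho>\<close>, and G resolves N
  over R. The section \<open>\<iota>\<close> of \<open>\<rho>\<close> makes A-modules into
  R-modules, which gives sense to F \<otimes> G over R.\<close>

locale algebra_retract =
  F: free_res A "restrict_scalars \<rho> (self_module R)" Sf \<epsilon>f df + G: free_res R N Sg \<epsilon>g dg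
  for A :: "('a, 'i) ring_scheme" and R :: "('b, 'j) ring_scheme" and \<rho> \<iota>
    and Sf :: "nat \<Rightarrow> 's set" and \<epsilon>f df and N :: "('b, 'c, 'k) module_scheme"
    and Sg :: "nat \<Rightarrow> 't set" and \<epsilon>g dg +
  assumes \<iota>: "\<iota> \<in> ring_hom R A" and \<rho>: "\<rho> \<in> ring_hom A R"
    and \<rho>_\<iota>: "\<And>r. r \<in> carrier R \<Longrightarrow> \<rho> (\<iota> r) = r"
    and fin_f: "\<And>i. finite (Sf i)" and fin_g: "\<And>i. finite (Sg i)"
begin

lemmas \<iota>_simps [simp] = ring_hom_memE[OF \<iota>] and \<rho>_simps [simp] = ring_hom_memE[OF \<rho>]

lemma \<iota>_zero [simp]: "\<iota> \<zero>\<^bsub>R\<^esub> = \<zero>\<^bsub>A\<^esub>"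
  by (rule ring_hom_zero[OF \<iota> G.L.ring_axioms F.L.ring_axioms])

text \<open>The matrix of \<open>dg q\<close>, with rows \<open>v\<close> and columns
  \<open>v'\<close>.\<close>

definition entry :: "nat \<Rightarrow> 't \<Rightarrow> 't \<Rightarrow> 'b"
  where "entry q v v' = dg q (free_basis R (Sg (Suc q)) v') v"

lemma entry_closed [simp]: "v \<in> Sg q \<Longrightarrow> v' \<in> Sg (Suc q) \<Longrightarrow> entry q v v' \<in> carrier R"
  unfolding entry_def by (intro G.L.free_coord[of _ "Sg q"] G.d.f_im) simp_all

text \<open>The map \<open>d \<otimes> X\<close>, where \<open>X\<close> is an \<open>A\<close>-module and \<open>G q \<otimes> X\<close> is identified with the families
  in \<open>X\<close> indexed by the basis of \<open>G q\<close>.\<close>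

definition act :: "('a, 'x, 'y) module_scheme \<Rightarrow> nat \<Rightarrow> ('t \<Rightarrow> 'x) \<Rightarrow> 't \<Rightarrow> 'x"
  where "act X q y v = (\<Oplus>\<^bsub>X\<^esub>v'\<in>Sg (Suc q). \<iota> (entry q v v') \<odot>\<^bsub>X\<^esub> y v')"

lemma dg_apply:
  assumes "w \<in> carrier (G.F (Suc q))" "v \<in> Sg q"
  shows "dg q w v = (\<Oplus>\<^bsub>R\<^esub>v'\<in>Sg (Suc q). entry q v v' \<otimes>\<^bsub>R\<^esub> w v')"
proof -
  have b: "(\<lambda>v'. dg q (free_basis R (Sg (Suc q)) v')) \<in> Sg (Suc q) \<rightarrow> carrier (G.F q)" by auto
  have sum: "dg q w = (\<Oplus>\<^bsub>G.F q\<^esub>v'\<in>Sg (Suc q). w v' \<odot>\<^bsub>G.F q\<^esub> dg q (free_basis R (Sg (Suc q)) v'))"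
    using hom_free_lift[OF G.F.module_axioms G.d_hom assms(1)] G.F.free_lift_finite[OF fin_g b assms(1)] by simp
  have "dg q w v = (\<Oplus>\<^bsub>R\<^esub>v'\<in>Sg (Suc q). (w v' \<odot>\<^bsub>G.F q\<^esub> dg q (free_basis R (Sg (Suc q)) v')) v)"
    unfolding sum using assms b by (intro G.L.free_finsum_apply) auto
  also have "\<dots> = (\<Oplus>\<^bsub>R\<^esub>v'\<in>Sg (Suc q). entry q v v' \<otimes>\<^bsub>R\<^esub> w v')"
  proof (rule G.L.R.finsum_cong')
    fix v' assume v': "v' \<in> Sg (Suc q)"
    have "w v' \<in> carrier R" using G.L.free_coord[OF assms(1) v'] .
    then show "(w v' \<odot>\<^bsub>G.F q\<^esub> dg q (free_basis R (Sg (Suc q)) v')) v = entry q v v' \<otimes>\<^bsub>R\<^esub> w v'"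
      using entry_closed[OF assms(2) v'] assms(2) by (simp add: entry_def[symmetric] G.L.R.m_comm)
  qed (use assms G.L.free_coord[OF assms(1)] in auto)
  finally show ?thesis .
qed

lemma entry_entry:
  assumes "v \<in> Sg q" "v'' \<in> Sg (Suc (Suc q))"
  shows "(\<Oplus>\<^bsub>R\<^esub>v'\<in>Sg (Suc q). entry q v v' \<otimes>\<^bsub>R\<^esub> entry (Suc q) v' v'') = \<zero>\<^bsub>R\<^esub>"
proof -
  let ?e = "free_basis R (Sg (Suc (Suc q))) v''"
  have "dg q (dg (Suc q) ?e) v = \<zero>\<^bsub>R\<^esub>" using assms by (simp add: G.d_d)
  then show ?thesis using assms dg_apply[of "dg (Suc q) ?e" q v] by (simp add: entry_def)
qed

context
  fixes X :: "('a, 'x, 'y) module_scheme"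
  assumes X: "Module.module A X"
begin

interpretation X: Module.module A X by (rule X)

lemma act_closed:
  assumes "\<And>v'. v' \<in> Sg (Suc q) \<Longrightarrow> y v' \<in> carrier X" "v \<in> Sg q"
  shows "act X q y v \<in> carrier X"
  unfolding act_def using assms by (intro X.M.finsum_closed Pi_I X.smult_closed) auto

lemma act_cong:
  assumes "\<And>v'. v' \<in> Sg (Suc q) \<Longrightarrow> y v' = z v'" "\<And>v'. v' \<in> Sg (Suc q) \<Longrightarrow> z v' \<in> carrier X" "v \<in> Sg q"
  shows "act X q y v = act X q z v"
  unfolding act_def using assms by (intro X.M.finsum_cong') auto

lemma act_add:
  assumes "\<And>v'. v' \<in> Sg (Suc q) \<Longrightarrow> y v' \<in> carrier X" "\<And>v'. v' \<in> Sg (Suc q) \<Longrightarrow> z v' \<in> carrier X" "v \<in> Sg q"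
  shows "act X q (\<lambda>v'. y v' \<oplus>\<^bsub>X\<^esub> z v') v = act X q y v \<oplus>\<^bsub>X\<^esub> act X q z v"
proof -
  have "act X q (\<lambda>v'. y v' \<oplus>\<^bsub>X\<^esub> z v') v =
    (\<Oplus>\<^bsub>X\<^esub>v'\<in>Sg (Suc q). \<iota> (entry q v v') \<odot>\<^bsub>X\<^esub> y v' \<oplus>\<^bsub>X\<^esub> \<iota> (entry q v v') \<odot>\<^bsub>X\<^esub> z v')"
    unfolding act_def using assms by (intro X.M.finsum_cong') (auto simp: X.smult_r_distr)
  also have "\<dots> = act X q y v \<oplus>\<^bsub>X\<^esub> act X q z v"
    unfolding act_def using assms by (intro X.M.finsum_addf) auto
  finally show ?thesis .
qed

lemma act_smult:
  assumes "\<And>v'. v' \<in> Sg (Suc q) \<Longrightarrow> y v' \<in> carrier X" "a \<in> carrier A" "v \<in> Sg q"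
  shows "act X q (\<lambda>v'. a \<odot>\<^bsub>X\<^esub> y v') v = a \<odot>\<^bsub>X\<^esub> act X q y v"
proof -
  have "act X q (\<lambda>v'. a \<odot>\<^bsub>X\<^esub> y v') v = (\<Oplus>\<^bsub>X\<^esub>v'\<in>Sg (Suc q). a \<odot>\<^bsub>X\<^esub> (\<iota> (entry q v v') \<odot>\<^bsub>X\<^esub> y v'))"
    unfolding act_def
  proof (rule X.M.finsum_cong')
    fix v' assume v': "v' \<in> Sg (Suc q)"
    have c: "\<iota> (entry q v v') \<in> carrier A" using assms(3) v' by simp
    show "\<iota> (entry q v v') \<odot>\<^bsub>X\<^esub> (a \<odot>\<^bsub>X\<^esub> y v') = a \<odot>\<^bsub>X\<^esub> (\<iota> (entry q v v') \<odot>\<^bsub>X\<^esub> y v')"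
      using X.smult_assoc1[OF c assms(2) assms(1)[OF v']] X.smult_assoc1[OF assms(2) c assms(1)[OF v']]
        F.L.R.m_comm[OF c assms(2)] by simp
  qed (use assms in auto)
  also have "\<dots> = a \<odot>\<^bsub>X\<^esub> act X q y v"
    unfolding act_def using assms by (intro X.finsum_smult[symmetric]) auto
  finally show ?thesis .
qed

text \<open>After an exchange of the two sums, the inner one is the image under
  \<open>\<iota>\<close> of an entry of the product of two consecutive matrices of
  \<open>dg\<close>, which is zero.\<close>

lemma act_act:
  assumes y: "\<And>v'. v' \<in> Sg (Suc (Suc q)) \<Longrightarrow> y v' \<in> carrier X" and v: "v \<in> Sg q"
  shows "act X q (act X (Suc q) y) v = \<zero>\<^bsub>X\<^esub>"
proof -
  let ?e = "\<lambda>v' v''. \<iota> (entry q v v' \<otimes>\<^bsub>R\<^esub> entry (Suc q) v' v'')"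
  have "act X q (act X (Suc q) y) v =
    (\<Oplus>\<^bsub>X\<^esub>v'\<in>Sg (Suc q). \<Oplus>\<^bsub>X\<^esub>v''\<in>Sg (Suc (Suc q)). ?e v' v'' \<odot>\<^bsub>X\<^esub> y v'')"
    unfolding act_def
  proof (rule X.M.finsum_cong')
    fix v' assume v': "v' \<in> Sg (Suc q)"
    have "\<iota> (entry q v v') \<odot>\<^bsub>X\<^esub> (\<Oplus>\<^bsub>X\<^esub>v''\<in>Sg (Suc (Suc q)). \<iota> (entry (Suc q) v' v'') \<odot>\<^bsub>X\<^esub> y v'') =
      (\<Oplus>\<^bsub>X\<^esub>v''\<in>Sg (Suc (Suc q)). \<iota> (entry q v v') \<odot>\<^bsub>X\<^esub> (\<iota> (entry (Suc q) v' v'') \<odot>\<^bsub>X\<^esub> y v''))"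
      using v v' y by (intro X.finsum_smult) auto
    also have "\<dots> = (\<Oplus>\<^bsub>X\<^esub>v''\<in>Sg (Suc (Suc q)). ?e v' v'' \<odot>\<^bsub>X\<^esub> y v'')"
      using v v' y by (intro X.M.finsum_cong') (auto simp: X.smult_assoc1)
    finally show "\<iota> (entry q v v') \<odot>\<^bsub>X\<^esub> (\<Oplus>\<^bsub>X\<^esub>v''\<in>Sg (Suc (Suc q)). \<iota> (entry (Suc q) v' v'') \<odot>\<^bsub>X\<^esub> y v'') =
      (\<Oplus>\<^bsub>X\<^esub>v''\<in>Sg (Suc (Suc q)). ?e v' v'' \<odot>\<^bsub>X\<^esub> y v'')" .
  qed (use v y in \<open>auto intro!: X.M.finsum_closed\<close>)
  also have "\<dots> = (\<Oplus>\<^bsub>X\<^esub>v''\<in>Sg (Suc (Suc q)). \<Oplus>\<^bsub>X\<^esub>v'\<in>Sg (Suc q). ?e v' v'' \<odot>\<^bsub>X\<^esub> y v'')"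
    using v y fin_g by (intro X.M.add.finprod_finprod_swap) auto
  also have "\<dots> = (\<Oplus>\<^bsub>X\<^esub>v''\<in>Sg (Suc (Suc q)). \<zero>\<^bsub>X\<^esub>)"
  proof (rule X.M.finsum_cong')
    fix v'' assume v'': "v'' \<in> Sg (Suc (Suc q))"
    have c: "(\<lambda>v'. entry q v v' \<otimes>\<^bsub>R\<^esub> entry (Suc q) v' v'') \<in> Sg (Suc q) \<rightarrow> carrier R" using v v'' by auto
    have "(\<Oplus>\<^bsub>X\<^esub>v'\<in>Sg (Suc q). ?e v' v'' \<odot>\<^bsub>X\<^esub> y v'') = (\<Oplus>\<^bsub>A\<^esub>v'\<in>Sg (Suc q). ?e v' v'') \<odot>\<^bsub>X\<^esub> y v''"
      using v v'' y by (intro X.finsum_smult_r[symmetric]) auto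
    also have "(\<Oplus>\<^bsub>A\<^esub>v'\<in>Sg (Suc q). ?e v' v'') = \<iota> (\<Oplus>\<^bsub>R\<^esub>v'\<in>Sg (Suc q). entry q v v' \<otimes>\<^bsub>R\<^esub> entry (Suc q) v' v'')"
    proof -
      interpret \<iota>: ring_hom_ring R A \<iota>
        by (rule ring_hom_ringI2[OF G.L.ring_axioms F.L.ring_axioms \<iota>])
      show ?thesis using \<iota>.hom_finsum[OF c] by (simp add: o_def)
    qed
    finally show "(\<Oplus>\<^bsub>X\<^esub>v'\<in>Sg (Suc q). ?e v' v'' \<odot>\<^bsub>X\<^esub> y v'') = \<zero>\<^bsub>X\<^esub>"
      using entry_entry[OF v v''] y[OF v''] by simp
  qed auto
  finally show ?thesis by simp
qed

text \<open>Naturality of d \<otimes> X in X. For the differentials of F it gives commuting squares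
  (\<open>df_act\<close>), for the augmentation of F a map of complexes to G
  (\<open>aug_act\<close>).\<close>

lemma act_hom:
  assumes W: "Module.module A W" and f: "f \<in> mhom A X W"
    and y: "\<And>v'. v' \<in> Sg (Suc q) \<Longrightarrow> y v' \<in> carrier X" and v: "v \<in> Sg q"
  shows "f (act X q y v) = act W q (\<lambda>v'. f (y v')) v"
proof -
  interpret W: Module.module A W by (rule W)
  interpret f: mod_hom A X W f by (rule mod_homI[OF X W f])
  have "f (act X q y v) = (\<Oplus>\<^bsub>W\<^esub>v'\<in>Sg (Suc q). f (\<iota> (entry q v v') \<odot>\<^bsub>X\<^esub> y v'))"
    unfolding act_def using v y by (intro f.hom_finsum) auto
  also have "\<dots> = act W q (\<lambda>v'. f (y v')) v"
    unfolding act_def using v y by (intro W.M.finsum_cong') auto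
  finally show ?thesis .
qed

end

text \<open>The entries act on R through \<open>\<rho>\<close> after \<open>\<iota>\<close>, which
  is the identity: R \<otimes> G is G with its own differential.\<close>

lemma act_base:
  assumes "w \<in> carrier (G.F (Suc q))" "v \<in> Sg q"
  shows "act (restrict_scalars \<rho> (self_module R)) q w v = dg q w v"
proof -
  have "act (restrict_scalars \<rho> (self_module R)) q w v = (\<Oplus>\<^bsub>R\<^esub>v'\<in>Sg (Suc q). \<rho> (\<iota> (entry q v v')) \<otimes>\<^bsub>R\<^esub> w v')"
    unfolding act_def by (subst finsum_eq_of_same_group[where N = R]) (simp_all add: self_module_def)
  also have "\<dots> = dg q w v"
    unfolding dg_apply[OF assms] using assms G.L.free_coord[OF assms(1)]
    by (intro G.L.R.finsum_cong') (auto simp: \<rho>_\<iota>)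
  finally show ?thesis .
qed

end

section \<open>The complex F \<otimes> G and its augmentation\<close>

context algebra_retract
begin

text \<open>The basis of F \<otimes> G in degree i: \<open>q\<close> is the degree in G,
  \<open>v\<close> a basis element of G q, and \<open>u\<close> one of F (i - q).\<close>

definition idx :: "nat \<Rightarrow> (nat \<times> 't \<times> 's) set"
  where "idx i = (SIGMA q:{..i}. Sg q \<times> Sf (i - q))"

abbreviation "X p \<equiv> free_module A (Sf p)"
abbreviation "T i \<equiv> free_module A (idx i)"
abbreviation "base \<equiv> restrict_scalars \<rho> (self_module R)"

lemma idx_iff [simp]: "(q, v, u) \<in> idx i \<longleftrightarrow> q \<le> i \<and> v \<in> Sg q \<and> u \<in> Sf (i - q)"
  by (simp add: idx_def)

lemma finite_idx: "finite (idx i)"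
  unfolding idx_def using fin_f fin_g by auto

lemma card_idx: "card (idx i) = (\<Sum>q\<le>i. card (Sf (i - q)) * card (Sg q))"
  unfolding idx_def using fin_f fin_g by (simp add: card_cartesian_product mult.commute)

sublocale T: Module.module A "T i" for i by (rule F.L.free_is_module)

text \<open>The coefficient in F (i - q) of the basis element \<open>v\<close> of G q;
  \<open>assemble\<close> is the inverse construction.\<close>

definition slice :: "nat \<Rightarrow> (nat \<times> 't \<times> 's \<Rightarrow> 'a) \<Rightarrow> nat \<Rightarrow> 't \<Rightarrow> 's \<Rightarrow> 'a"
  where "slice i x q v = (\<lambda>u\<in>Sf (i - q). x (q, v, u))"

lemma slice_hom:
  assumes "q \<le> i" "v \<in> Sg q"
  shows "(\<lambda>x. slice i x q v) \<in> mhom A (T i) (X (i - q))"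
  unfolding slice_def using assms fin_f by (intro F.L.hom_into_free F.L.coord_hom) auto

lemma slice_closed [simp]:
  assumes "x \<in> carrier (T i)" "q \<le> i" "v \<in> Sg q"
  shows "slice i x q v \<in> carrier (X (i - q))"
  using mhom_closed[OF slice_hom[OF assms(2,3)] assms(1)] .

text \<open>Subtraction is truncated: \<open>Suc i - q\<close> and \<open>Suc (i - q)\<close> agree
  only for \<open>q \<le> i\<close>. The shifted closure rules are therefore separate lemmas for the
  simplifier.\<close>

lemma slice_closed_Suc [simp]:
  assumes "x \<in> carrier (T (Suc i))" "q \<le> i" "v \<in> Sg q"
  shows "slice (Suc i) x q v \<in> carrier (X (Suc (i - q)))"
  using slice_closed[OF assms(1), of q v] assms by (simp add: Suc_diff_le)

lemma slice_Suc_closed [simp]: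
  assumes "x \<in> carrier (T (Suc i))" "q \<le> i" "v \<in> Sg (Suc q)"
  shows "slice (Suc i) x (Suc q) v \<in> carrier (X (i - q))"
  using slice_closed[OF assms(1), of "Suc q" v] assms by simp

lemma slice_eqI:
  assumes "x \<in> carrier (T i)" "y \<in> carrier (T i)"
    "\<And>q v. q \<le> i \<Longrightarrow> v \<in> Sg q \<Longrightarrow> slice i x q v = slice i y q v"
  shows "x = y"
proof (rule F.L.free_eqI[OF assms(1,2)])
  fix p assume "p \<in> idx i"
  then obtain q v u where p: "p = (q, v, u)" "q \<le> i" "v \<in> Sg q" "u \<in> Sf (i - q)" by (cases p) auto
  then show "x p = y p" using fun_cong[OF assms(3)[of q v], of u] by (simp add: slice_def)
qed

definition assemble :: "nat \<Rightarrow> (nat \<Rightarrow> 't \<Rightarrow> 's \<Rightarrow> 'a) \<Rightarrow> nat \<times> 't \<times> 's \<Rightarrow> 'a"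
  where "assemble i y = (\<lambda>p\<in>idx i. case p of (q, v, u) \<Rightarrow> y q v u)"

lemma
  assumes y: "\<And>q v. q \<le> i \<Longrightarrow> v \<in> Sg q \<Longrightarrow> y q v \<in> carrier (X (i - q))"
  shows assemble_closed: "assemble i y \<in> carrier (T i)"
    and slice_assemble: "\<And>q v. q \<le> i \<Longrightarrow> v \<in> Sg q \<Longrightarrow> slice i (assemble i y) q v = y q v"
proof -
  have c: "y q v u \<in> carrier A" if "q \<le> i" "v \<in> Sg q" "u \<in> Sf (i - q)" for q v u
    using F.L.free_coord[OF y[OF that(1,2)] that(3)] .
  show cl: "assemble i y \<in> carrier (T i)"
    unfolding F.L.free_carrier_finite[OF finite_idx] assemble_def using c
    by (auto split: prod.splits)
  fix q v assume q: "q \<le> i" "v \<in> Sg q"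
  show "slice i (assemble i y) q v = y q v"
    by (rule F.L.free_eqI[OF slice_closed[OF cl q] y[OF q]]) (use q in \<open>simp add: slice_def assemble_def\<close>)
qed

text \<open>The sign (-1)^q on the differential of F makes it anticommute with that of G; without
  signs the two commute.\<close>

definition sgn :: "nat \<Rightarrow> 'a"
  where "sgn q = (if even q then \<one>\<^bsub>A\<^esub> else \<ominus>\<^bsub>A\<^esub> \<one>\<^bsub>A\<^esub>)"

lemma sgn_closed [simp]: "sgn q \<in> carrier A" by (simp add: sgn_def)

lemma sgn_sgn [simp]: "x \<in> carrier (X p) \<Longrightarrow> sgn q \<odot>\<^bsub>X p\<^esub> (sgn q \<odot>\<^bsub>X p\<^esub> x) = x"
  by (simp add: sgn_def F.F.smult_l_minus F.F.smult_r_minus)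

lemma sgn_Suc: "x \<in> carrier (X p) \<Longrightarrow> sgn (Suc q) \<odot>\<^bsub>X p\<^esub> x = \<ominus>\<^bsub>X p\<^esub> (sgn q \<odot>\<^bsub>X p\<^esub> x)"
  by (simp add: sgn_def F.F.smult_l_minus)

text \<open>The component of the differential of \<open>F \<otimes> G\<close> in \<open>F (i - q) \<otimes> G q\<close>.\<close>

definition comp :: "nat \<Rightarrow> nat \<Rightarrow> 't \<Rightarrow> (nat \<times> 't \<times> 's \<Rightarrow> 'a) \<Rightarrow> 's \<Rightarrow> 'a"
  where "comp i q v x = sgn q \<odot>\<^bsub>X (i - q)\<^esub> df (i - q) (slice (Suc i) x q v)
    \<oplus>\<^bsub>X (i - q)\<^esub> act (X (i - q)) q (slice (Suc i) x (Suc q)) v"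

definition bd :: "nat \<Rightarrow> (nat \<times> 't \<times> 's \<Rightarrow> 'a) \<Rightarrow> nat \<times> 't \<times> 's \<Rightarrow> 'a"
  where "bd i x = assemble i (\<lambda>q v. comp i q v x)"

text \<open>The map \<epsilon>f \<otimes> G in degree 0: a family in R indexed by the basis of G 0
  is an element of G 0.\<close>

definition aug_family :: "(nat \<times> 't \<times> 's \<Rightarrow> 'a) \<Rightarrow> 't \<Rightarrow> 'b"
  where "aug_family x = (\<lambda>v\<in>Sg 0. \<epsilon>f (slice 0 x 0 v))"

definition aug :: "(nat \<times> 't \<times> 's \<Rightarrow> 'a) \<Rightarrow> 'c"
  where "aug x = \<epsilon>g (aug_family x)"

lemma X_module: "Module.module A (X p)" by (rule F.F.module_axioms)

lemma comp_hom:
  assumes "q \<le> i" "v \<in> Sg q"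
  shows "comp i q v \<in> mhom A (T (Suc i)) (X (i - q))"
proof -
  have 1: "(\<lambda>x. slice (Suc i) x q v) \<in> mhom A (T (Suc i)) (X (Suc (i - q)))"
    using slice_hom[of q "Suc i" v] assms by (simp add: Suc_diff_le)
  have 2: "(\<lambda>x. slice (Suc i) x (Suc q) v') \<in> mhom A (T (Suc i)) (X (i - q))" if "v' \<in> Sg (Suc q)" for v'
    using slice_hom[of "Suc q" "Suc i" v'] assms that by simp
  show ?thesis
    unfolding comp_def act_def using assms
    by (intro F.F.mhom_add F.F.mhom_smult F.F.mhom_finsum T.module_axioms mhom_comp[OF 1 F.d_hom] 2) auto
qed

lemma comp_closed [simp]:
  assumes "x \<in> carrier (T (Suc i))" "q \<le> i" "v \<in> Sg q"
  shows "comp i q v x \<in> carrier (X (i - q))"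
  using mhom_closed[OF comp_hom[OF assms(2,3)] assms(1)] .

lemma bd_closed [simp]: "x \<in> carrier (T (Suc i)) \<Longrightarrow> bd i x \<in> carrier (T i)"
  unfolding bd_def by (intro assemble_closed) simp

lemma slice_bd:
  assumes "x \<in> carrier (T (Suc i))" "q \<le> i" "v \<in> Sg q"
  shows "slice i (bd i x) q v = comp i q v x"
  unfolding bd_def using assms by (intro slice_assemble) simp_all

lemma bd_hom: "bd i \<in> mhom A (T (Suc i)) (T i)"
  unfolding mhom_def
proof (intro CollectI conjI allI impI Pi_I; (elim conjE)?)
  fix x y assume x: "x \<in> carrier (T (Suc i))" and y: "y \<in> carrier (T (Suc i))"
  show "bd i (x \<oplus>\<^bsub>T (Suc i)\<^esub> y) = bd i x \<oplus>\<^bsub>T i\<^esub> bd i y"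
  proof (rule slice_eqI)
    fix q v assume q: "q \<le> i" "v \<in> Sg q"
    have "slice i (bd i x \<oplus>\<^bsub>T i\<^esub> bd i y) q v = slice i (bd i x) q v \<oplus>\<^bsub>X (i - q)\<^esub> slice i (bd i y) q v"
      using LinearCombinations.module_hom_add[OF slice_hom[OF q]] x y by simp
    then show "slice i (bd i (x \<oplus>\<^bsub>T (Suc i)\<^esub> y)) q v = slice i (bd i x \<oplus>\<^bsub>T i\<^esub> bd i y) q v"
      using LinearCombinations.module_hom_add[OF comp_hom[OF q] x y] x y q by (simp add: slice_bd)
  qed (use x y in simp_all)
next
  fix a x assume a: "a \<in> carrier A" and x: "x \<in> carrier (T (Suc i))"
  show "bd i (a \<odot>\<^bsub>T (Suc i)\<^esub> x) = a \<odot>\<^bsub>T i\<^esub> bd i x"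
  proof (rule slice_eqI)
    fix q v assume q: "q \<le> i" "v \<in> Sg q"
    have "slice i (a \<odot>\<^bsub>T i\<^esub> bd i x) q v = a \<odot>\<^bsub>X (i - q)\<^esub> slice i (bd i x) q v"
      using module_hom_smult[OF slice_hom[OF q]] a x by simp
    then show "slice i (bd i (a \<odot>\<^bsub>T (Suc i)\<^esub> x)) q v = slice i (a \<odot>\<^bsub>T i\<^esub> bd i x) q v"
      using module_hom_smult[OF comp_hom[OF q] a x] a x q by (simp add: slice_bd)
  qed (use a x in simp_all)
qed simp

lemma aug_family_closed: "x \<in> carrier (T 0) \<Longrightarrow> aug_family x \<in> carrier (G.F 0)"
  unfolding aug_family_def using mhom_closed[OF F.aug_hom] slice_closed[of x 0 0]
  by (auto simp: G.L.free_carrier_finite[OF fin_g])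

lemma aug_hom: "aug \<in> mhom A (T 0) (restrict_scalars \<rho> N)"
  unfolding mhom_def
proof (intro CollectI conjI allI impI Pi_I; (elim conjE)?)
  fix x assume "x \<in> carrier (T 0)"
  then show "aug x \<in> carrier (restrict_scalars \<rho> N)"
    unfolding aug_def using aug_family_closed by simp
next
  fix x y assume x: "x \<in> carrier (T 0)" and y: "y \<in> carrier (T 0)"
  have "aug_family (x \<oplus>\<^bsub>T 0\<^esub> y) = aug_family x \<oplus>\<^bsub>G.F 0\<^esub> aug_family y"
  proof (rule G.L.free_eqI[of _ "Sg 0"])
    fix v assume v: "v \<in> Sg 0"
    show "aug_family (x \<oplus>\<^bsub>T 0\<^esub> y) v = (aug_family x \<oplus>\<^bsub>G.F 0\<^esub> aug_family y) v"
      using v x y LinearCombinations.module_hom_add[OF slice_hom[of 0 0 v] x y] slice_closed[of x 0 0 v] slice_closed[of y 0 0 v]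
      by (simp add: aug_family_def)
  qed (use x y aug_family_closed in simp_all)
  then show "aug (x \<oplus>\<^bsub>T 0\<^esub> y) = aug x \<oplus>\<^bsub>restrict_scalars \<rho> N\<^esub> aug y"
    unfolding aug_def using aug_family_closed x y by simp
next
  fix a x assume a: "a \<in> carrier A" and x: "x \<in> carrier (T 0)"
  have "aug_family (a \<odot>\<^bsub>T 0\<^esub> x) = \<rho> a \<odot>\<^bsub>G.F 0\<^esub> aug_family x"
  proof (rule G.L.free_eqI[of _ "Sg 0"])
    fix v assume v: "v \<in> Sg 0"
    show "aug_family (a \<odot>\<^bsub>T 0\<^esub> x) v = (\<rho> a \<odot>\<^bsub>G.F 0\<^esub> aug_family x) v"
      using v a x module_hom_smult[OF slice_hom[of 0 0 v] a x] slice_closed[of x 0 0 v]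
      by (simp add: aug_family_def)
  qed (use a x aug_family_closed in simp_all)
  then show "aug (a \<odot>\<^bsub>T 0\<^esub> x) = a \<odot>\<^bsub>restrict_scalars \<rho> N\<^esub> aug x"
    unfolding aug_def using aug_family_closed a x by simp
qed

text \<open>The augmentation of F induces a map of complexes from F 0 \<otimes> G to R \<otimes> G =
  G.\<close>

lemma aug_act:
  assumes y: "\<And>v'. v' \<in> Sg (Suc q) \<Longrightarrow> y v' \<in> carrier (X 0)" and v: "v \<in> Sg q"
  shows "\<epsilon>f (act (X 0) q y v) = dg q (\<lambda>v'\<in>Sg (Suc q). \<epsilon>f (y v')) v"
proof -
  have c: "\<epsilon>f (y v') \<in> carrier R" if "v' \<in> Sg (Suc q)" for v' using F.aug.f_im[OF y[OF that]] by simp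
  then have w: "(\<lambda>v'\<in>Sg (Suc q). \<epsilon>f (y v')) \<in> carrier (G.F (Suc q))"
    by (auto simp: G.L.free_carrier_finite[OF fin_g])
  have "\<epsilon>f (act (X 0) q y v) = act base q (\<lambda>v'. \<epsilon>f (y v')) v"
    by (rule act_hom[OF X_module F.L.module_axioms F.aug_hom y v])
  also have "\<dots> = act base q (\<lambda>v'\<in>Sg (Suc q). \<epsilon>f (y v')) v"
    using c v by (intro act_cong[OF F.L.module_axioms]) auto
  finally show ?thesis using act_base[OF w v] by simp
qed

lemma df_act:
  assumes y: "\<And>v'. v' \<in> Sg (Suc q) \<Longrightarrow> y v' \<in> carrier (X (Suc p))" and v: "v \<in> Sg q"
  shows "df p (act (X (Suc p)) q y v) = act (X p) q (\<lambda>v'. df p (y v')) v"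
  by (rule act_hom[OF X_module X_module F.d_hom y v])

lemma bd_bd:
  assumes x: "x \<in> carrier (T (Suc (Suc i)))"
  shows "bd i (bd (Suc i) x) = \<zero>\<^bsub>T i\<^esub>"
proof (rule slice_eqI)
  fix q v assume q: "q \<le> i" "v \<in> Sg q"
  let ?x = "\<lambda>q v. slice (Suc (Suc i)) x q v" and ?p = "i - q"
  have q': "Suc i - q = Suc ?p" using q by (simp add: Suc_diff_le)
  have x0: "?x q v \<in> carrier (X (Suc (Suc ?p)))" using slice_closed_Suc[OF x, of q v] q q' by simp
  have x1: "?x (Suc q) v' \<in> carrier (X (Suc ?p))" if "v' \<in> Sg (Suc q)" for v'
    using slice_Suc_closed[OF x, of q v'] q that q' by simp
  have x2: "?x (Suc (Suc q)) v' \<in> carrier (X ?p)" if "v' \<in> Sg (Suc (Suc q))" for v'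
    using slice_Suc_closed[OF x, of "Suc q" v'] q that by simp
  have a1: "act (X (Suc ?p)) q (?x (Suc q)) v \<in> carrier (X (Suc ?p))"
    by (rule act_closed[OF X_module x1 q(2)])
  have ad: "act (X ?p) q (\<lambda>v'. df ?p (?x (Suc q) v')) v \<in> carrier (X ?p)"
    using x1 by (intro act_closed[OF X_module _ q(2)]) simp
  have a2: "act (X ?p) (Suc q) (?x (Suc (Suc q))) v' \<in> carrier (X ?p)" if "v' \<in> Sg (Suc q)" for v'
    by (rule act_closed[OF X_module x2 that])
  have s0: "slice (Suc i) (bd (Suc i) x) q v =
      sgn q \<odot>\<^bsub>X (Suc ?p)\<^esub> df (Suc ?p) (?x q v) \<oplus>\<^bsub>X (Suc ?p)\<^esub> act (X (Suc ?p)) q (?x (Suc q)) v"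
    using slice_bd[OF x, of q v] q q' by (simp add: comp_def)
  have s1: "slice (Suc i) (bd (Suc i) x) (Suc q) v' =
      sgn (Suc q) \<odot>\<^bsub>X ?p\<^esub> df ?p (?x (Suc q) v') \<oplus>\<^bsub>X ?p\<^esub> act (X ?p) (Suc q) (?x (Suc (Suc q))) v'"
    if "v' \<in> Sg (Suc q)" for v'
    using slice_bd[OF x, of "Suc q" v'] q that by (simp add: comp_def)
  have "df ?p (slice (Suc i) (bd (Suc i) x) q v) = act (X ?p) q (\<lambda>v'. df ?p (?x (Suc q) v')) v"
    unfolding s0 using x0 a1 ad F.d_d[OF x0] df_act[OF x1 q(2)] by simp
  moreover have "act (X ?p) q (slice (Suc i) (bd (Suc i) x) (Suc q)) v =
      sgn (Suc q) \<odot>\<^bsub>X ?p\<^esub> act (X ?p) q (\<lambda>v'. df ?p (?x (Suc q) v')) v"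
  proof -
    have "act (X ?p) q (slice (Suc i) (bd (Suc i) x) (Suc q)) v =
      act (X ?p) q (\<lambda>v'. sgn (Suc q) \<odot>\<^bsub>X ?p\<^esub> df ?p (?x (Suc q) v') \<oplus>\<^bsub>X ?p\<^esub> act (X ?p) (Suc q) (?x (Suc (Suc q))) v') v"
      using s1 x1 a2 q(2) by (intro act_cong[OF X_module]) simp_all
    also have "\<dots> = act (X ?p) q (\<lambda>v'. sgn (Suc q) \<odot>\<^bsub>X ?p\<^esub> df ?p (?x (Suc q) v')) v
        \<oplus>\<^bsub>X ?p\<^esub> act (X ?p) q (act (X ?p) (Suc q) (?x (Suc (Suc q)))) v"
      using x1 a2 q(2) by (intro act_add[OF X_module]) simp_all
    also have "act (X ?p) q (act (X ?p) (Suc q) (?x (Suc (Suc q)))) v = \<zero>\<^bsub>X ?p\<^esub>"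
      by (rule act_act[OF X_module x2 q(2)])
    also have "act (X ?p) q (\<lambda>v'. sgn (Suc q) \<odot>\<^bsub>X ?p\<^esub> df ?p (?x (Suc q) v')) v =
        sgn (Suc q) \<odot>\<^bsub>X ?p\<^esub> act (X ?p) q (\<lambda>v'. df ?p (?x (Suc q) v')) v"
      using x1 q(2) by (intro act_smult[OF X_module]) simp_all
    finally show ?thesis using ad by simp
  qed
  \<comment> \<open>Only the two mixed terms are left; they carry the signs of \<open>q\<close> and
    \<open>Suc q\<close>, which are opposite.\<close>
  ultimately have "slice i (bd i (bd (Suc i) x)) q v = \<zero>\<^bsub>X ?p\<^esub>"
    using slice_bd[of "bd (Suc i) x" i q v] x q ad by (simp add: comp_def sgn_Suc F.F.M.r_neg)
  also have "\<dots> = slice i \<zero>\<^bsub>T i\<^esub> q v"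
    using q by (auto simp: slice_def F.L.free_zero)
  finally show "slice i (bd i (bd (Suc i) x)) q v = slice i \<zero>\<^bsub>T i\<^esub> q v" .
qed (use x in simp_all)

text \<open>The part of the boundary coming from F dies under \<open>\<epsilon>f\<close>. What
  remains is a boundary in G, so \<open>\<epsilon>g\<close> kills it.\<close>

lemma aug_family_bd:
  assumes x: "x \<in> carrier (T (Suc 0))"
  shows "aug_family (bd 0 x) = dg 0 (\<lambda>v\<in>Sg (Suc 0). \<epsilon>f (slice (Suc 0) x (Suc 0) v))"
    and "(\<lambda>v\<in>Sg (Suc 0). \<epsilon>f (slice (Suc 0) x (Suc 0) v)) \<in> carrier (G.F (Suc 0))"
proof -
  have x1: "slice (Suc 0) x (Suc 0) v' \<in> carrier (X 0)" if "v' \<in> Sg (Suc 0)" for v'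
    using slice_Suc_closed[OF x, of 0 v'] that by simp
  then have "\<epsilon>f (slice (Suc 0) x (Suc 0) v') \<in> carrier R" if "v' \<in> Sg (Suc 0)" for v'
    using F.aug.f_im[OF x1[OF that]] by simp
  then show w: "(\<lambda>v\<in>Sg (Suc 0). \<epsilon>f (slice (Suc 0) x (Suc 0) v)) \<in> carrier (G.F (Suc 0))"
    by (auto simp: G.L.free_carrier_finite[OF fin_g])
  show "aug_family (bd 0 x) = dg 0 (\<lambda>v\<in>Sg (Suc 0). \<epsilon>f (slice (Suc 0) x (Suc 0) v))"
  proof (rule G.L.free_eqI[of _ "Sg 0"])
    fix v assume v: "v \<in> Sg 0"
    have x0: "slice (Suc 0) x 0 v \<in> carrier (X (Suc 0))" using slice_closed_Suc[OF x, of 0 v] v by simp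
    have a: "act (X 0) 0 (slice (Suc 0) x (Suc 0)) v \<in> carrier (X 0)" by (rule act_closed[OF X_module x1 v])
    have "aug_family (bd 0 x) v = \<epsilon>f (comp 0 0 v x)"
      unfolding aug_family_def using slice_bd[OF x, of 0 v] v by simp
    also have "\<dots> = \<epsilon>f (act (X 0) 0 (slice (Suc 0) x (Suc 0)) v)"
      unfolding comp_def using x0 a F.aug_d[OF x0] F.aug.f_im[OF a] by simp
    also have "\<dots> = dg 0 (\<lambda>v\<in>Sg (Suc 0). \<epsilon>f (slice (Suc 0) x (Suc 0) v)) v"
      by (rule aug_act[OF x1 v])
    finally show "aug_family (bd 0 x) v = dg 0 (\<lambda>v\<in>Sg (Suc 0). \<epsilon>f (slice (Suc 0) x (Suc 0) v)) v" .
  qed (use x w aug_family_closed in simp_all)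
qed

end

section \<open>Exactness and minimality of F \<otimes> G\<close>

context algebra_retract
begin

text \<open>The equation that makes the component \<open>x\<close> in degree \<open>q\<close> a boundary.\<close>

abbreviation solves :: "nat \<Rightarrow> nat \<Rightarrow> ('t \<Rightarrow> 's \<Rightarrow> 'a) \<Rightarrow> ('t \<Rightarrow> 's \<Rightarrow> 'a) \<Rightarrow> ('t \<Rightarrow> 's \<Rightarrow> 'a) \<Rightarrow> bool"
  where "solves p q x z y \<equiv> \<forall>v\<in>Sg q. x v = sgn q \<odot>\<^bsub>X p\<^esub> df p (z v) \<oplus>\<^bsub>X p\<^esub> act (X p) q y v"

lemma solve_step:
  assumes x: "\<And>v. v \<in> Sg q \<Longrightarrow> x v \<in> carrier (X p)"
    and y: "\<And>v'. v' \<in> Sg (Suc q) \<Longrightarrow> y v' \<in> carrier (X p)"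
    and lift: "\<And>v. v \<in> Sg q \<Longrightarrow> x v \<ominus>\<^bsub>X p\<^esub> act (X p) q y v \<in> df p ` carrier (X (Suc p))"
  shows "\<exists>z. (\<forall>v\<in>Sg q. z v \<in> carrier (X (Suc p))) \<and> solves p q x z y"
proof -
  have "\<forall>v\<in>Sg q. \<exists>w. w \<in> carrier (X (Suc p)) \<and> x v \<ominus>\<^bsub>X p\<^esub> act (X p) q y v = df p w"
    using lift by blast
  then obtain w where w: "\<And>v. v \<in> Sg q \<Longrightarrow> w v \<in> carrier (X (Suc p))"
    "\<And>v. v \<in> Sg q \<Longrightarrow> x v \<ominus>\<^bsub>X p\<^esub> act (X p) q y v = df p (w v)" by metis
  \<comment> \<open>The preimage \<open>w\<close> is multiplied by \<open>sgn q\<close> to undo the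
    sign in \<open>solves\<close>, since the square of the sign is one.\<close>
  have "x v = sgn q \<odot>\<^bsub>X p\<^esub> df p (sgn q \<odot>\<^bsub>X (Suc p)\<^esub> w v) \<oplus>\<^bsub>X p\<^esub> act (X p) q y v" if v: "v \<in> Sg q" for v
  proof -
    have a: "act (X p) q y v \<in> carrier (X p)" by (rule act_closed[OF X_module y v])
    have "sgn q \<odot>\<^bsub>X p\<^esub> df p (sgn q \<odot>\<^bsub>X (Suc p)\<^esub> w v) = x v \<ominus>\<^bsub>X p\<^esub> act (X p) q y v"
      unfolding w(2)[OF v] using w(1)[OF v] by simp
    then show ?thesis using F.F.M.add_diff_self[OF a x[OF v]] a x[OF v] by (simp add: F.F.M.a_comm)
  qed
  then show ?thesis using w(1) by (intro exI[of _ "\<lambda>v. sgn q \<odot>\<^bsub>X (Suc p)\<^esub> w v"]) simp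
qed

text \<open>The start of the descent, in F 0 \<otimes> G q. Lifting \<open>w\<close> through
  \<open>\<epsilon>f\<close> gives \<open>y\<close>; then \<open>x\<close> minus the action on
  \<open>y\<close> has augmentation zero and is in the image of \<open>df 0\<close>.\<close>

lemma solve_base:
  assumes x: "\<And>v. v \<in> Sg q \<Longrightarrow> x v \<in> carrier (X 0)"
    and w: "w \<in> carrier (G.F (Suc q))" "\<And>v. v \<in> Sg q \<Longrightarrow> \<epsilon>f (x v) = dg q w v"
  shows "\<exists>y z. (\<forall>v\<in>Sg (Suc q). y v \<in> carrier (X 0)) \<and> (\<forall>v\<in>Sg q. z v \<in> carrier (X (Suc 0))) \<and> solves 0 q x z y"
proof -
  have "\<exists>y. y \<in> carrier (X 0) \<and> \<epsilon>f y = w v'" if "v' \<in> Sg (Suc q)" for v'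
  proof -
    have "w v' \<in> \<epsilon>f ` carrier (X 0)" unfolding F.aug_surj using G.L.free_coord[OF w(1) that] by simp
    then show ?thesis by auto
  qed
  then have "\<forall>v'\<in>Sg (Suc q). \<exists>y. y \<in> carrier (X 0) \<and> \<epsilon>f y = w v'" ..
  then obtain y where y: "\<And>v'. v' \<in> Sg (Suc q) \<Longrightarrow> y v' \<in> carrier (X 0)" "\<And>v'. v' \<in> Sg (Suc q) \<Longrightarrow> \<epsilon>f (y v') = w v'"
    by metis
  have yw: "(\<lambda>v'\<in>Sg (Suc q). \<epsilon>f (y v')) = w"
    using w(1) y(2) by (auto simp: G.L.free_carrier_finite[OF fin_g] intro!: ext)
  have "x v \<ominus>\<^bsub>X 0\<^esub> act (X 0) q y v \<in> df 0 ` carrier (X (Suc 0))" if v: "v \<in> Sg q" for v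
  proof -
    have a: "act (X 0) q y v \<in> carrier (X 0)" by (rule act_closed[OF X_module y(1) v])
    have "\<epsilon>f (act (X 0) q y v) = dg q (\<lambda>v'\<in>Sg (Suc q). \<epsilon>f (y v')) v" by (rule aug_act[OF y(1) v])
    then have eq: "\<epsilon>f (x v) = \<epsilon>f (act (X 0) q y v)" unfolding w(2)[OF v] yw by simp
    have "\<epsilon>f (x v \<ominus>\<^bsub>X 0\<^esub> act (X 0) q y v) = \<zero>\<^bsub>base\<^esub>"
      unfolding F.aug.f_minus[OF x[OF v] a] eq F.L.M.minus_eq by (rule F.L.M.r_neg[OF F.aug.f_im[OF a]])
    then show ?thesis unfolding F.exact_0 using a x[OF v] by simp
  qed
  then obtain z where "(\<forall>v\<in>Sg q. z v \<in> carrier (X (Suc 0))) \<and> solves 0 q x z y"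
    using solve_step[of q x 0 y] x y(1) by blast
  then show ?thesis using y(1) by blast
qed

lemma bd_zero_slice:
  assumes x: "x \<in> carrier (T (Suc i))" "bd i x = \<zero>\<^bsub>T i\<^esub>" and q: "q \<le> i" "v \<in> Sg q"
  shows "comp i q v x = \<zero>\<^bsub>X (i - q)\<^esub>"
proof -
  have "comp i q v x = slice i \<zero>\<^bsub>T i\<^esub> q v" using slice_bd[OF x(1) q] x(2) by simp
  then show ?thesis using q by (auto simp: slice_def F.L.free_zero)
qed

lemma bd_surjI:
  assumes x: "x \<in> carrier (T i)"
    and y: "\<And>q v. q \<le> Suc i \<Longrightarrow> v \<in> Sg q \<Longrightarrow> y q v \<in> carrier (X (Suc i - q))"
    and eq: "\<And>q. q \<le> i \<Longrightarrow> solves (i - q) q (slice i x q) (y q) (y (Suc q))"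
  shows "\<exists>z\<in>carrier (T (Suc i)). x = bd i z"
proof
  let ?z = "assemble (Suc i) y"
  show z: "?z \<in> carrier (T (Suc i))" by (rule assemble_closed) (rule y)
  show "x = bd i ?z"
  proof (rule slice_eqI[OF x bd_closed[OF z]])
    fix q v assume q: "q \<le> i" "v \<in> Sg q"
    have s: "slice (Suc i) ?z r w = y r w" if "r \<le> Suc i" "w \<in> Sg r" for r w
      by (rule slice_assemble[OF y that])
    have y1: "y (Suc q) v' \<in> carrier (X (i - q))" if "v' \<in> Sg (Suc q)" for v'
      using y[of "Suc q" v'] q that by simp
    have "act (X (i - q)) q (slice (Suc i) ?z (Suc q)) v = act (X (i - q)) q (y (Suc q)) v"
      using s q y1 by (intro act_cong[OF X_module]) auto
    then show "slice i x q v = slice i (bd i ?z) q v"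
      unfolding slice_bd[OF z q] comp_def using s[of q v] q eq[OF q(1)] by simp
  qed
qed

text \<open>A boundary is found by descending induction on \<open>q\<close>, using the exactness of the rows \<open>F \<otimes> G q\<close>.\<close>

lemma solve_down:
  assumes x: "x \<in> carrier (T i)" and cycle: "\<And>j. i = Suc j \<Longrightarrow> bd j x = \<zero>\<^bsub>T j\<^esub>"
    and w: "w \<in> carrier (G.F (Suc i))" "\<And>v. v \<in> Sg i \<Longrightarrow> \<epsilon>f (slice i x i v) = dg i w v"
  shows "\<exists>z\<in>carrier (T (Suc i)). x = bd i z"
proof -
  \<comment> \<open>The equation in degree \<open>q\<close> involves the components \<open>q\<close>
    and \<open>Suc q\<close> of the preimage. Once those above \<open>q\<close> are known, it has a
    single unknown.\<close>
  let ?P = "\<lambda>k. \<exists>y. (\<forall>q. k \<le> q \<and> q \<le> Suc i \<longrightarrow> (\<forall>v\<in>Sg q. y q v \<in> carrier (X (Suc i - q)))) \<and>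
    (\<forall>q. k \<le> q \<and> q \<le> i \<longrightarrow> solves (i - q) q (slice i x q) (y q) (y (Suc q)))"
  have "?P 0"
  proof (rule inc_induct[of 0 i ?P])
    have x0: "slice i x i v \<in> carrier (X 0)" if "v \<in> Sg i" for v using slice_closed[OF x, of i v] that by simp
    obtain y z where yz: "\<forall>v\<in>Sg (Suc i). y v \<in> carrier (X 0)" "\<forall>v\<in>Sg i. z v \<in> carrier (X (Suc 0))"
      "solves 0 i (slice i x i) z y"
      using solve_base[of i "slice i x i" w] x0 w by blast
    show "?P i"
    proof (intro exI[of _ "\<lambda>q. if q = i then z else y"] conjI allI impI)
      fix q assume "i \<le> q \<and> q \<le> Suc i"
      then have "q = i \<or> q = Suc i" by auto
      then show "\<forall>v\<in>Sg q. (if q = i then z else y) v \<in> carrier (X (Suc i - q))" using yz by auto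
    next
      fix q assume "i \<le> q \<and> q \<le> i"
      then have "q = i" by simp
      then show "solves (i - q) q (slice i x q) (if q = i then z else y) (if Suc q = i then z else y)" using yz by simp
    qed
  next
    fix q assume q: "q < i" and "?P (Suc q)"
    then obtain y where y: "\<And>r v. Suc q \<le> r \<Longrightarrow> r \<le> Suc i \<Longrightarrow> v \<in> Sg r \<Longrightarrow> y r v \<in> carrier (X (Suc i - r))"
      and eq: "\<And>r. Suc q \<le> r \<Longrightarrow> r \<le> i \<Longrightarrow> solves (i - r) r (slice i x r) (y r) (y (Suc r))" by blast
    obtain j where j: "i = Suc j" using q by (cases i) auto
    let ?p = "j - q"
    have p: "i - q = Suc ?p" "i - Suc q = ?p" "Suc i - Suc q = Suc ?p" "Suc i - Suc (Suc q) = ?p"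
      using q j by (auto simp: Suc_diff_le)
    have xq: "slice i x q v \<in> carrier (X (Suc ?p))" if "v \<in> Sg q" for v using slice_closed[OF x, of q v] q that p by simp
    have y1: "y (Suc q) v' \<in> carrier (X (Suc ?p))" if "v' \<in> Sg (Suc q)" for v' using y[of "Suc q" v'] q that p by simp
    have y2: "y (Suc (Suc q)) v' \<in> carrier (X ?p)" if "v' \<in> Sg (Suc (Suc q))" for v'
      using y[of "Suc (Suc q)" v'] q that p by simp
    have "slice i x q v \<ominus>\<^bsub>X (Suc ?p)\<^esub> act (X (Suc ?p)) q (y (Suc q)) v \<in> df (Suc ?p) ` carrier (X (Suc (Suc ?p)))"
      if v: "v \<in> Sg q" for v
    proof -
      let ?a = "act (X (Suc ?p)) q (y (Suc q)) v" and ?b = "act (X ?p) q (\<lambda>v'. df ?p (y (Suc q) v')) v"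
      have a: "?a \<in> carrier (X (Suc ?p))" by (rule act_closed[OF X_module y1 v])
      have b: "?b \<in> carrier (X ?p)" using y1 by (intro act_closed[OF X_module _ v]) simp
      have a2: "act (X ?p) (Suc q) (y (Suc (Suc q))) v' \<in> carrier (X ?p)" if "v' \<in> Sg (Suc q)" for v'
        by (rule act_closed[OF X_module y2 that])
      \<comment> \<open>\<open>act\<close> is applied to the equation already solved in degree
        \<open>Suc q\<close>, where it removes the component \<open>Suc (Suc q)\<close> because its
        square is zero. Compared with the cycle condition in degree \<open>q\<close>, the result
        says that the slice of \<open>x\<close> and \<open>?a\<close> have the same image under
        \<open>df\<close>, so exactness of F applies.\<close>
      have "act (X ?p) q (slice i x (Suc q)) v =
        act (X ?p) q (\<lambda>v'. sgn (Suc q) \<odot>\<^bsub>X ?p\<^esub> df ?p (y (Suc q) v') \<oplus>\<^bsub>X ?p\<^esub> act (X ?p) (Suc q) (y (Suc (Suc q))) v') v"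
        using eq[of "Suc q"] q p y1 a2 v by (intro act_cong[OF X_module]) simp_all
      also have "\<dots> = act (X ?p) q (\<lambda>v'. sgn (Suc q) \<odot>\<^bsub>X ?p\<^esub> df ?p (y (Suc q) v')) v
          \<oplus>\<^bsub>X ?p\<^esub> act (X ?p) q (act (X ?p) (Suc q) (y (Suc (Suc q)))) v"
        using y1 a2 v by (intro act_add[OF X_module]) simp_all
      also have "act (X ?p) q (act (X ?p) (Suc q) (y (Suc (Suc q)))) v = \<zero>\<^bsub>X ?p\<^esub>"
        by (rule act_act[OF X_module y2 v])
      also have "act (X ?p) q (\<lambda>v'. sgn (Suc q) \<odot>\<^bsub>X ?p\<^esub> df ?p (y (Suc q) v')) v = sgn (Suc q) \<odot>\<^bsub>X ?p\<^esub> ?b"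
        using y1 v by (intro act_smult[OF X_module]) simp_all
      finally have act_x: "act (X ?p) q (slice i x (Suc q)) v = \<ominus>\<^bsub>X ?p\<^esub> (sgn q \<odot>\<^bsub>X ?p\<^esub> ?b)"
        using b by (simp add: sgn_Suc)
      have "q \<le> j" using q j by simp
      have "comp j q v x = \<zero>\<^bsub>X ?p\<^esub>"
        using bd_zero_slice[of x j q v] x cycle[OF j] \<open>q \<le> j\<close> v j by simp
      then have "sgn q \<odot>\<^bsub>X ?p\<^esub> df ?p (slice i x q v) \<ominus>\<^bsub>X ?p\<^esub> sgn q \<odot>\<^bsub>X ?p\<^esub> ?b = \<zero>\<^bsub>X ?p\<^esub>"
        unfolding comp_def j[symmetric] act_x by (simp add: F.F.M.minus_eq)
      then have "sgn q \<odot>\<^bsub>X ?p\<^esub> df ?p (slice i x q v) = sgn q \<odot>\<^bsub>X ?p\<^esub> ?b"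
        using xq[OF v] b by simp
      then have "sgn q \<odot>\<^bsub>X ?p\<^esub> (sgn q \<odot>\<^bsub>X ?p\<^esub> df ?p (slice i x q v)) = sgn q \<odot>\<^bsub>X ?p\<^esub> (sgn q \<odot>\<^bsub>X ?p\<^esub> ?b)"
        by (rule arg_cong)
      then have "df ?p (slice i x q v) = ?b"
        unfolding sgn_sgn[OF F.d.f_im[OF xq[OF v]]] sgn_sgn[OF b] .
      also have "?b = df ?p ?a" by (rule df_act[OF y1 v, symmetric])
      finally have "df ?p (slice i x q v \<ominus>\<^bsub>X (Suc ?p)\<^esub> ?a) = \<zero>\<^bsub>X ?p\<^esub>"
        using xq[OF v] a by simp
      then show ?thesis unfolding F.exact_Suc using xq[OF v] a by simp
    qed
    then obtain z where z: "\<forall>v\<in>Sg q. z v \<in> carrier (X (Suc (Suc ?p)))" "solves (Suc ?p) q (slice i x q) z (y (Suc q))"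
      using solve_step[of q "slice i x q" "Suc ?p" "y (Suc q)"] xq y1 by blast
    have p': "Suc i - q = Suc (Suc ?p)" using q j by (simp add: Suc_diff_le)
    show "?P q"
    proof (intro exI[of _ "y(q := z)"] conjI allI impI)
      fix r assume "q \<le> r \<and> r \<le> Suc i"
      then consider "r = q" | "Suc q \<le> r" "r \<le> Suc i" by linarith
      then show "\<forall>v\<in>Sg r. (y(q := z)) r v \<in> carrier (X (Suc i - r))"
        by cases (use z(1) p' y in auto)
    next
      fix r assume "q \<le> r \<and> r \<le> i"
      then consider "r = q" | "Suc q \<le> r" "r \<le> i" by linarith
      then show "solves (i - r) r (slice i x r) ((y(q := z)) r) ((y(q := z)) (Suc r))"
        by cases (use z(2) p(1) eq in auto)
    qed
  qed simp
  then obtain y where "\<forall>q. 0 \<le> q \<and> q \<le> Suc i \<longrightarrow> (\<forall>v\<in>Sg q. y q v \<in> carrier (X (Suc i - q)))"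
    "\<forall>q. 0 \<le> q \<and> q \<le> i \<longrightarrow> solves (i - q) q (slice i x q) (y q) (y (Suc q))" by (elim exE conjE)
  then show ?thesis by (intro bd_surjI[OF x, of y]) simp_all
qed

text \<open>Exactness rests on the component in F 0 \<otimes> G i: under \<open>\<epsilon>f\<close>
  it becomes a cycle of G, hence a boundary \<open>dg\<close> of some \<open>w\<close>, and this
  \<open>w\<close> is the input that \<open>solve_down\<close> needs.\<close>

theorem total_resolution: "free_res A (restrict_scalars \<rho> N) idx aug bd"
proof -
  have mod: "Module.module A (restrict_scalars \<rho> N)"
    by (rule restrict_scalars_module[OF F.L.is_cring \<rho> G.L.module_axioms])
  have slice0: "slice 0 x 0 v \<in> carrier (X 0)" if "x \<in> carrier (T 0)" "v \<in> Sg 0" for x v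
    using slice_closed[OF that(1), of 0 v] that by simp
  have surj: "aug ` carrier (T 0) = carrier (restrict_scalars \<rho> N)"
  proof
    show "aug ` carrier (T 0) \<subseteq> carrier (restrict_scalars \<rho> N)" using mhom_closed[OF aug_hom] by blast
    show "carrier (restrict_scalars \<rho> N) \<subseteq> aug ` carrier (T 0)"
    proof
      fix n assume "n \<in> carrier (restrict_scalars \<rho> N)"
      then have "n \<in> \<epsilon>g ` carrier (G.F 0)" using G.aug_surj by simp
      then obtain w where w: "w \<in> carrier (G.F 0)" "n = \<epsilon>g w" by blast
      have "\<forall>v\<in>Sg 0. \<exists>y. y \<in> carrier (X 0) \<and> \<epsilon>f y = w v"
      proof
        fix v assume "v \<in> Sg 0"
        then have "w v \<in> \<epsilon>f ` carrier (X 0)" unfolding F.aug_surj using G.L.free_coord[OF w(1)] by simp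
        then show "\<exists>y. y \<in> carrier (X 0) \<and> \<epsilon>f y = w v" by auto
      qed
      then obtain y where y: "\<And>v. v \<in> Sg 0 \<Longrightarrow> y v \<in> carrier (X 0)" "\<And>v. v \<in> Sg 0 \<Longrightarrow> \<epsilon>f (y v) = w v" by metis
      let ?x = "assemble 0 (\<lambda>q. y)"
      have x: "?x \<in> carrier (T 0)" by (rule assemble_closed) (use y in simp)
      have "slice 0 ?x 0 v = y v" if "v \<in> Sg 0" for v
        by (rule slice_assemble) (use y that in simp_all)
      then have "aug_family ?x = w"
        using w(1) y(2) by (auto simp: aug_family_def G.L.free_carrier_finite[OF fin_g] intro!: ext)
      then have "n = aug ?x" using w by (simp add: aug_def)
      with x show "n \<in> aug ` carrier (T 0)" by blast
    qed
  qed
  have ex0: "bd 0 ` carrier (T 1) = {x \<in> carrier (T 0). aug x = \<zero>\<^bsub>restrict_scalars \<rho> N\<^esub>}"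
  proof
    show "bd 0 ` carrier (T 1) \<subseteq> {x \<in> carrier (T 0). aug x = \<zero>\<^bsub>restrict_scalars \<rho> N\<^esub>}"
      using aug_family_bd G.aug_d by (auto simp: aug_def)
    show "{x \<in> carrier (T 0). aug x = \<zero>\<^bsub>restrict_scalars \<rho> N\<^esub>} \<subseteq> bd 0 ` carrier (T 1)"
    proof clarify
      fix x assume x: "x \<in> carrier (T 0)" "aug x = \<zero>\<^bsub>restrict_scalars \<rho> N\<^esub>"
      then obtain w where w: "w \<in> carrier (G.F (Suc 0))" "aug_family x = dg 0 w"
        using G.exact_0E[of "aug_family x"] aug_family_closed by (auto simp: aug_def)
      have "\<exists>z\<in>carrier (T (Suc 0)). x = bd 0 z"
      proof (rule solve_down[OF x(1) _ w(1)])
        fix v assume "v \<in> Sg 0"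
        then show "\<epsilon>f (slice 0 x 0 v) = dg 0 w v" using fun_cong[OF w(2), of v] by (simp add: aug_family_def)
      qed simp
      then show "x \<in> bd 0 ` carrier (T 1)" by auto
    qed
  qed
  have exS: "bd (Suc i) ` carrier (T (Suc (Suc i))) = {x \<in> carrier (T (Suc i)). bd i x = \<zero>\<^bsub>T i\<^esub>}" for i
  proof
    show "bd (Suc i) ` carrier (T (Suc (Suc i))) \<subseteq> {x \<in> carrier (T (Suc i)). bd i x = \<zero>\<^bsub>T i\<^esub>}"
      using bd_bd by auto
    show "{x \<in> carrier (T (Suc i)). bd i x = \<zero>\<^bsub>T i\<^esub>} \<subseteq> bd (Suc i) ` carrier (T (Suc (Suc i)))"
    proof clarify
      fix x assume x: "x \<in> carrier (T (Suc i))" "bd i x = \<zero>\<^bsub>T i\<^esub>"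
      let ?x = "slice (Suc i) x (Suc i)"
      have x0: "?x v \<in> carrier (X 0)" if "v \<in> Sg (Suc i)" for v using slice_Suc_closed[OF x(1), of i v] that by simp
      let ?e = "\<lambda>v\<in>Sg (Suc i). \<epsilon>f (?x v)"
      have "\<epsilon>f (?x v) \<in> carrier R" if "v \<in> Sg (Suc i)" for v using F.aug.f_im[OF x0[OF that]] by simp
      then have e: "?e \<in> carrier (G.F (Suc i))" by (auto simp: G.L.free_carrier_finite[OF fin_g])
      \<comment> \<open>The cycle condition in G-degree \<open>i\<close> is projected by
        \<open>\<epsilon>f\<close>: its term with \<open>df\<close> vanishes and the other one
        becomes \<open>dg i ?e\<close>.\<close>
      have "dg i ?e = \<zero>\<^bsub>G.F i\<^esub>"
      proof (rule G.L.free_eqI[of _ "Sg i"])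
        fix v assume v: "v \<in> Sg i"
        have y: "slice (Suc i) x i v \<in> carrier (X (Suc 0))" using slice_closed_Suc[OF x(1), of i v] v by simp
        have a: "act (X 0) i ?x v \<in> carrier (X 0)" by (rule act_closed[OF X_module x0 v])
        have "dg i ?e v = \<epsilon>f (act (X 0) i ?x v)" by (rule aug_act[OF x0 v, symmetric])
        also have "\<dots> = \<epsilon>f (comp i i v x)"
          unfolding comp_def using y a F.aug_d[OF y] F.aug.f_im[OF a] by simp
        also have "comp i i v x = \<zero>\<^bsub>X 0\<^esub>" using bd_zero_slice[OF x, of i v] v by simp
        also have "\<epsilon>f \<zero>\<^bsub>X 0\<^esub> = \<zero>\<^bsub>R\<^esub>" using F.aug.f0_is_0 by simp
        finally show "dg i ?e v = \<zero>\<^bsub>G.F i\<^esub> v" unfolding G.L.free_apply(2)[OF v] .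
      qed (use e in simp_all)
      then obtain w where w: "w \<in> carrier (G.F (Suc (Suc i)))" "?e = dg (Suc i) w"
        using G.exact_SucE[OF e] by blast
      have "\<exists>z\<in>carrier (T (Suc (Suc i))). x = bd (Suc i) z"
      proof (rule solve_down[OF x(1) _ w(1)])
        show "bd j x = \<zero>\<^bsub>T j\<^esub>" if "Suc i = Suc j" for j using x(2) that by simp
        fix v assume "v \<in> Sg (Suc i)"
        then show "\<epsilon>f (?x v) = dg (Suc i) w v" using fun_cong[OF w(2), of v] by simp
      qed
      then show "x \<in> bd (Suc i) ` carrier (T (Suc (Suc i)))" by auto
    qed
  qed
  have "resolution A (restrict_scalars \<rho> N) idx aug bd"
    unfolding resolution_def Let_def using aug_hom bd_hom surj ex0 exS by simp
  with mod show ?thesis by (simp add: free_res_def free_res_axioms_def)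
qed

text \<open>A coordinate of \<open>bd\<close> is, up to sign, one of a differential of F plus a
  combination of matrix entries of \<open>dg\<close> moved to A by \<open>\<iota>\<close>; both lie
  in the maximal ideal of A.\<close>

lemma total_minimal:
  assumes A: "local_ring A" and R: "local_ring R"
    and \<iota>m: "\<And>r. r \<in> max_ideal R \<Longrightarrow> \<iota> r \<in> max_ideal A"
    and f: "\<And>i x s. x \<in> carrier (X (Suc i)) \<Longrightarrow> s \<in> Sf i \<Longrightarrow> df i x s \<in> max_ideal A"
    and g: "\<And>i x s. x \<in> carrier (G.F (Suc i)) \<Longrightarrow> s \<in> Sg i \<Longrightarrow> dg i x s \<in> max_ideal R"
  shows "local_ring.minimal_resolution A (restrict_scalars \<rho> N) idx aug bd"
proof -
  interpret A: local_ring A by (rule A)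
  have "bd i x p \<in> max_ideal A" if x: "x \<in> carrier (T (Suc i))" and p: "p \<in> idx i" for i x p
  proof -
    obtain q v u where q: "p = (q, v, u)" "q \<le> i" "v \<in> Sg q" "u \<in> Sf (i - q)" using p by (cases p) auto
    let ?p = "i - q"
    have x0: "slice (Suc i) x q v \<in> carrier (X (Suc ?p))" by (rule slice_closed_Suc[OF x q(2,3)])
    have x1: "slice (Suc i) x (Suc q) v' \<in> carrier (X ?p)" if "v' \<in> Sg (Suc q)" for v'
      by (rule slice_Suc_closed[OF x q(2) that])
    have "act (X ?p) q (slice (Suc i) x (Suc q)) v u =
      (\<Oplus>\<^bsub>A\<^esub>v'\<in>Sg (Suc q). (\<iota> (entry q v v') \<odot>\<^bsub>X ?p\<^esub> slice (Suc i) x (Suc q) v') u)"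
      unfolding act_def using x1 q by (intro F.L.free_finsum_apply) auto
    also have "\<dots> \<in> max_ideal A"
    proof (rule A.max_ideal_finsum)
      fix v' assume v': "v' \<in> Sg (Suc q)"
      have "entry q v v' \<in> max_ideal R" unfolding entry_def using v' q by (intro g) simp_all
      then show "(\<iota> (entry q v v') \<odot>\<^bsub>X ?p\<^esub> slice (Suc i) x (Suc q) v') u \<in> max_ideal A"
        using q F.L.free_coord[OF x1[OF v'] q(4)] \<iota>m by (simp add: A.mm.I_r_closed)
    qed
    finally have act: "act (X ?p) q (slice (Suc i) x (Suc q)) v u \<in> max_ideal A" .
    have "comp i q v x u = sgn q \<otimes>\<^bsub>A\<^esub> df ?p (slice (Suc i) x q v) u \<oplus>\<^bsub>A\<^esub> act (X ?p) q (slice (Suc i) x (Suc q)) v u"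
      unfolding comp_def using q by simp
    also have "\<dots> \<in> max_ideal A"
      using act f[OF x0 q(4)] by (intro A.mm.a_closed A.mm.I_l_closed) simp_all
    finally have "comp i q v x u \<in> max_ideal A" .
    moreover have "bd i x p = comp i q v x u"
      using fun_cong[OF slice_bd[OF x q(2,3)], of u] q by (simp add: slice_def)
    ultimately show ?thesis by simp
  qed
  then show ?thesis
    unfolding A.minimal_resolution_def using total_resolution finite_idx by blast
qed

end

section \<open>The idealization\<close>

lemma idealization_simps [simp]:
  "carrier (R \<ltimes> M) = carrier R \<times> carrier M"
  "x \<otimes>\<^bsub>R \<ltimes> M\<^esub> y = (fst x \<otimes>\<^bsub>R\<^esub> fst y, fst x \<odot>\<^bsub>M\<^esub> snd y \<oplus>\<^bsub>M\<^esub> fst y \<odot>\<^bsub>M\<^esub> snd x)"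
  "\<one>\<^bsub>R \<ltimes> M\<^esub> = (\<one>\<^bsub>R\<^esub>, \<zero>\<^bsub>M\<^esub>)" "\<zero>\<^bsub>R \<ltimes> M\<^esub> = (\<zero>\<^bsub>R\<^esub>, \<zero>\<^bsub>M\<^esub>)"
  "x \<oplus>\<^bsub>R \<ltimes> M\<^esub> y = (fst x \<oplus>\<^bsub>R\<^esub> fst y, snd x \<oplus>\<^bsub>M\<^esub> snd y)"
  by (simp_all add: idealization_def split_beta)

context Module.module
begin

lemma idealization_cring: "cring (R \<ltimes> M)"
proof (rule cringI)
  show "abelian_group (R \<ltimes> M)"
  proof (rule abelian_groupI)
    fix x assume "x \<in> carrier (R \<ltimes> M)"
    then show "\<exists>y\<in>carrier (R \<ltimes> M). y \<oplus>\<^bsub>R \<ltimes> M\<^esub> x = \<zero>\<^bsub>R \<ltimes> M\<^esub>"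
      by (intro bexI[of _ "(\<ominus> fst x, \<ominus>\<^bsub>M\<^esub> snd x)"]) (auto simp: R.l_neg M.l_neg)
  qed (auto simp: R.a_ac M.a_ac)
  show "comm_monoid (R \<ltimes> M)"
    by (rule comm_monoidI)
      (auto simp: R.m_ac M.a_ac smult_r_distr smult_assoc1[symmetric])
qed (auto simp: R.l_distr smult_l_distr smult_r_distr M.a_ac)

lemma fst_ring_hom: "fst \<in> ring_hom (R \<ltimes> M) R"
  by (rule ring_hom_memI) auto

lemma embed_ring_hom: "(\<lambda>r. (r, \<zero>\<^bsub>M\<^esub>)) \<in> ring_hom R (R \<ltimes> M)"
  by (rule ring_hom_memI) auto

lemma
  assumes "local_ring R"
  shows idealization_local: "local_ring (R \<ltimes> M)"
    and idealization_max_ideal: "max_ideal (R \<ltimes> M) = max_ideal R \<times> carrier M"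
proof -
  interpret R': local_ring R by fact
  interpret A: cring "R \<ltimes> M" by (rule idealization_cring)
  have m: "a \<in> carrier R" if "a \<in> max_ideal R" for a using R'.mm.a_subset that by blast
  have I: "ideal (max_ideal R \<times> carrier M) (R \<ltimes> M)"
    using m by (intro A.ideal_criterion) (auto intro: R'.mm.I_l_closed)
  have one: "\<one>\<^bsub>R \<ltimes> M\<^esub> \<notin> max_ideal R \<times> carrier M" using R'.one_notin_max_ideal by simp
  have units: "a \<in> Units (R \<ltimes> M)" if a: "a \<in> carrier (R \<ltimes> M)" "a \<notin> max_ideal R \<times> carrier M" for a
  proof -
    obtain r x where rx: "a = (r, x)" "r \<in> carrier R" "x \<in> carrier M" "r \<notin> max_ideal R" using a by auto
    then have u: "r \<in> Units R" using R'.Units_if_notin by simp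
    \<comment> \<open>Solving (r, x)(s, y) = (1, 0): s is the inverse of r, and r y + s x = 0 gives
      y = -s (s x).\<close>
    let ?b = "(inv r, \<ominus>\<^bsub>M\<^esub> (inv r \<odot>\<^bsub>M\<^esub> (inv r \<odot>\<^bsub>M\<^esub> x)))"
    have b: "?b \<in> carrier (R \<ltimes> M)" using rx u by simp
    have "r \<odot>\<^bsub>M\<^esub> (inv r \<odot>\<^bsub>M\<^esub> y) = y" if "y \<in> carrier M" for y
      using that u rx smult_assoc1[of r "inv r" y] by simp
    then have ab: "a \<otimes>\<^bsub>R \<ltimes> M\<^esub> ?b = \<one>\<^bsub>R \<ltimes> M\<^esub>"
      using rx u by (simp add: smult_r_minus M.l_neg)
    then have "?b \<otimes>\<^bsub>R \<ltimes> M\<^esub> a = \<one>\<^bsub>R \<ltimes> M\<^esub>" using A.m_comm[OF a(1) b] by simp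
    with ab a(1) b show ?thesis unfolding Units_def by blast
  qed
  show "local_ring (R \<ltimes> M)" "max_ideal (R \<ltimes> M) = max_ideal R \<times> carrier M"
    using A.max_idealI(2,3)[OF I one units] by auto
qed

text \<open>As an R-module, R |x M is generated by (1, 0) and the generators of M. Ideals pull back
  along \<open>\<pi>\<close> to submodules of a free R-module of finite rank; these are finitely
  generated, and the images of their generators generate the ideal.\<close>

lemma idealization_noetherian:
  assumes noeth: "noetherian_ring R" and fg: "finitely_generated_module R M"
  shows "noetherian_ring (R \<ltimes> M)"
proof -
  interpret A: cring "R \<ltimes> M" by (rule idealization_cring)
  obtain G where G: "finite G" "G \<subseteq> carrier M" "span G = carrier M"
    using fg unfolding finitely_generated_module_def by blast
  \<comment> \<open>The index \<open>None\<close> stands for the summand R. Its value under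
    \<open>c\<close> is zero, so the coordinate there leaves the component in M alone.\<close>
  define S where "S = insert None (Some ` G)"
  define c where "c s = (case s of None \<Rightarrow> \<zero>\<^bsub>M\<^esub> | Some g \<Rightarrow> g)" for s
  have S: "finite S" "None \<in> S" using G by (simp_all add: S_def)
  have c: "c \<in> S \<rightarrow> carrier M" using G by (auto simp: S_def c_def)
  let ?F = "\<F> S"
  interpret F: Module.module R ?F by (rule free_is_module)
  let ?l = "free_lift R M S c"
  interpret l: mod_hom R ?F M ?l by (rule mod_homI[OF free_is_module module_axioms free_lift_hom[OF c]])
  define \<pi> where "\<pi> x = (x None, ?l x)" for x
  have \<pi>_closed: "\<pi> x \<in> carrier (R \<ltimes> M)" if "x \<in> carrier ?F" for x
    using that S free_coord[OF that S(2)] by (simp add: \<pi>_def)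
  have \<pi>_add: "\<pi> (x \<oplus>\<^bsub>?F\<^esub> y) = \<pi> x \<oplus>\<^bsub>R \<ltimes> M\<^esub> \<pi> y" if "x \<in> carrier ?F" "y \<in> carrier ?F" for x y
    using that S by (simp add: \<pi>_def)
  have \<pi>_smult: "\<pi> (a \<odot>\<^bsub>?F\<^esub> x) = (a, \<zero>\<^bsub>M\<^esub>) \<otimes>\<^bsub>R \<ltimes> M\<^esub> \<pi> x" if "a \<in> carrier R" "x \<in> carrier ?F" for a x
    using that S free_coord[OF that(2) S(2)] by (simp add: \<pi>_def)
  have \<pi>_surj: "\<exists>x\<in>carrier ?F. \<pi> x = a" if a: "a \<in> carrier (R \<ltimes> M)" for a
  proof -
    obtain r m where rm: "a = (r, m)" "r \<in> carrier R" "m \<in> carrier M" using a by auto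
    have "G \<subseteq> c ` S" by (force simp: S_def c_def)
    then have "carrier M \<subseteq> ?l ` carrier ?F"
      using span_is_monotone[of G "c ` S"] G(3) free_lift_image[OF S(1) c] by simp
    then obtain x where x: "x \<in> carrier ?F" "m = ?l x" using rm(3) by blast
    \<comment> \<open>This corrects the coordinate at \<open>None\<close> to \<open>r\<close> and is
      invisible to \<open>?l\<close>.\<close>
    let ?e = "(r \<ominus> x None) \<odot>\<^bsub>?F\<^esub> free_basis R S None"
    have xN: "x None \<in> carrier R" by (rule free_coord[OF x(1) S(2)])
    have e: "?e \<in> carrier ?F" using rm xN S by simp
    have "?l ?e = \<zero>\<^bsub>M\<^esub>" using rm xN S free_lift_basis[OF c S(2)] by (simp add: c_def)
    then have "\<pi> (x \<oplus>\<^bsub>?F\<^esub> ?e) = a"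
      using x e S xN rm R.add_diff_self[of "x None" r] by (simp add: \<pi>_def)
    with x e show ?thesis by (intro bexI[of _ "x \<oplus>\<^bsub>?F\<^esub> ?e"]) auto
  qed
  have preimage: "submodule R {x \<in> carrier ?F. \<pi> x \<in> J} ?F" if J: "ideal J (R \<ltimes> M)" for J
  proof -
    interpret J: ideal J "R \<ltimes> M" by (rule J)
    have "\<pi> \<zero>\<^bsub>?F\<^esub> = \<zero>\<^bsub>R \<ltimes> M\<^esub>" using S by (simp add: \<pi>_def)
    moreover have "(a, \<zero>\<^bsub>M\<^esub>) \<otimes>\<^bsub>R \<ltimes> M\<^esub> \<pi> x \<in> J" if "a \<in> carrier R" "\<pi> x \<in> J" for a x
      using that J.I_l_closed[of "\<pi> x" "(a, \<zero>\<^bsub>M\<^esub>)"] by (simp del: idealization_simps(2))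
    ultimately show ?thesis
      by unfold_locales (auto simp del: idealization_simps simp: \<pi>_add \<pi>_smult J.a_closed J.zero_closed)
  qed
  show ?thesis
  proof (rule A.noetherian_ringI)
    fix J assume J: "ideal J (R \<ltimes> M)"
    interpret J: ideal J "R \<ltimes> M" by (rule J)
    obtain H where fgH: "finite H \<and> H \<subseteq> {x \<in> carrier ?F. \<pi> x \<in> J} \<and> F.span H = {x \<in> carrier ?F. \<pi> x \<in> J}"
      using free_submodule_finitely_generated[OF R.is_cring noeth S(1) preimage[OF J]] ..
    note H = fgH[THEN conjunct1] fgH[THEN conjunct2, THEN conjunct1] fgH[THEN conjunct2, THEN conjunct2]
    have HA: "\<pi> ` H \<subseteq> carrier (R \<ltimes> M)" using H(2) \<pi>_closed by blast
    have HI: "ideal (Idl\<^bsub>R \<ltimes> M\<^esub> (\<pi> ` H)) (R \<ltimes> M)" by (rule A.genideal_ideal[OF HA])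
    have "J \<subseteq> Idl\<^bsub>R \<ltimes> M\<^esub> (\<pi> ` H)"
    proof
      fix a assume a: "a \<in> J"
      then have "a \<in> carrier (R \<ltimes> M)" using J.a_subset by blast
      then obtain x where x: "x \<in> carrier ?F" "\<pi> x = a" using \<pi>_surj by blast
      have "H \<subseteq> {x \<in> carrier ?F. \<pi> x \<in> Idl\<^bsub>R \<ltimes> M\<^esub> (\<pi> ` H)}"
        using H(2) A.genideal_self[OF HA] by blast
      then have "F.span H \<subseteq> {x \<in> carrier ?F. \<pi> x \<in> Idl\<^bsub>R \<ltimes> M\<^esub> (\<pi> ` H)}"
        by (rule F.span_is_subset[OF _ preimage[OF HI]])
      then show "a \<in> Idl\<^bsub>R \<ltimes> M\<^esub> (\<pi> ` H)" using x a unfolding H(3) by blast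
    qed
    moreover have "Idl\<^bsub>R \<ltimes> M\<^esub> (\<pi> ` H) \<subseteq> J"
      by (rule A.genideal_minimal[OF J]) (use H(2) in blast)
    ultimately have "J = Idl\<^bsub>R \<ltimes> M\<^esub> (\<pi> ` H)" ..
    then show "\<exists>A\<subseteq>carrier (R \<ltimes> M). finite A \<and> J = Idl\<^bsub>R \<ltimes> M\<^esub> A"
      using HA H(1) by (intro exI[of _ "\<pi> ` H"] conjI finite_imageI)
  qed
qed

end

text \<open>The same generators serve, since a coefficient r is realised over A by
  \<open>\<iota> r\<close>, which acts as r.\<close>

lemma restrict_scalars_finitely_generated:
  assumes A: "cring A" and \<rho>: "\<rho> \<in> ring_hom A R" and \<iota>: "\<iota> \<in> ring_hom R A"
    and \<rho>_\<iota>: "\<And>r. r \<in> carrier R \<Longrightarrow> \<rho> (\<iota> r) = r"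
    and N: "finitely_generated_module R N"
  shows "finitely_generated_module A (restrict_scalars \<rho> N)"
proof -
  interpret N: Module.module R N using N by (simp add: finitely_generated_module_def)
  interpret N': Module.module A "restrict_scalars \<rho> N" by (rule restrict_scalars_module[OF A \<rho> N.module_axioms])
  obtain S where S: "finite S" "S \<subseteq> carrier N" "N.span S = carrier N"
    using N unfolding finitely_generated_module_def by blast
  have S': "S \<subseteq> carrier (restrict_scalars \<rho> N)" using S by simp
  have "carrier N \<subseteq> N'.span S"
  proof
    fix x assume "x \<in> carrier N"
    then obtain a where a: "a \<in> S \<rightarrow> carrier R" "N.lincomb a S = x"
      using N.finite_in_span[OF S(1,2)] S(3) by blast
    have "N'.lincomb (\<lambda>s. \<iota> (a s)) S = (\<Oplus>\<^bsub>N\<^esub>s\<in>S. \<rho> (\<iota> (a s)) \<odot>\<^bsub>N\<^esub> s)"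
      unfolding N'.lincomb_def by (subst finsum_eq_of_same_group[where N = N]) simp_all
    also have "\<dots> = N.lincomb a S"
      unfolding N.lincomb_def using a(1) S(2) \<rho>_\<iota> by (intro N.M.finsum_cong') (auto simp: Pi_iff)
    finally have "x = N'.lincomb (\<lambda>s. \<iota> (a s)) S" using a(2) by simp
    moreover have "(\<lambda>s. \<iota> (a s)) \<in> S \<rightarrow> carrier A" using a(1) ring_hom_closed[OF \<iota>] by auto
    ultimately show "x \<in> N'.span S" unfolding N'.finite_span[OF S(1) S'] by blast
  qed
  moreover have "N'.span S \<subseteq> carrier (restrict_scalars \<rho> N)"
    using N'.span_is_submodule[OF S'] by (simp add: submodule_def)
  ultimately show ?thesis
    unfolding finitely_generated_module_def using S(1) S' N'.module_axioms by auto
qed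

section \<open>Betti numbers over the idealization\<close>

lemma mhom_restrict_scalars:
  assumes "\<phi> \<in> ring_hom A R" "f \<in> mhom R L L'"
  shows "f \<in> mhom A (restrict_scalars \<phi> L) (restrict_scalars \<phi> L')"
  using assms(2) ring_hom_closed[OF assms(1)] by (auto simp: mhom_def)

lemma ring_hom_mhom:
  assumes "\<phi> \<in> ring_hom A R"
  shows "\<phi> \<in> mhom A (self_module A) (restrict_scalars \<phi> (self_module R))"
  using ring_hom_memE[OF assms] by (auto simp: mhom_def)

lemma cyclic_finitely_generated:
  assumes L: "Module.module R L" and \<theta>: "\<theta> \<in> mhom R (self_module R) L" "\<theta> ` carrier R = carrier L"
  shows "finitely_generated_module R L"
proof -
  interpret L: Module.module R L by (rule L)
  have one: "\<theta> \<one>\<^bsub>R\<^esub> \<in> carrier L" using \<theta>(2) by blast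
  then interpret Sp: submodule R "L.span {\<theta> \<one>\<^bsub>R\<^esub>}" L by (intro L.span_is_submodule) simp
  have "\<theta> \<one>\<^bsub>R\<^esub> \<in> L.span {\<theta> \<one>\<^bsub>R\<^esub>}" using L.in_own_span[of "{\<theta> \<one>\<^bsub>R\<^esub>}"] one by simp
  then have "\<theta> a \<in> L.span {\<theta> \<one>\<^bsub>R\<^esub>}" if "a \<in> carrier R" for a
    using Sp.smult_closed[OF that] module_hom_smult[OF \<theta>(1) that, of "\<one>\<^bsub>R\<^esub>"] that by simp
  then have "\<theta> ` carrier R \<subseteq> L.span {\<theta> \<one>\<^bsub>R\<^esub>}" by (rule image_subsetI)
  then have "L.span {\<theta> \<one>\<^bsub>R\<^esub>} = carrier L" unfolding \<theta>(2) using Sp.subset by (rule subset_antisym[rotated])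
  then show ?thesis unfolding finitely_generated_module_def using L one by (intro conjI exI[of _ "{\<theta> \<one>\<^bsub>R\<^esub>}"]) simp_all
qed

text \<open>The product formula for Poincare series: the series of N over A is that of R over A
  times that of N over R. The summands are the ranks counted by \<open>card_idx\<close>.\<close>

lemma betti_retract:
  assumes A: "local_ring A" "noetherian_ring A" and R: "local_ring R" "noetherian_ring R"
    and \<iota>: "\<iota> \<in> ring_hom R A" and \<rho>: "\<rho> \<in> ring_hom A R"
    and \<rho>_\<iota>: "\<And>r. r \<in> carrier R \<Longrightarrow> \<rho> (\<iota> r) = r"
    and \<iota>m: "\<And>r. r \<in> max_ideal R \<Longrightarrow> \<iota> r \<in> max_ideal A"
    and F: "local_ring.minimal_resolution A (restrict_scalars \<rho> (self_module R)) Sf \<epsilon>f df"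
    and N: "finitely_generated_module R N"
  shows "betti A (restrict_scalars \<rho> N) i = (\<Sum>q\<le>i. card (Sf (i - q)) * betti R N q)"
proof -
  interpret A: local_ring A by (rule A)
  interpret R: local_ring R by (rule R)
  obtain b \<epsilon> d where G: "R.minimal_resolution N (\<lambda>i. {..<b i :: nat}) \<epsilon> d"
    using R.minimal_resolution_exists[OF R(2) N] by (elim exE)
  interpret algebra_retract A R \<rho> \<iota> Sf \<epsilon>f df N "\<lambda>i. {..<b i}" \<epsilon> d
    using F G \<iota> \<rho> \<rho>_\<iota>
    by (simp add: algebra_retract_def algebra_retract_axioms_def A.minimal_resolution_def R.minimal_resolution_def)
  have "A.minimal_resolution (restrict_scalars \<rho> N) idx aug bd"
    using total_minimal[OF A(1) R(1) \<iota>m] F G by (simp add: A.minimal_resolution_def R.minimal_resolution_def)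
  moreover have "finitely_generated_module A (restrict_scalars \<rho> N)"
    by (rule restrict_scalars_finitely_generated[OF A.is_cring \<rho> \<iota> \<rho>_\<iota> N])
  ultimately have "betti A (restrict_scalars \<rho> N) i = card (idx i)"
    using A.betti_minimal_resolution[OF A(2)] by blast
  also have "\<dots> = (\<Sum>q\<le>i. card (Sf (i - q)) * b q)" by (simp add: card_idx)
  also have "\<dots> = (\<Sum>q\<le>i. card (Sf (i - q)) * betti R N q)"
    using R.betti_minimal_resolution[OF R(2) N G] by simp
  finally show ?thesis .
qed

context Module.module
begin

text \<open>The exact sequence \<open>0 \<rightarrow> M \<rightarrow> R \<ltimes> M \<rightarrow> R \<rightarrow> 0\<close> extends a resolution of \<open>M\<close> to one of \<open>R\<close>.\<close>

lemma idealization_resolution_of_base: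
  assumes R: "local_ring R"
    and P: "local_ring.minimal_resolution (R \<ltimes> M) (restrict_scalars fst M) (\<lambda>i. {..<p i :: nat}) \<epsilon> d"
  shows "local_ring.minimal_resolution (R \<ltimes> M) (restrict_scalars fst (self_module R))
    (\<lambda>i. {..<case i of 0 \<Rightarrow> 1 | Suc j \<Rightarrow> p j}) (\<lambda>x. fst (x 0))
    (\<lambda>i. case i of 0 \<Rightarrow> \<lambda>x. \<lambda>t\<in>{..<1}. (\<zero>, \<epsilon> x) | Suc j \<Rightarrow> d j)"
    (is "local_ring.minimal_resolution ?A ?R ?S ?\<epsilon> ?d")
proof -
  interpret A: local_ring ?A by (rule idealization_local[OF R])
  interpret R: local_ring R by (rule R)
  have P': "free_res ?A (restrict_scalars fst M) (\<lambda>i. {..<p i}) \<epsilon> d"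
    using P by (simp add: A.minimal_resolution_def)
  interpret P: free_res ?A "restrict_scalars fst M" "\<lambda>i. {..<p i}" \<epsilon> d by (rule P')
  let ?F = "free_module ?A {..<1 :: nat}"
  have Rmod: "Module.module ?A ?R" by (rule restrict_scalars_module[OF A.is_cring fst_ring_hom R.self_is_module])
  have \<epsilon>M: "\<epsilon> x \<in> carrier M" if "x \<in> carrier (P.F 0)" for x using P.aug.f_im[OF that] by simp
  have hom0: "?\<epsilon> \<in> mhom ?A ?F ?R"
    by (rule mhom_comp[OF A.coord_hom ring_hom_mhom[OF fst_ring_hom]]) simp
  have surj: "?\<epsilon> ` carrier ?F = carrier ?R"
  proof
    show "?\<epsilon> ` carrier ?F \<subseteq> carrier ?R" using mhom_closed[OF hom0] by blast
    show "carrier ?R \<subseteq> ?\<epsilon> ` carrier ?F"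
    proof
      fix r assume "r \<in> carrier ?R"
      then show "r \<in> ?\<epsilon> ` carrier ?F"
        by (intro image_eqI[of _ _ "\<lambda>t\<in>{..<1}. (r, \<zero>\<^bsub>M\<^esub>)"]) (auto simp: A.free_carrier_finite)
    qed
  qed
  \<comment> \<open>M sits in R |x M as the ideal 0 \<times> M, and (r, m)(0, y) = (0, r y); so the
    embedding is linear when R |x M acts on M through \<open>fst\<close>.\<close>
  have incl: "(\<lambda>x. (\<zero>, \<epsilon> x)) \<in> mhom ?A (P.F 0) (self_module ?A)"
    unfolding mhom_def using \<epsilon>M by auto
  have hom1: "(\<lambda>x. \<lambda>t\<in>{..<1 :: nat}. (\<zero>, \<epsilon> x)) \<in> mhom ?A (P.F 0) ?F"
    by (rule A.hom_into_free) (use incl in simp_all)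
  have ex0: "(\<lambda>x. \<lambda>t\<in>{..<1 :: nat}. (\<zero>, \<epsilon> x)) ` carrier (P.F 0) = {x \<in> carrier ?F. ?\<epsilon> x = \<zero>\<^bsub>?R\<^esub>}"
  proof
    show "(\<lambda>x. \<lambda>t\<in>{..<1 :: nat}. (\<zero>, \<epsilon> x)) ` carrier (P.F 0) \<subseteq> {x \<in> carrier ?F. ?\<epsilon> x = \<zero>\<^bsub>?R\<^esub>}"
      using \<epsilon>M by (intro image_subsetI) (simp add: A.free_carrier_finite)
    show "{x \<in> carrier ?F. ?\<epsilon> x = \<zero>\<^bsub>?R\<^esub>} \<subseteq> (\<lambda>x. \<lambda>t\<in>{..<1 :: nat}. (\<zero>, \<epsilon> x)) ` carrier (P.F 0)"
    proof clarify
      fix x assume x: "x \<in> carrier ?F" "fst (x 0) = \<zero>\<^bsub>?R\<^esub>"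
      have "x 0 \<in> carrier R \<times> carrier M" using x(1) by (auto simp: A.free_carrier_finite)
      then have "snd (x 0) \<in> \<epsilon> ` carrier (P.F 0)" using P.aug_surj by auto
      then obtain y where y: "y \<in> carrier (P.F 0)" "snd (x 0) = \<epsilon> y" by blast
      have x0: "x 0 = (\<zero>, \<epsilon> y)" using x(2) y(2) by (simp add: prod_eq_iff)
      have "(\<lambda>t\<in>{..<1 :: nat}. (\<zero>, \<epsilon> y)) \<in> carrier ?F" using \<epsilon>M[OF y(1)] by (auto simp: A.free_carrier_finite)
      then have "x = (\<lambda>t\<in>{..<1 :: nat}. (\<zero>, \<epsilon> y))"
        by (intro A.free_eqI[OF x(1)]) (simp_all add: x0)
      then show "x \<in> (\<lambda>x. \<lambda>t\<in>{..<1 :: nat}. (\<zero>, \<epsilon> x)) ` carrier (P.F 0)" using y(1) by blast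
    qed
  qed
  \<comment> \<open>The embedding of M is injective, so composing with it leaves the kernel of
    \<open>\<epsilon>\<close> unchanged.\<close>
  have ex1: "d 0 ` carrier (P.F (Suc 0)) = {x \<in> carrier (P.F 0). (\<lambda>t\<in>{..<1 :: nat}. (\<zero>, \<epsilon> x)) = \<zero>\<^bsub>?F\<^esub>}"
  proof -
    have "(\<lambda>t\<in>{..<1 :: nat}. (\<zero>, \<epsilon> x)) = \<zero>\<^bsub>?F\<^esub> \<longleftrightarrow> \<epsilon> x = \<zero>\<^bsub>M\<^esub>" for x
    proof
      assume "(\<lambda>t\<in>{..<1 :: nat}. (\<zero>, \<epsilon> x)) = \<zero>\<^bsub>?F\<^esub>"
      from fun_cong[OF this, of 0] show "\<epsilon> x = \<zero>\<^bsub>M\<^esub>" by (simp add: A.free_zero)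
    qed (simp add: A.free_zero)
    then show ?thesis using P.exact_0 by simp
  qed
  have "resolution ?A ?R ?S ?\<epsilon> ?d"
    unfolding resolution_def Let_def
  proof (intro conjI allI)
    show "?\<epsilon> \<in> mhom ?A (free_module ?A (?S 0)) ?R" using hom0 by simp
    show "?\<epsilon> ` carrier (free_module ?A (?S 0)) = carrier ?R" using surj by simp
    show "?d 0 ` carrier (free_module ?A (?S 1)) = {x \<in> carrier (free_module ?A (?S 0)). ?\<epsilon> x = \<zero>\<^bsub>?R\<^esub>}"
      using ex0 by simp
    fix i
    show "?d i \<in> mhom ?A (free_module ?A (?S (Suc i))) (free_module ?A (?S i))"
      using hom1 P.d_hom by (cases i) simp_all
    show "?d (Suc i) ` carrier (free_module ?A (?S (Suc (Suc i)))) =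
        {x \<in> carrier (free_module ?A (?S (Suc i))). ?d i x = \<zero>\<^bsub>free_module ?A (?S i)\<^esub>}"
      using ex1 P.exact_Suc by (cases i) simp_all
  qed
  \<comment> \<open>In degree 0 the image consists of elements of 0 \<times> M, which is part of the
    maximal ideal m \<times> M; the later differentials belong to the given minimal
    resolution.\<close>
  moreover have "?d i x s \<in> max_ideal ?A" if "x \<in> carrier (free_module ?A (?S (Suc i)))" "s \<in> ?S i" for i x s
  proof (cases i)
    case 0
    then show ?thesis using that \<epsilon>M[of x] by (simp add: idealization_max_ideal[OF R])
  next
    case (Suc j)
    then show ?thesis using that P by (simp add: A.minimal_resolution_def)
  qed
  ultimately show ?thesis
    unfolding A.minimal_resolution_def free_res_def free_res_axioms_def using Rmod by blast
qed

end

theorem proposition4p2: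
  fixes R :: "('a, 'r) ring_scheme"
    and M :: "('a, 'b, 'm) module_scheme"
    and N :: "('a, 'c, 'n) module_scheme"
  assumes "noetherian_local_ring R"
    and "finitely_generated_module R M" and "carrier M \<noteq> {\<zero>\<^bsub>M\<^esub>}"
    and "finitely_generated_module R N" and "carrier N \<noteq> {\<zero>\<^bsub>N\<^esub>}"
  shows "betti (R \<ltimes> M) (restrict_scalars fst N) 0 = betti R N 0
    \<and> betti (R \<ltimes> M) (restrict_scalars fst N) 1 = betti R N 0 * betti R M 0 + betti R N 1
    \<and> edim (R \<ltimes> M) = betti R M 0 + edim R
    \<and> betti (R \<ltimes> M) (restrict_scalars fst N) 2 =
        betti R N 0 * (betti R M 0)\<^sup>2 + betti R N 0 * betti R M 1 + betti R M 0 * betti R N 1 + betti R N 2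
    \<and> (\<forall>i. betti (R \<ltimes> M) (restrict_scalars fst N) i \<ge>
        betti R M 0 * (case i of 0 \<Rightarrow> 0 | Suc j \<Rightarrow> betti R N j) + betti R N i)"
proof -
  let ?A = "R \<ltimes> M"
  interpret M: Module.module R M using assms(2) by (simp add: finitely_generated_module_def)
  have R: "local_ring R" "noetherian_ring R"
    using noetherian_local_imp_local assms(1) by (auto simp: noetherian_local_ring_def)
  interpret R: local_ring R by (rule R)
  have A: "local_ring ?A" "noetherian_ring ?A"
    using M.idealization_local[OF R(1)] M.idealization_noetherian[OF R(2) assms(2)] by auto
  interpret A: local_ring ?A by (rule A)
  have \<iota>: "(\<lambda>r. (r, \<zero>\<^bsub>M\<^esub>)) \<in> ring_hom R ?A" by (rule M.embed_ring_hom)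
  have \<rho>: "fst \<in> ring_hom ?A R" by (rule M.fst_ring_hom)
  have mA: "max_ideal ?A = max_ideal R \<times> carrier M" by (rule M.idealization_max_ideal[OF R(1)])
  have "finitely_generated_module ?A (restrict_scalars fst M)"
    by (rule restrict_scalars_finitely_generated[OF A.is_cring \<rho> \<iota> _ assms(2)]) simp
  from A.minimal_resolution_exists[OF A(2) this] obtain p \<epsilon> d
    where P: "A.minimal_resolution (restrict_scalars fst M) (\<lambda>i. {..<p i :: nat}) \<epsilon> d" by (elim exE)
  define f where "f i = (case i of 0 \<Rightarrow> 1 | Suc j \<Rightarrow> p j)" for i
  \<comment> \<open>Stated for all \<open>L\<close>, since it is applied to M, to N and to the
    residue field, whose element types differ.\<close>
  have betti_A: "betti ?A (restrict_scalars fst L) i = (\<Sum>q\<le>i. f (i - q) * betti R L q)"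
    if "finitely_generated_module R L" for L :: "('a, 'x, 'y) module_scheme" and i
    using betti_retract[OF A R \<iota> \<rho> _ _ M.idealization_resolution_of_base[OF R(1) P] that, of i]
    by (simp add: mA f_def)
  have f0: "f 0 = 1" by (simp add: f_def)
  \<comment> \<open>Here \<open>betti_A\<close> is applied to M itself, as \<open>p j\<close> is a
    Betti number of M over R |x M.\<close>
  have f_Suc: "f (Suc j) = (\<Sum>q\<le>j. f (j - q) * betti R M q)" for j
  proof -
    have "p j = betti ?A (restrict_scalars fst M) j"
      using A.betti_eqI[OF P A.minimal_resolution_imp_free[OF P]] by simp
    then show ?thesis using betti_A[OF assms(2)] by (simp add: f_def)
  qed
  have f1: "f 1 = betti R M 0" using f_Suc[of 0] f0 by simp
  have f2: "f 2 = (betti R M 0)\<^sup>2 + betti R M 1"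
    using f_Suc[of 1] f0 f1 by (simp add: numeral_2_eq_2 power2_eq_square)
  note betti_N = betti_A[OF assms(4)]
  have edim: "edim ?A = betti R M 0 + edim R"
  proof -
    let ?k = "residue_module R"
    \<comment> \<open>This is the residue field of R |x M: a pair acts as zero iff its first
      component is in m, that is, iff it lies in m \<times> M. So \<open>betti_A\<close> in degree 1
      relates the two embedding dimensions.\<close>
    let ?k' = "restrict_scalars (fst :: 'a \<times> 'b \<Rightarrow> 'a) ?k"
    have surj: "(\<lambda>a. max_ideal R +>\<^bsub>R\<^esub> a) ` carrier R = carrier ?k" by (simp add: R.residue_module_carrier)
    have ker: "max_ideal R +>\<^bsub>R\<^esub> a = \<zero>\<^bsub>?k\<^esub> \<longleftrightarrow> a \<in> max_ideal R" if "a \<in> carrier R" for a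
      using R.residue_eq_zero_iff[OF that] by (simp add: R.residue_module_zero)
    have k_fg: "finitely_generated_module R ?k"
      by (rule cyclic_finitely_generated[OF R.residue_module_is_module R.residue_hom surj])
    have hom_A: "(\<lambda>a. max_ideal R +>\<^bsub>R\<^esub> fst a) \<in> mhom ?A (self_module ?A) ?k'"
      by (rule mhom_comp[OF ring_hom_mhom[OF \<rho>] mhom_restrict_scalars[OF \<rho> R.residue_hom]])
    have "fst ` carrier ?A = carrier R" using M.M.zero_closed by (force simp: image_iff)
    then have surj_A: "(\<lambda>a. max_ideal R +>\<^bsub>R\<^esub> fst a) ` carrier ?A = carrier ?k'"
      using surj by (simp add: image_image[symmetric, of "\<lambda>a. max_ideal R +>\<^bsub>R\<^esub> a" fst])
    have ker_A: "max_ideal R +>\<^bsub>R\<^esub> fst a = \<zero>\<^bsub>?k'\<^esub> \<longleftrightarrow> a \<in> max_ideal ?A" if "a \<in> carrier ?A" for a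
      using that ker[of "fst a"] by (auto simp: mA mem_Times_iff)
    have "edim ?A = betti ?A ?k' 1"
      by (rule A.betti_cyclic_residue(2)[OF A(2) restrict_scalars_module[OF A.is_cring \<rho> R.residue_module_is_module]
            hom_A surj_A ker_A, symmetric])
    also have "\<dots> = f 1 * betti R ?k 0 + f 0 * betti R ?k 1" by (simp add: betti_A[OF k_fg])
    also have "\<dots> = betti R M 0 + edim R"
      using R.betti_cyclic_residue[OF R(2) R.residue_module_is_module R.residue_hom surj ker] f0 f1 by simp
    finally show ?thesis .
  qed
  have "betti R M 0 * (case i of 0 \<Rightarrow> 0 | Suc j \<Rightarrow> betti R N j) + betti R N i \<le> betti ?A (restrict_scalars fst N) i" for i
  proof (cases i)
    case 0
    then show ?thesis by (simp add: betti_N f0)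
  next
    case (Suc j)
    \<comment> \<open>All summands are natural numbers, and the two that are kept have coefficients
      \<open>f 1\<close> and \<open>f 0\<close>.\<close>
    have "(\<Sum>q\<in>{j, Suc j}. f (i - q) * betti R N q) \<le> (\<Sum>q\<le>i. f (i - q) * betti R N q)"
      using Suc by (intro sum_mono2) auto
    then show ?thesis using Suc f0 f1 by (simp add: betti_N Suc_diff_le)
  qed
  moreover have "betti ?A (restrict_scalars fst N) 2 =
      betti R N 0 * (betti R M 0)\<^sup>2 + betti R N 0 * betti R M 1 + betti R M 0 * betti R N 1 + betti R N 2"
  proof -
    have "betti ?A (restrict_scalars fst N) 2 = f 2 * betti R N 0 + f 1 * betti R N 1 + f 0 * betti R N 2"
      by (simp add: betti_N numeral_2_eq_2)
    then show ?thesis unfolding f0 f1 f2 by (simp add: algebra_simps)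
  qed
  ultimately show ?thesis
    using edim f0 f1 by (simp add: betti_N)
qed

end
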